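(* The images under $F$ of the regular atoms of the return map $L$ cover all of $\Omega\setminus\mathcal E$ (the complement of the main island), apart from a set of area $O(\lambda^2)$ as $\lambda\to0^+$. That is, $(\Omega\setminus\mathcal E)\setminus\bigcup_{t\ge0}F^t\bigl(\bigcup_{m,n}\Lambda_{m,n}\bigr)$ has area $O(\lambda^2)$.
   Context: For $\lambda>0$ small let $\Omega=[0,1)^2$, $F:\Omega\to\Omega$, $F(x,y)=(\lambda x-y+\iota(x,y),x)$, $\iota(x,y)=-\lfloor\lambda x-y\rfloor$, $G(x,y)=(y,x)$. Let $\mathcal Q(U,V)=U_xV_x+U_yV_y-\frac\lambda2(U_xV_y+U_yV_x)$; areas are taken in this metric. Put $\theta=\arcsin(\lambda/2)$, $N=\lfloor\frac{\pi}{8\theta}-\frac14\rfloor$, $M=\lfloor\frac{\pi}{4\theta}-\frac12\rfloor$. Let $c=(\frac1{2-\lambda},\frac1{2-\lambda})$ (fixed point of $F$). The main island $\mathcal E$ is the elliptical disc $\mathcal Q(z-c,z-c)\le(1-\lambda^2/4)(\frac{1-\lambda}{2-\lambda})^2$, whose boundary is tangent to $y=1$ and $x=1$. For $n\ge0$ let $\ell_n$ be the image of the line $y=1$ under $z\mapsto c+C^{4n}(z-c)$, $C=\begin{pmatrix}\lambda&-1\\1&0\end{pmatrix}$; $Q_0(n)=\ell_0\cap G(\ell_n)$, $Q_1(n)=\ell_1\cap G(\ell_n)$. For $1\le n\le N-1$, $\Lambda_n^{\rm in}$ is the quadrilateral with consecutive vertices $Q_0(n),Q_0(n-1),Q_1(n-1),Q_1(n)$.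 Let $P_0(m)=\left(\frac12\left(1+2\lambda+\frac{\tan\theta}{\tan(2m+1)\theta}\right),1\right)$ for $1\le m\le M$; $P_1(m)=\left(\frac12\left(1+2\lambda-\lambda^2+\lambda^4+(1-3\lambda^2+\lambda^4)\frac{\tan\theta}{\tan(2m-1)\theta}\right),\,1+\frac{\lambda^3}2+\frac\lambda2(\lambda^2-2)\frac{\tan\theta}{\tan(2m-1)\theta}\right)$ for $2\le m\le M$; $P_1(0)=\left(1,\frac{2-\lambda-\lambda^2}{2-4\lambda^2+\lambda^4}\right)$, $P_1(1)=\left(1,\frac{2-2\lambda-4\lambda^2+\lambda^3+\lambda^4}{2-9\lambda^2+6\lambda^4-\lambda^6}\right)$. For $3\le m\le M$, $\Lambda_m^{\rm out}$ is the quadrilateral $[P_0(m),P_0(m-1),P_1(m-1),P_1(m)]$; $\Lambda_1^{\rm out}=[P_0(1),(1,1),P_1(0),P']$ with $P'=(1-2\lambda^2+6\lambda^3+\lambda^4-5\lambda^5+\lambda^7,\ 1-\lambda+3\lambda^2+\lambda^3-4\lambda^4+\lambda^6)$; $\Lambda_2^{\rm out}=[P_0(2),P_0(1),P'',P_1(1),P''',P_1(2)]$ with $D=1-6\lambda^2+5\lambda^4-\lambda^6$, $P''=\left(1,\frac{1-\lambda-3\lambda^2+\lambda^3+\lambda^4}{D}\right)$, $P'''=\left(\frac{1-6\lambda^2-3\lambda^3+11\lambda^4+4\lambda^5-12\lambda^6-\lambda^7+6\lambda^8-\lambda^{10}}{D},\frac{1-\lambda-4\lambda^2+3\lambda^3+4\lambda^4-7\lambda^5-\lambda^6+5\lambda^7-\lambda^9}{D}\right)$.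 The regular atoms of the return map $L$ are the non-trivial intersections $\Lambda_{m,n}=\Lambda_m^{\rm out}\cap\Lambda_n^{\rm in}$, $1\le m\le M$, $1\le n\le N-1$ (inclusion or exclusion of polygon boundaries is irrelevant for area). Here $L$ is the first-return map induced by $F$ on a domain $\Lambda$ near the corner $(1,1)$ which contains all these polygons. *)

theory Defs
  imports "HOL-Analysis.Analysis" "HOL-Library.Landau_Symbols"
begin

type_synonym point = "real \<times> real"

definition Omega :: "point set" where
  "Omega = {0..<1} \<times> {0..<1}"

definition iota :: "real \<Rightarrow> point \<Rightarrow> int" where
  "iota lam = (\<lambda>(x, y). - \<lfloor>lam * x - y\<rfloor>)"

(* A total function; only its restriction to Omega (which it maps to itself) is meaningful. *)
definition F :: "real \<Rightarrow> point \<Rightarrow> point" where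
  "F lam = (\<lambda>(x, y). (lam * x - y + real_of_int (iota lam (x, y)), x))"

definition G :: "point \<Rightarrow> point" where
  "G = (\<lambda>(x, y). (y, x))"

definition Cmap :: "real \<Rightarrow> point \<Rightarrow> point" where
  "Cmap lam = (\<lambda>(x, y). (lam * x - y, x))"

definition Qform :: "real \<Rightarrow> point \<Rightarrow> point \<Rightarrow> real" where
  "Qform lam U V = fst U * fst V + snd U * snd V - lam / 2 * (fst U * snd V + snd U * fst V)"

(* Area of the constant metric Qform: Lebesgue measure times the square root of the Gram
   determinant of the standard basis. *)
definition area :: "real \<Rightarrow> point set \<Rightarrow> real" where
  "area lam A =
     sqrt (Qform lam (1, 0) (1, 0) * Qform lam (0, 1) (0, 1) - (Qform lam (1, 0) (0, 1))\<^sup>2)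
       * measure lborel A"

definition theta :: "real \<Rightarrow> real" where
  "theta lam = arcsin (lam / 2)"

definition Nmax :: "real \<Rightarrow> nat" where
  "Nmax lam = nat \<lfloor>pi / (8 * theta lam) - 1 / 4\<rfloor>"

definition Mmax :: "real \<Rightarrow> nat" where
  "Mmax lam = nat \<lfloor>pi / (4 * theta lam) - 1 / 2\<rfloor>"

definition centre :: "real \<Rightarrow> point" where
  "centre lam = (1 / (2 - lam), 1 / (2 - lam))"

definition main_island :: "real \<Rightarrow> point set" where
  "main_island lam =
     {z. Qform lam (z - centre lam) (z - centre lam)
           \<le> (1 - lam\<^sup>2 / 4) * ((1 - lam) / (2 - lam))\<^sup>2}"

definition polygon_boundary :: "point list \<Rightarrow> point set" where
  "polygon_boundary vs =
     (\<Union>i<length vs. closed_segment (vs ! i) (vs ! (Suc i mod length vs)))"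

(* The closed region bounded by the polygon with the given consecutive vertices. *)
definition polygon :: "point list \<Rightarrow> point set" where
  "polygon vs = polygon_boundary vs \<union> inside (polygon_boundary vs)"

definition ell :: "real \<Rightarrow> nat \<Rightarrow> point set" where
  "ell lam n =
     (\<lambda>z. centre lam + (Cmap lam ^^ (4 * n)) (z - centre lam)) ` {z. snd z = 1}"

(* For small lam > 0 the two lines meet in exactly one point in all cases used below but one:
   if pi / (8 theta) - 1/4 is an integer (and thus equal to N), then ell 1 = G ` ell (N - 1), and
   Qpt 1 (N - 1) is an arbitrary point of this line.  In that case the vertices of
   Lambda_in (N - 1) other than Qpt 0 (N - 2) all lie on this line, so the choice of the
   point affects Lambda_in (N - 1) only by a set of area 0. *)
definition Qpt :: "real \<Rightarrow> nat \<Rightarrow> nat \<Rightarrow> point" where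
  "Qpt lam i n = (SOME z. z \<in> ell lam i \<inter> G ` ell lam n)"

definition Lambda_in :: "real \<Rightarrow> nat \<Rightarrow> point set" where
  "Lambda_in lam n =
     polygon [Qpt lam 0 n, Qpt lam 0 (n - 1), Qpt lam 1 (n - 1), Qpt lam 1 n]"

(* For m = M the argument of tan may be pi/2; then tan is 0 here, and so is the quotient,
   in agreement with cot (pi/2) = 0. *)
definition P0 :: "real \<Rightarrow> nat \<Rightarrow> point" where
  "P0 lam m =
     (1 / 2 * (1 + 2 * lam + tan (theta lam) / tan ((2 * real m + 1) * theta lam)), 1)"

definition P1 :: "real \<Rightarrow> nat \<Rightarrow> point" where
  "P1 lam m =
     (if m = 0 then (1, (2 - lam - lam^2) / (2 - 4 * lam^2 + lam^4))
      else if m = 1 then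
        (1, (2 - 2 * lam - 4 * lam^2 + lam^3 + lam^4) / (2 - 9 * lam^2 + 6 * lam^4 - lam^6))
      else
        (1 / 2 * (1 + 2 * lam - lam^2 + lam^4
                  + (1 - 3 * lam^2 + lam^4)
                    * (tan (theta lam) / tan ((2 * real m - 1) * theta lam))),
         1 + lam^3 / 2
           + lam / 2 * (lam^2 - 2) * (tan (theta lam) / tan ((2 * real m - 1) * theta lam))))"

definition P' :: "real \<Rightarrow> point" where
  "P' lam =
     (1 - 2 * lam^2 + 6 * lam^3 + lam^4 - 5 * lam^5 + lam^7,
      1 - lam + 3 * lam^2 + lam^3 - 4 * lam^4 + lam^6)"

definition Dpoly :: "real \<Rightarrow> real" where
  "Dpoly lam = 1 - 6 * lam^2 + 5 * lam^4 - lam^6"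

definition P'' :: "real \<Rightarrow> point" where
  "P'' lam = (1, (1 - lam - 3 * lam^2 + lam^3 + lam^4) / Dpoly lam)"

definition P''' :: "real \<Rightarrow> point" where
  "P''' lam =
     ((1 - 6 * lam^2 - 3 * lam^3 + 11 * lam^4 + 4 * lam^5 - 12 * lam^6 - lam^7
         + 6 * lam^8 - lam^10) / Dpoly lam,
      (1 - lam - 4 * lam^2 + 3 * lam^3 + 4 * lam^4 - 7 * lam^5 - lam^6
         + 5 * lam^7 - lam^9) / Dpoly lam)"

(* Only used for 1 <= m <= M. *)
definition Lambda_out :: "real \<Rightarrow> nat \<Rightarrow> point set" where
  "Lambda_out lam m =
     (if m = 1 then polygon [P0 lam 1, (1, 1), P1 lam 0, P' lam]
      else if m = 2 then
        polygon [P0 lam 2, P0 lam 1, P'' lam, P1 lam 1, P''' lam, P1 lam 2]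
      else polygon [P0 lam m, P0 lam (m - 1), P1 lam (m - 1), P1 lam m])"

(* An intersection is non-trivial if it has positive area. *)
definition regular_atoms :: "real \<Rightarrow> point set set" where
  "regular_atoms lam =
     {A. \<exists>m\<in>{1..Mmax lam}. \<exists>n\<in>{1..Nmax lam - 1}.
           A = Lambda_out lam m \<inter> Lambda_in lam n \<and> area lam A > 0}"

(* The closed polygons have edges on x = 1 and y = 1, hence the intersection with Omega. *)
definition atom_orbits :: "real \<Rightarrow> point set" where
  "atom_orbits lam = (\<Union>t. (F lam ^^ t) ` (\<Union>(regular_atoms lam) \<inter> Omega))"


text \<open>
  The function \<^const>\<open>measure\<close> is 0 on non-measurable sets and on sets of infinite measure. The
  remaining lemmas show that the uncovered set is neither.
\<close>

lemma F_in_Omega: "z \<in> Omega \<Longrightarrow> F lam z \<in> Omega"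
  by (cases z) (auto simp: F_def iota_def Omega_def; linarith)

definition Finv :: "real \<Rightarrow> point \<Rightarrow> point" where
  "Finv lam = (\<lambda>(u, v). (v, frac (lam * v - u)))"

lemma Finv_in_Omega: "z \<in> Omega \<Longrightarrow> Finv lam z \<in> Omega"
  by (cases z) (auto simp: Finv_def Omega_def frac_ge_0 frac_lt_1)

lemma frac_eqI:
  fixes x y :: real
  assumes "0 \<le> y" "y < 1" "x - y = of_int k"
  shows "frac x = y"
proof -
  have "\<lfloor>x\<rfloor> = k"
    using assms by linarith
  then show ?thesis
    using assms by (simp add: frac_def)
qed

lemma Finv_F: "z \<in> Omega \<Longrightarrow> Finv lam (F lam z) = z"
  by (cases z)
    (auto simp: Finv_def F_def Omega_def
          intro!: frac_eqI[where k = "- iota lam z" for z])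

lemma F_Finv: "z \<in> Omega \<Longrightarrow> F lam (Finv lam z) = z"
proof (cases z)
  case (Pair u v)
  assume "z \<in> Omega"
  then have "frac (lam * v - frac (lam * v - u)) = u"
    unfolding Pair Omega_def
    by (intro frac_eqI[where k = "\<lfloor>lam * v - u\<rfloor>"]) (auto simp: frac_def)
  then show ?thesis
    by (simp add: Pair Finv_def F_def iota_def frac_def)
qed

lemma F_image_eq:
  assumes "A \<subseteq> Omega"
  shows "F lam ` A = Omega \<inter> Finv lam -` A"
proof (intro equalityI subsetI)
  fix z assume "z \<in> F lam ` A"
  with assms show "z \<in> Omega \<inter> Finv lam -` A"
    using F_in_Omega Finv_F by auto
next
  fix z assume "z \<in> Omega \<inter> Finv lam -` A"
  then have "z = F lam (Finv lam z)" "Finv lam z \<in> A"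
    by (auto simp: F_Finv)
  then show "z \<in> F lam ` A"
    by blast
qed

lemma Omega_borel: "Omega \<in> sets borel"
  unfolding Omega_def by (intro borel_Times) auto

lemma Finv_borel: "Finv lam \<in> borel_measurable borel"
proof -
  have "(\<lambda>z. (snd z, lam * snd z - fst z - of_int \<lfloor>lam * snd z - fst z\<rfloor>))
          \<in> (borel :: point measure) \<rightarrow>\<^sub>M borel"
    unfolding borel_prod[symmetric] by measurable
  moreover have "Finv lam = (\<lambda>z. (snd z, lam * snd z - fst z - of_int \<lfloor>lam * snd z - fst z\<rfloor>))"
    by (auto simp: Finv_def frac_def fun_eq_iff)
  ultimately show ?thesis
    by simp
qed

lemma F_pow_image_borel:
  assumes "A \<subseteq> Omega" "A \<in> sets borel"
  shows "(F lam ^^ t) ` A \<subseteq> Omega \<and> (F lam ^^ t) ` A \<in> sets borel"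
proof (induction t)
  case 0
  show ?case using assms by simp
next
  case (Suc t)
  let ?B = "(F lam ^^ t) ` A"
  have *: "(F lam ^^ Suc t) ` A = F lam ` ?B"
    by (simp add: image_comp)
  have "F lam ` ?B = Omega \<inter> Finv lam -` ?B"
    using Suc by (intro F_image_eq) auto
  moreover have "Finv lam -` ?B \<in> sets borel"
    using measurable_sets[OF Finv_borel, of ?B] Suc by simp
  ultimately show ?case
    unfolding * using Omega_borel by auto
qed

lemma polygon_borel: "polygon vs \<in> sets borel"
proof -
  have "closed (polygon_boundary vs)"
    unfolding polygon_boundary_def by (intro closed_UN) auto
  then show ?thesis
    unfolding polygon_def
    by (intro sets.Un borel_closed borel_open open_inside)
qed

lemma Lambda_borel: "Lambda_in lam n \<in> sets borel" "Lambda_out lam m \<in> sets borel"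
  by (auto simp: Lambda_in_def Lambda_out_def polygon_borel)

lemma atom_orbits_borel: "atom_orbits lam \<in> sets borel"
proof -
  have "regular_atoms lam
        \<subseteq> (\<lambda>(m, n). Lambda_out lam m \<inter> Lambda_in lam n) ` ({1..Mmax lam} \<times> {1..Nmax lam - 1})"
    by (auto simp: regular_atoms_def)
  then have "finite (regular_atoms lam)"
    by (rule finite_subset) auto
  moreover have "regular_atoms lam \<subseteq> sets borel"
    by (auto simp: regular_atoms_def Lambda_borel)
  ultimately have "\<Union>(regular_atoms lam) \<inter> Omega \<in> sets borel"
    using Omega_borel by (intro sets.Int sets.finite_Union)
  then show ?thesis
    unfolding atom_orbits_def
    using F_pow_image_borel[of "\<Union>(regular_atoms lam) \<inter> Omega"]
    by (intro sets.countable_UN) auto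
qed

lemma main_island_borel: "main_island lam \<in> sets borel"
  unfolding main_island_def Qform_def
  by (intro borel_closed closed_Collect_le continuous_intros)

lemma uncovered_fmeasurable:
  "(Omega - main_island lam) - atom_orbits lam \<in> fmeasurable lborel"
proof (rule fmeasurableI2)
  show "cbox (0, 0) (1, 1) \<in> fmeasurable (lborel :: point measure)"
    by simp
  show "(Omega - main_island lam) - atom_orbits lam \<subseteq> cbox (0, 0) (1, 1)"
    by (auto simp: Omega_def cbox_Pair_eq)
  show "(Omega - main_island lam) - atom_orbits lam \<in> sets lborel"
    using Omega_borel main_island_borel atom_orbits_borel by auto
qed

end

theory Submission
  imports Defs "HOL-Real_Asymp.Real_Asymp"
begin

text \<open>
  Write \<open>R\<close> for the rotation by \<open>pi / 2 - \<theta>\<close> about the centre of the island in the metric \<^const>\<open>Qform\<close>. On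
  the part \<open>y > \<lambda> x\<close> of the square the map is \<open>R\<close>, and on the thin triangle \<open>y \<le> \<lambda> x\<close> it is \<open>R\<close>
  followed by the translation by \<open>(-1, 0)\<close>. As \<open>R\<^sup>4\<close> is a clockwise rotation by the small angle \<open>4 \<theta>\<close>,
  a point outside the island drifts slowly along an ellipse until it leaves the square through one
  edge and comes back at the opposite one. The proof compares this drift with the strip between
  \<open>ell 0\<close> and \<open>ell 1\<close>, that is, with the points of the square that \<open>R\<^sup>-\<^sup>4\<close> moves to \<open>y \<ge> 1\<close>: they
  have just entered the corner at \<open>(1, 1)\<close>.

  \<^bold>\<open>Backward orbits reach the strip.\<close> Follow a point outside the island backwards by \<open>R\<^sup>-\<^sup>1\<close> until it
  leaves the square for the first time. It does so within \<open>O(1 / \<lambda>)\<close> steps, because the angles of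
  the orbit are \<open>4 \<theta>\<close> apart, unless the point lies in an annulus of width \<open>O(\<lambda>\<^sup>2)\<close> around the island
  (\<open>escape_time\<close>). If this takes at least four steps, then the backward orbit of the
  map has met the strip (\<open>strip_before_late_exit\<close>). Otherwise the orbit is at the left edge, at some
  \<open>(u, v)\<close> with \<open>u \<le> \<lambda> v\<close>, where \<open>v > 1/2\<close> after at most two further steps. There the backward map shifts the point by about \<open>\<lambda> (2 v - 1)\<close> towards the
  edge in every four steps, while \<open>v\<close> changes by \<open>O(\<lambda>\<^sup>2)\<close> only; after \<open>O(1 / \<lambda>)\<close> steps this sliding
  ends and a long passage, which comes from the strip, begins (\<open>sliding_reaches_strip\<close>). The
  argument fails only for \<open>v\<close> within \<open>O(\<lambda>)\<close> of \<open>0\<close>, \<open>1/2\<close> or \<open>1\<close>, where the points \<open>(u, v)\<close>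
  fill an area \<open>O(\<lambda>\<^sup>2)\<close>. The result is \<open>reaches_strip_or_edge_junction\<close>.

  \<^bold>\<open>The atoms fill the strip.\<close> The lines \<open>G ` ell n\<close> cut the strip into the quadrilaterals
  \<^const>\<open>Lambda_in\<close>, and the lines through \<open>P0 m\<close> and \<open>P1 m\<close>, with \<open>P''\<close> instead of
  \<open>P1 1\<close> for \<open>m = 1\<close>, cut it into the polygons \<^const>\<open>Lambda_out\<close>;
  the first line in either family that has a given point on its right determines the polygon that
  contains the point (\<open>in_Lambda_in_exists\<close>, \<open>in_Lambda_out_exists\<close>). What remains are null sets and
  the two ends of the strip. The strip has thickness \<open>O(\<lambda>\<^sup>2)\<close> at its left end and \<open>O(\<lambda>)\<close> at its right
  end, and the uncovered parts there have length \<open>O(\<lambda>)\<close> and \<open>O(\<lambda>\<^sup>2)\<close>, so that the atoms miss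
  only an area \<open>O(\<lambda>\<^sup>3)\<close> of the strip (\<open>emeasure_missed_strip\<close>).

  \<^bold>\<open>Conclusion.\<close> The map does not increase area, so that the points that reach the missed part of the
  strip within \<open>O(1 / \<lambda>)\<close> backward steps fill an area \<open>O(1 / \<lambda>) \<cdot> O(\<lambda>\<^sup>3) = O(\<lambda>\<^sup>2)\<close>.
\<close>

section \<open>Regions bounded by half-planes lie inside polygons\<close>

definition affine_form :: "(point \<Rightarrow> real) \<Rightarrow> bool" where
  "affine_form f \<longleftrightarrow> (\<exists>a b d. f = (\<lambda>z. a * fst z + b * snd z + d))"

lemma affine_form_continuous: "affine_form f \<Longrightarrow> continuous_on UNIV f"
  unfolding affine_form_def by (auto intro!: continuous_intros)

lemma affine_form_line:
  assumes "affine_form f"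
  shows "f (u + t *\<^sub>R (v - u)) = (1 - t) * f u + t * f v"
  using assms unfolding affine_form_def by (auto simp: algebra_simps)

text \<open>
  Two distinct zeros of a non-constant affine form determine its zero set, which is the line through
  them.
\<close>

lemma affine_form_zero_line:
  assumes f: "affine_form f" and "f u = 0" "f v = 0" "f w \<noteq> 0" "u \<noteq> v" "f z = 0"
  shows "\<exists>t. z = u + t *\<^sub>R (v - u)"
proof -
  obtain a b d where eq: "\<And>z. f z = a * fst z + b * snd z + d"
    using f unfolding affine_form_def by auto
  have nz: "a \<noteq> 0 \<or> b \<noteq> 0" using assms by (auto simp: eq)
  define x y where "x = fst v - fst u" and "y = snd v - snd u"
  define X Y where "X = fst z - fst u" and "Y = snd z - snd u"
  have 1: "a * x + b * y = 0" "a * X + b * Y = 0"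
    using assms by (auto simp: eq x_def y_def X_def Y_def algebra_simps)
  have xy: "x \<noteq> 0 \<or> y \<noteq> 0" using \<open>u \<noteq> v\<close> by (auto simp: x_def y_def prod_eq_iff)
  have "a * (x * Y - y * X) = 0" "b * (x * Y - y * X) = 0"
    using 1 by algebra+
  with nz have cr: "x * Y = y * X" by auto
  have "\<exists>t. X = t * x \<and> Y = t * y"
  proof (cases "x = 0")
    case True
    then show ?thesis using xy cr by (intro exI[of _ "Y / y"]) auto
  next
    case False
    then show ?thesis using cr by (intro exI[of _ "X / x"]) (auto simp: field_simps)
  qed
  then obtain t where "X = t * x" "Y = t * y" by blast
  then have "z = u + t *\<^sub>R (v - u)"
    by (auto simp: X_def Y_def x_def y_def prod_eq_iff)
  then show ?thesis ..
qed

text \<open>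
  Outside a large disc a set with bounded frontier is everything or nothing, since the complement of
  a disc is connected. If it were everything, then every point would be the midpoint of two points
  of the set, and convexity would make the set the whole plane.
\<close>

lemma bounded_if_bounded_frontier:
  fixes K :: "point set"
  assumes "convex K" "v \<notin> K" "bounded (frontier K)"
  shows "bounded K"
proof (rule ccontr)
  assume nb: "\<not> bounded K"
  obtain r where r: "frontier K \<subseteq> ball 0 r"
    using assms(3) bounded_subset_ballD by blast
  have con: "connected (- ball 0 r :: point set)"
    by (rule connected_complement_bounded_convex) auto
  have "- ball 0 r \<inter> K \<noteq> {}"
    using nb bounded_ball bounded_subset[of "ball 0 r" K] by auto
  moreover have "- ball 0 r \<inter> frontier K = {}" using r by auto
  ultimately have sub: "- ball 0 r \<subseteq> K"
    using connected_Int_frontier[OF con] by auto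
  \<comment> \<open>\<open>v\<close> is the midpoint of two points far away\<close>
  define w :: point where "w = ((\<bar>r\<bar> + norm v), 0)"
  have nw: "norm w = \<bar>r\<bar> + norm v" by (simp add: w_def norm_Pair)
  have "norm w \<le> norm (v + w) + norm v" "norm w \<le> norm (v - w) + norm v"
    using norm_triangle_ineq4[of "v + w" v] norm_triangle_ineq4[of v "v - w"] by auto
  then have "v + w \<in> K" "v - w \<in> K"
    using sub nw by (auto intro!: subsetD[OF sub])
  then have "(1/2) *\<^sub>R (v + w) + (1/2) *\<^sub>R (v - w) \<in> K"
    by (intro convexD[OF assms(1)]) auto
  moreover have "(1/2) *\<^sub>R (v + w) + (1/2) *\<^sub>R (v - w) = v"
    by (simp add: scaleR_add_right[symmetric] del: scaleR_add_right)
  ultimately show False using assms(2) by simp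
qed

text \<open>
  A connected set that avoids the frontier of \<open>K\<close> cannot leave \<open>K\<close>, so that the component of \<open>z\<close> in
  the complement of \<open>T\<close> is bounded.
\<close>

lemma region_subset_inside:
  fixes K T :: "point set"
  assumes "open K" "bounded K" "frontier K \<subseteq> T" "z \<in> K"
  shows "z \<in> T \<union> inside T"
proof (cases "z \<in> T")
  case False
  let ?C = "connected_component_set (- T) z"
  have z: "z \<in> ?C" using False by simp
  have "?C \<inter> frontier K = {}"
    using assms(3) connected_component_subset[of "- T" z] by blast
  then have "?C \<subseteq> K"
    using connected_Int_frontier[of ?C K] z assms(4) connected_connected_component[of "- T" z] by blast
  then have "bounded ?C" using assms(2) bounded_subset by blast
  then show ?thesis using False by (auto simp: inside_def)
qed simp

text \<open>
  The form \<open>L i\<close> vanishes on the edge from vertex \<open>i\<close> to its successor. The two strictness assumptions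
  say that the polygon is strictly convex at each vertex. They are what confines the frontier of the
  region \<open>\<forall>i. L i > 0\<close> to the edges: on the line \<open>L i = 0\<close> the two neighbouring forms are nonnegative
  exactly between the two end points.
\<close>

lemma half_plane_region_subset_polygon:
  fixes vs :: "point list" and L :: "nat \<Rightarrow> point \<Rightarrow> real"
  assumes aff: "\<And>i. i < length vs \<Longrightarrow> affine_form (L i)"
    and ends: "\<And>i. i < length vs \<Longrightarrow> L i (vs ! i) = 0 \<and> L i (vs ! (Suc i mod length vs)) = 0"
    and before: "\<And>i. i < length vs \<Longrightarrow> L (Suc i mod length vs) (vs ! i) > 0"
    and after: "\<And>i. i < length vs \<Longrightarrow> L i (vs ! (Suc (Suc i mod length vs) mod length vs)) > 0"
    and z: "\<And>i. i < length vs \<Longrightarrow> L i z > 0" and ne: "vs \<noteq> []"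
  shows "z \<in> polygon vs"
proof -
  let ?n = "length vs"
  have n: "?n > 0" using ne by simp
  define K where "K = (\<Inter>i<?n. {z. L i z > 0})"
  define H where "H = (\<Inter>i<?n. {z. L i z \<ge> 0})"
  have oK: "open K"
    unfolding K_def using aff affine_form_continuous
    by (intro open_INT) (auto intro!: open_Collect_less continuous_intros)
  have cH: "closed H"
    unfolding H_def using aff affine_form_continuous
    by (intro closed_INT) (auto intro!: closed_Collect_le continuous_intros)
  have KH: "K \<subseteq> H" unfolding K_def H_def by (auto intro: less_imp_le)
  have fr: "frontier K \<subseteq> polygon_boundary vs"
  proof
    fix w assume w: "w \<in> frontier K"
    then have "w \<in> closure K" "w \<notin> K"
      using oK by (auto simp: frontier_def interior_open)
    then have wH: "w \<in> H" using closure_minimal[OF KH cH] by auto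
    from \<open>w \<notin> K\<close> obtain i where i: "i < ?n" "\<not> L i w > 0" by (auto simp: K_def)
    then have Liw: "L i w = 0" using wH by (force simp: H_def)
    let ?j = "Suc i mod ?n"
    have j: "?j < ?n" using n by simp
    \<comment> \<open>the edge before edge \<open>i\<close>\<close>
    define h where "h = (if i = 0 then ?n - 1 else i - 1)"
    have h: "h < ?n" "Suc h mod ?n = i" using n i by (auto simp: h_def)
    have ndeg: "vs ! i \<noteq> vs ! ?j"
      using before[OF i(1)] ends[OF j] by auto
    obtain t where t: "w = vs ! i + t *\<^sub>R (vs ! ?j - vs ! i)"
      using affine_form_zero_line[OF aff[OF i(1)], of "vs ! i" "vs ! ?j" "vs ! (Suc ?j mod ?n)" w]
        ends[OF i(1)] after[OF i(1)] ndeg Liw by auto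
    have "L ?j w \<ge> 0" "L h w \<ge> 0" using wH j h by (auto simp: H_def)
    moreover have "L ?j w = (1 - t) * L ?j (vs ! i)"
      unfolding t affine_form_line[OF aff[OF j]] using ends[OF j] by simp
    moreover have "L h w = t * L h (vs ! ?j)"
      unfolding t affine_form_line[OF aff[OF h(1)]] using ends[OF h(1)] h(2) by simp
    ultimately have "t \<le> 1" "t \<ge> 0"
      using before[OF i(1)] after[OF h(1)] h(2) by (auto simp: zero_le_mult_iff)
    then have "w \<in> closed_segment (vs ! i) (vs ! ?j)"
      unfolding t closed_segment_def by (auto intro!: exI[of _ t] simp: algebra_simps)
    then show "w \<in> polygon_boundary vs"
      unfolding polygon_boundary_def using i by auto
  qed
  have bd: "bounded (polygon_boundary vs)"
    unfolding polygon_boundary_def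
    by (intro compact_imp_bounded compact_UN) auto
  have "convex {z. L i z > 0}" if i: "i < ?n" for i
  proof -
    obtain a b d where eq: "\<And>z. L i z = a * fst z + b * snd z + d"
      using aff[OF i] unfolding affine_form_def by auto
    have "{z. L i z > 0} = {z. inner (a, b) z > - d}"
      by (auto simp: eq inner_prod_def)
    then show ?thesis using convex_halfspace_gt by metis
  qed
  then have "convex K" unfolding K_def by (intro convex_INT) auto
  moreover have "vs ! 0 \<notin> K" using ends[OF n] n by (force simp: K_def)
  ultimately have "bounded K"
    using bounded_if_bounded_frontier bounded_subset[OF bd fr] by blast
  moreover have "z \<in> K" using z by (auto simp: K_def)
  ultimately show ?thesis
    unfolding polygon_def using region_subset_inside[OF oK _ fr] by blast
qed

section \<open>Area is not increased\<close>

text \<open>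
  On each horizontal line the map is a reflection followed by a translation; integrate over the lines.
\<close>

lemma emeasure_shear_vimage:
  fixes A :: "point set"
  assumes A: "A \<in> sets borel"
  shows "emeasure lborel {z. (snd z, lam * snd z - fst z + d) \<in> A} = emeasure lborel A"
proof -
  have A': "A \<in> sets (lborel \<Otimes>\<^sub>M lborel)" using A unfolding lborel_prod by simp
  have "(\<lambda>z. (snd z, lam * snd z - fst z + d)) \<in> (borel :: point measure) \<rightarrow>\<^sub>M borel"
    by (intro borel_measurable_continuous_onI continuous_intros)
  from measurable_sets[OF this A]
  have B: "{z. (snd z, lam * snd z - fst z + d) \<in> A} \<in> sets (lborel \<Otimes>\<^sub>M lborel)"
    unfolding lborel_prod by (simp add: vimage_def)
  have "emeasure lborel {z. (snd z, lam * snd z - fst z + d) \<in> A}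
      = (\<integral>\<^sup>+v. emeasure lborel ((\<lambda>u. (u, v)) -` {z. (snd z, lam * snd z - fst z + d) \<in> A}) \<partial>lborel)"
    using lborel_pair.emeasure_pair_measure_alt2[OF B] by (simp add: lborel_prod)
  also have "\<dots> = (\<integral>\<^sup>+v. emeasure lborel (Pair v -` A) \<partial>lborel)"
  proof (rule nn_integral_cong)
    fix v :: real
    have m: "Pair v -` A \<in> sets borel"
      using sets_Pair1[OF A', of v] by simp
    have "emeasure lborel (Pair v -` A) = (\<integral>\<^sup>+x. indicator (Pair v -` A) x \<partial>lborel)"
      using m by simp
    also have "\<dots> = (\<integral>\<^sup>+x. indicator (Pair v -` A) (lam * v + d + (-1) * x) \<partial>lborel)"
      using nn_integral_real_affine[of "indicator (Pair v -` A)" "-1" "lam * v + d"] m by simp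
    also have "\<dots> = (\<integral>\<^sup>+x. indicator ((\<lambda>x. lam * v + d + (-1) * x) -` (Pair v -` A)) x \<partial>lborel)"
      by (simp add: indicator_def)
    also have "\<dots> = emeasure lborel ((\<lambda>x. lam * v + d + (-1) * x) -` (Pair v -` A))"
    proof (rule nn_integral_indicator)
      have "(\<lambda>x. lam * v + d + (-1) * x) \<in> borel \<rightarrow>\<^sub>M borel" by measurable
      from measurable_sets[OF this m]
      show "(\<lambda>x. lam * v + d + (-1) * x) -` (Pair v -` A) \<in> sets lborel" by simp
    qed
    also have "(\<lambda>x. lam * v + d + (-1) * x) -` (Pair v -` A)
        = (\<lambda>u. (u, v)) -` {z. (snd z, lam * snd z - fst z + d) \<in> A}"
      by (auto simp: algebra_simps)
    finally show "emeasure lborel ((\<lambda>u. (u, v)) -` {z. (snd z, lam * snd z - fst z + d) \<in> A})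
        = emeasure lborel (Pair v -` A)" by simp
  qed
  also have "\<dots> = emeasure lborel A"
    using lborel.emeasure_pair_measure_alt[OF A'] by (simp add: lborel_prod)
  finally show ?thesis .
qed

text \<open>
  On each of the two pieces \<open>y \<le> \<lambda> x\<close> and \<open>y > \<lambda> x\<close> the map is the inverse of one of the affine maps
  of the previous lemma.
\<close>

lemma emeasure_F_image_le:
  assumes A: "A \<in> sets borel" "A \<subseteq> Omega" and lam: "0 \<le> lam" "lam \<le> 1"
  shows "emeasure lborel (F lam ` A) \<le> emeasure lborel A"
proof -
  define A1 where "A1 = A \<inter> {z. snd z \<le> lam * fst z}"
  define A2 where "A2 = A - A1"
  have c: "{z :: point. snd z \<le> lam * fst z} \<in> sets borel"
    by (intro borel_closed closed_Collect_le continuous_intros)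
  have m: "A1 \<in> sets borel" "A2 \<in> sets borel"
    using A c by (auto simp: A1_def A2_def)
  let ?T = "\<lambda>d B. {z. (snd z, lam * snd z - fst z + d) \<in> B}"
  have T: "?T d B \<in> sets borel" if "B \<in> sets borel" for d and B :: "point set"
  proof -
    have "(\<lambda>z. (snd z, lam * snd z - fst z + d)) \<in> (borel :: point measure) \<rightarrow>\<^sub>M borel"
      by (intro borel_measurable_continuous_onI continuous_intros)
    from measurable_sets[OF this that] show ?thesis by (simp add: vimage_def)
  qed
  have "F lam ` A \<subseteq> ?T 0 A1 \<union> ?T 1 A2"
  proof
    fix w assume "w \<in> F lam ` A"
    then obtain x y where xy: "(x, y) \<in> A" "w = F lam (x, y)" by auto
    then have b: "0 \<le> x" "x < 1" "0 \<le> y" "y < 1" using A by (auto simp: Omega_def)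
    have lx: "0 \<le> lam * x" "lam * x < 1"
      using b lam mult_right_mono[of lam 1 x] by auto
    show "w \<in> ?T 0 A1 \<union> ?T 1 A2"
    proof (cases "y \<le> lam * x")
      case True
      then have "\<lfloor>lam * x - y\<rfloor> = 0" using b lx by linarith
      then show ?thesis using xy True by (simp add: A1_def F_def iota_def)
    next
      case False
      then have "\<lfloor>lam * x - y\<rfloor> = -1" using b lx by linarith
      then show ?thesis using xy False by (simp add: A1_def A2_def F_def iota_def)
    qed
  qed
  then have "emeasure lborel (F lam ` A) \<le> emeasure lborel (?T 0 A1 \<union> ?T 1 A2)"
    using sets.Un[OF T[OF m(1), of 0] T[OF m(2), of 1]] by (intro emeasure_mono) auto
  also have "\<dots> \<le> emeasure lborel (?T 0 A1) + emeasure lborel (?T 1 A2)"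
    using T[OF m(1), of 0] T[OF m(2), of 1] by (intro emeasure_subadditive) simp_all
  also have "\<dots> = emeasure lborel A1 + emeasure lborel A2"
    using emeasure_shear_vimage[OF m(1), of lam 0] emeasure_shear_vimage[OF m(2), of lam 1] by simp
  also have "\<dots> = emeasure lborel (A1 \<union> A2)"
    using m by (intro plus_emeasure) (auto simp: A2_def)
  also have "A1 \<union> A2 = A" by (auto simp: A1_def A2_def)
  finally show ?thesis .
qed

lemma emeasure_F_pow_image_le:
  assumes A: "A \<in> sets borel" "A \<subseteq> Omega" and lam: "0 \<le> lam" "lam \<le> 1"
  shows "emeasure lborel ((F lam ^^ t) ` A) \<le> emeasure lborel A"
proof (induction t)
  case (Suc t)
  have "emeasure lborel ((F lam ^^ Suc t) ` A) = emeasure lborel (F lam ` ((F lam ^^ t) ` A))"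
    by (simp add: image_comp)
  also have "\<dots> \<le> emeasure lborel ((F lam ^^ t) ` A)"
    using F_pow_image_borel[OF A(2,1)] lam by (intro emeasure_F_image_le) auto
  finally show ?case using Suc by simp
qed simp

lemma Finv_pow_in_Omega: "z \<in> Omega \<Longrightarrow> (Finv lam ^^ t) z \<in> Omega"
  by (induction t) (auto simp: Finv_in_Omega)

lemma F_pow_Finv_pow: "z \<in> Omega \<Longrightarrow> (F lam ^^ t) ((Finv lam ^^ t) z) = z"
proof (induction t)
  case (Suc t)
  have "(F lam ^^ Suc t) ((Finv lam ^^ Suc t) z) = (F lam ^^ t) (F lam (Finv lam ((Finv lam ^^ t) z)))"
    by (simp add: funpow_swap1)
  then show ?case
    using Suc Finv_pow_in_Omega[OF Suc.prems] by (simp add: F_Finv)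
qed simp

section \<open>Rotation about the centre of the island\<close>

text \<open>
  The inverse of the affine map that agrees with \<^const>\<open>F\<close> on \<open>y > \<lambda> x\<close>. In the metric \<^const>\<open>Qform\<close> it
  is a rotation about the centre of the island.
\<close>

definition Rinv :: "real \<Rightarrow> point \<Rightarrow> point" where
  "Rinv lam = (\<lambda>(u, v). (v, lam * v - u + 1))"

text \<open>
  The points of the square that lie between the lines \<open>ell 0\<close> and \<open>ell 1\<close>, on the side of the corner
  \<open>(1, 1)\<close>.
\<close>

definition entry_strip :: "real \<Rightarrow> point set" where
  "entry_strip lam = {z \<in> Omega. snd ((Rinv lam ^^ 4) z) \<ge> 1}"

text \<open>
  The squared distance from the centre of the island; the orbits of the rotation lie on its level
  ellipses.
\<close>

definition rho :: "real \<Rightarrow> point \<Rightarrow> real" where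
  "rho lam z = Qform lam (z - centre lam) (z - centre lam)"

lemma Finv_eq_Rinv:
  assumes "(u, v) \<in> Omega" "0 \<le> lam" "lam \<le> 1" "lam * v < u"
  shows "Finv lam (u, v) = Rinv lam (u, v)"
proof -
  have "0 \<le> lam * v" "u < 1" using assms by (auto simp: Omega_def)
  then have "frac (lam * v - u) = lam * v - u + 1"
    using assms by (intro frac_eqI[where k = "-1"]) simp_all
  then show ?thesis by (simp add: Finv_def Rinv_def)
qed

lemma Finv_eq_shift:
  assumes "(u, v) \<in> Omega" "0 \<le> lam" "lam \<le> 1" "u \<le> lam * v"
  shows "Finv lam (u, v) = (v, lam * v - u)"
proof -
  have "lam * v < 1" using assms mult_right_mono[of lam 1 v] by (auto simp: Omega_def)
  then have "frac (lam * v - u) = lam * v - u"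
    using assms by (intro frac_eqI[where k = 0]) (auto simp: Omega_def)
  then show ?thesis by (simp add: Finv_def)
qed

lemma rho_alt:
  "rho lam (u, v) = (u - 1 / (2 - lam))\<^sup>2 + (v - 1 / (2 - lam))\<^sup>2
     - lam * (u - 1 / (2 - lam)) * (v - 1 / (2 - lam))"
  by (simp add: rho_def Qform_def centre_def power2_eq_square algebra_simps)

lemma rho_squares:
  "rho lam (u, v) = (1 - lam\<^sup>2 / 4) * (u - 1 / (2 - lam))\<^sup>2
     + (v - 1 / (2 - lam) - lam / 2 * (u - 1 / (2 - lam)))\<^sup>2"
proof -
  have "X\<^sup>2 + Y\<^sup>2 - lam * X * Y = (1 - lam\<^sup>2 / 4) * X\<^sup>2 + (Y - lam / 2 * X)\<^sup>2" for X Y :: real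
    by (simp add: power2_eq_square algebra_simps)
  then show ?thesis unfolding rho_alt .
qed

lemma theta_facts:
  assumes "0 < lam" "lam \<le> 1"
  shows "sin (theta lam) = lam / 2" "lam / 2 \<le> theta lam" "theta lam < pi / 2"
    "cos (2 * theta lam) = 1 - lam\<^sup>2 / 2" "0 < theta lam"
proof -
  show s: "sin (theta lam) = lam / 2" using assms by (simp add: theta_def)
  have pos: "0 < theta lam" using assms arcsin_less_arcsin[of 0 "lam / 2"] by (simp add: theta_def)
  then show "0 < theta lam" .
  show "lam / 2 \<le> theta lam" using sin_x_le_x[of "theta lam"] s pos by simp
  show "theta lam < pi / 2"
    using assms arcsin_less_arcsin[of "lam / 2" 1] by (simp add: theta_def)
  show "cos (2 * theta lam) = 1 - lam\<^sup>2 / 2"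
    by (simp add: cos_double_sin s power_divide)
qed

lemma cos_theta_pos: "0 < lam \<Longrightarrow> lam \<le> 1 \<Longrightarrow> cos (theta lam) > 0"
  using theta_facts[of lam] by (intro cos_gt_zero_pi) auto

lemma tan_theta_le:
  assumes "0 < lam" "lam \<le> 1"
  shows "tan (theta lam) \<le> lam"
proof -
  note th = theta_facts[OF assms]
  have c: "cos (theta lam) > 0" by (rule cos_theta_pos[OF assms])
  have "(cos (theta lam))\<^sup>2 = 1 - lam\<^sup>2 / 4"
    using sin_cos_squared_add[of "theta lam"] th(1) by (simp add: power_divide)
  also have "\<dots> \<ge> 1 / 4" using assms power_le_one[of lam 2] by simp
  also have "1 / 4 = (1/2 :: real)\<^sup>2" by (simp add: power2_eq_square)
  finally have c2: "1/2 \<le> cos (theta lam)" using c by (rule power2_le_imp_le[OF _ less_imp_le])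
  have "tan (theta lam) = (lam / 2) / cos (theta lam)" by (simp add: tan_def th(1))
  also have "\<dots> \<le> (lam / 2) / (1/2)" using c2 assms by (intro divide_left_mono) auto
  finally show ?thesis by simp
qed

lemma le_tan: "0 < x \<Longrightarrow> x < pi / 2 \<Longrightarrow> x \<le> tan (x :: real)"
  using abs_tan_ge[of x] tan_gt_zero[of x] by simp

lemma theta_le: "0 < lam \<Longrightarrow> lam \<le> 1 \<Longrightarrow> theta lam \<le> lam"
  using le_tan[of "theta lam"] theta_facts[of lam] tan_theta_le[of lam] by linarith

text \<open>
  The second coordinates of a backward orbit satisfy the recurrence \<open>Y (k + 2) = \<lambda> Y (k + 1) - Y k\<close>,
  which \<open>cos (\<phi> - k \<beta>)\<close> solves when \<open>2 cos \<beta> = \<lambda>\<close>, and so for \<open>\<beta> = pi / 2 - \<theta>\<close>. The amplitude \<open>A\<close> is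
  the largest height that the ellipse of the orbit reaches above the centre.
\<close>

lemma Rinv_pow_cos:
  assumes lam: "0 < lam" "lam \<le> 1"
  obtains A \<phi> where "A \<ge> 0" "A\<^sup>2 * (1 - lam\<^sup>2 / 4) = rho lam z" "0 \<le> \<phi>" "\<phi> < 2 * pi"
    "\<And>k. snd ((Rinv lam ^^ k) z) = 1 / (2 - lam) + A * cos (\<phi> - k * (pi / 2 - theta lam))"
proof -
  define c where "c = 1 / (2 - lam)"
  have c: "(2 - lam) * c = 1" using lam by (simp add: c_def)
  define Y where "Y k = snd ((Rinv lam ^^ k) z) - c" for k
  obtain u v where z: "z = (u, v)" by (cases z)
  have Y0: "Y 0 = v - c" and Y1: "Y (Suc 0) = lam * (v - c) - (u - c)"
    using c by (auto simp: Y_def z Rinv_def algebra_simps)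
  have fs: "fst (Rinv lam w) = snd w" "snd (Rinv lam w) = lam * snd w - fst w + 1" for w
    by (auto simp: Rinv_def split: prod.split)
  have rec: "Y (Suc (Suc k)) = lam * Y (Suc k) - Y k" for k
    using c by (simp add: Y_def fs algebra_simps)
  define b where "b = pi / 2 - theta lam"
  have cb: "cos b = lam / 2" using theta_facts[OF lam] by (simp add: b_def cos_diff)
  have sb: "sin b > 0" using theta_facts[OF lam] by (auto simp: b_def intro!: sin_gt_zero)
  have sb2: "(sin b)\<^sup>2 = 1 - lam\<^sup>2 / 4"
    using sin_cos_squared_add[of b] by (simp add: cb power_divide algebra_simps)
  \<comment> \<open>the sine part of the wave, chosen so that the first two values are right\<close>
  define s where "s = (Y (Suc 0) - Y 0 * cos b) / sin b"
  define A where "A = sqrt ((Y 0)\<^sup>2 + s\<^sup>2)"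
  have A2: "A\<^sup>2 = (Y 0)\<^sup>2 + s\<^sup>2" by (simp add: A_def)
  have ssb: "s * sin b = Y (Suc 0) - Y 0 * cos b" using sb by (simp add: s_def)
  have "A\<^sup>2 * (1 - lam\<^sup>2 / 4) = (Y 0)\<^sup>2 * (1 - lam\<^sup>2 / 4) + (s * sin b)\<^sup>2"
    by (simp add: A2 algebra_simps sb2[symmetric] power_mult_distrib)
  also have "\<dots> = rho lam z"
    unfolding ssb cb z Y0 Y1 rho_alt c_def[symmetric]
    by (simp add: power2_eq_square field_simps)
  finally have Arho: "A\<^sup>2 * (1 - lam\<^sup>2 / 4) = rho lam z" .
  have "\<exists>\<phi>. 0 \<le> \<phi> \<and> \<phi> < 2 * pi \<and> Y 0 = A * cos \<phi> \<and> s = A * sin \<phi>"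
  proof (cases "A = 0")
    case True
    then have "Y 0 = 0 \<and> s = 0" using A2 sum_power2_eq_zero_iff[of "Y 0" s] by simp
    then show ?thesis using True by (intro exI[of _ 0]) auto
  next
    case False
    then have "(Y 0 / A)\<^sup>2 + (s / A)\<^sup>2 = 1"
      unfolding power_divide add_divide_distrib[symmetric] A2[symmetric] by simp
    then obtain t where "0 \<le> t" "t < 2 * pi" "Y 0 / A = cos t" "s / A = sin t"
      using sincos_total_2pi by metis
    then show ?thesis using False by (intro exI[of _ t]) (auto simp: field_simps)
  qed
  then obtain \<phi> where \<phi>: "0 \<le> \<phi>" "\<phi> < 2 * pi" "Y 0 = A * cos \<phi>" "s = A * sin \<phi>" by blast
  have "Y k = A * cos (\<phi> - k * b) \<and> Y (Suc k) = A * cos (\<phi> - Suc k * b)" for k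
  proof (induction k)
    case 0
    have "Y (Suc 0) = Y 0 * cos b + s * sin b" using ssb by simp
    then show ?case using \<phi> by (simp add: cos_diff algebra_simps)
  next
    case (Suc k)
    define x where "x = \<phi> - Suc k * b"
    have x1: "\<phi> - k * b = x + b" "\<phi> - Suc (Suc k) * b = x - b"
      by (auto simp: x_def algebra_simps)
    have Yk: "Y k = A * cos (x + b)" "Y (Suc k) = A * cos x"
      using Suc unfolding x1[symmetric] by (simp_all only: x_def)
    have "Y (Suc (Suc k)) = 2 * cos b * (A * cos x) - A * cos (x + b)"
      using Yk rec[of k] by (simp add: cb)
    also have "\<dots> = A * cos (x - b)" by (simp add: cos_add cos_diff algebra_simps)
    finally show ?case unfolding x1(2) using Yk by (simp only: x_def)
  qed
  then have "snd ((Rinv lam ^^ k) z) = 1 / (2 - lam) + A * cos (\<phi> - k * (pi / 2 - theta lam))" for k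
    unfolding b_def[symmetric] c_def[symmetric] by (metis Y_def add.commute diff_add_cancel)
  moreover have "A \<ge> 0" by (simp add: A_def)
  ultimately show ?thesis using that \<phi>(1,2) Arho by blast
qed

text \<open>
  The value of \<open>rho\<close> on the boundary of the island.
\<close>

definition rhoE :: "real \<Rightarrow> real" where
  "rhoE lam = (1 - lam\<^sup>2 / 4) * ((1 - lam) / (2 - lam))\<^sup>2"

text \<open>
  Every fourth angle of the orbit lies \<open>4 \<theta>\<close> further, so that within one turn some angle is at most \<open>2 \<theta>\<close>
  away from the top of the ellipse. There the height is at least \<open>A cos (2 \<theta>) = A (1 - \<lambda>\<^sup>2 / 2)\<close>, and
  the factor \<open>1 + \<lambda>\<^sup>2\<close> in the assumption compensates for the cosine.
\<close>

lemma escape_time: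
  assumes lam: "0 < lam" "lam \<le> 1"
    and rho: "rho lam z \<ge> (1 + lam\<^sup>2)\<^sup>2 * rhoE lam"
  obtains k where "real k \<le> 20 / lam" "snd ((Rinv lam ^^ k) z) \<ge> 1"
proof -
  define th where "th = theta lam"
  note th = theta_facts[OF lam, folded th_def]
  define a where "a = (1 - lam) / (2 - lam)"
  have a: "a \<ge> 0" "1 - 1 / (2 - lam) = a" using lam by (auto simp: a_def field_simps)
  have l2: "lam\<^sup>2 \<le> 1" using lam by (simp add: power_le_one)
  obtain A \<phi> where A: "A \<ge> 0" "A\<^sup>2 * (1 - lam\<^sup>2 / 4) = rho lam z" and \<phi>: "0 \<le> \<phi>" "\<phi> < 2 * pi"
    and Y: "\<And>k. snd ((Rinv lam ^^ k) z) = 1 / (2 - lam) + A * cos (\<phi> - k * (pi / 2 - th))"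
    using Rinv_pow_cos[OF lam, of z] unfolding th_def by metis
  have "(1 - lam\<^sup>2 / 4) * ((1 + lam\<^sup>2) * a)\<^sup>2 \<le> (1 - lam\<^sup>2 / 4) * A\<^sup>2"
    using rho A(2) by (simp add: rhoE_def a_def[symmetric] power_mult_distrib mult_ac)
  then have "((1 + lam\<^sup>2) * a)\<^sup>2 \<le> A\<^sup>2" using l2 by simp
  then have Aa: "(1 + lam\<^sup>2) * a \<le> A" using A(1) by (rule power2_le_imp_le)
  have "a \<le> ((1 + lam\<^sup>2) * a) * (1 - lam\<^sup>2 / 2)"
  proof -
    have "1 \<le> (1 + lam\<^sup>2) * (1 - lam\<^sup>2 / 2)"
      using mult_left_mono[of "lam\<^sup>2" 1 "lam\<^sup>2"] l2 by (simp add: algebra_simps)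
    then have "a * 1 \<le> a * ((1 + lam\<^sup>2) * (1 - lam\<^sup>2 / 2))"
      using a by (intro mult_left_mono) auto
    then show ?thesis by (simp only: mult_ac mult_1_right)
  qed
  also have "\<dots> \<le> A * cos (2 * th)"
    unfolding th(4) using Aa l2 by (intro mult_right_mono) auto
  finally have big: "a \<le> A * cos (2 * th)" .
  \<comment> \<open>the integer part of \<open>x\<close> is the number of steps by \<open>4 \<theta>\<close> that brings \<open>\<phi>\<close> closest to \<open>2 pi\<close>\<close>
  define x where "x = (2 * pi - \<phi>) / (4 * th) + 1 / 2"
  define j where "j = nat \<lfloor>x\<rfloor>"
  have x0: "x \<ge> 0" using \<phi> th by (auto simp: x_def intro!: add_nonneg_nonneg divide_nonneg_pos)
  then have j: "real j \<le> x" "x < real j + 1" by (auto simp: j_def)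
  have "4 * th * x = 2 * pi - \<phi> + 2 * th" using th(5) by (simp add: x_def field_simps)
  moreover have "4 * th * real j \<le> 4 * th * x" "4 * th * x < 4 * th * (real j + 1)"
    using mult_left_mono[OF j(1), of "4 * th"] mult_strict_left_mono[OF j(2), of "4 * th"] th(5) by auto
  ultimately have "4 * th * real j \<le> 2 * pi - \<phi> + 2 * th" "2 * pi - \<phi> + 2 * th < 4 * th * real j + 4 * th"
    by (simp_all add: distrib_left)
  then have d: "\<bar>2 * pi - (\<phi> + 4 * j * th)\<bar> \<le> 2 * th" by (simp add: abs_le_iff mult_ac)
  have "cos (\<phi> - real (4 * j) * (pi / 2 - th)) = cos (\<phi> + 4 * j * th - 2 * pi * of_int (int j))"
    by (simp add: algebra_simps)
  also have "\<dots> = cos (\<phi> + 4 * j * th)"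
    using cos_add[of "\<phi> + 4 * j * th" "- (2 * pi * of_int (int j))"] cos_int_2pin[of "int j"] sin_int_2pin[of "int j"]
    by (simp del: of_int_of_nat_eq)
  also have "\<dots> = cos (\<bar>2 * pi - (\<phi> + 4 * j * th)\<bar>)"
    by (simp add: cos_diff)
  also have "\<dots> \<ge> cos (2 * th)"
    using d th by (intro cos_monotone_0_pi_le) auto
  finally have "a \<le> A * cos (\<phi> - real (4 * j) * (pi / 2 - th))"
    using big A(1) mult_left_mono order_trans by blast
  then have e: "snd ((Rinv lam ^^ (4 * j)) z) \<ge> 1" using Y[of "4 * j"] a by simp
  have "x \<le> 2 * pi / (4 * th) + 1 / 2"
    unfolding x_def using \<phi> th by (intro add_right_mono divide_right_mono) auto
  also have "2 * pi / (4 * th) \<le> 2 * pi / (4 * (lam / 2))"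
    using th lam by (intro divide_left_mono) auto
  finally have "x \<le> pi / lam + 1 / 2" by simp
  then have "real (4 * j) \<le> 4 * (pi / lam) + 2" using j by simp
  also have "\<dots> \<le> 4 * (4 / lam) + 4 / lam"
    using lam pi_less_4 by (intro add_mono mult_left_mono divide_right_mono) (auto simp: field_simps)
  also have "\<dots> = 20 / lam" using lam by (simp add: field_simps)
  finally show ?thesis using that e by blast
qed

text \<open>
  Before the first exit the rotation stays in the square, and there it agrees with the inverse of the
  map. An exit always happens through the top edge: the first coordinate of an image is the second
  coordinate of its argument, and the second coordinate of an image is positive.
\<close>

lemma first_exit:
  assumes lam: "0 \<le> lam" "lam \<le> 1" and z: "z \<in> Omega" and e: "snd ((Rinv lam ^^ k0) z) \<ge> 1"
  obtains k where "0 < k" "k \<le> k0" "snd ((Rinv lam ^^ k) z) \<ge> 1"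
    "\<And>j. j < k \<Longrightarrow> (Finv lam ^^ j) z = (Rinv lam ^^ j) z"
    "\<And>j. j < k \<Longrightarrow> (Rinv lam ^^ j) z \<in> Omega"
proof -
  define k where "k = (LEAST k. snd ((Rinv lam ^^ k) z) \<ge> 1)"
  have k: "snd ((Rinv lam ^^ k) z) \<ge> 1" "k \<le> k0"
    unfolding k_def using e by (auto intro: LeastI Least_le)
  have lt: "snd ((Rinv lam ^^ j) z) < 1" if "j < k" for j
    using not_less_Least[OF that[unfolded k_def]] by simp
  have k0: "0 < k" using k z by (cases k) (auto simp: Omega_def)
  have "(Finv lam ^^ j) z = (Rinv lam ^^ j) z \<and> (Rinv lam ^^ j) z \<in> Omega" if "j < k" for j
    using that
  proof (induction j)
    case (Suc j)
    obtain u v where uv: "(Rinv lam ^^ j) z = (u, v)" by (cases "(Rinv lam ^^ j) z")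
    have O: "(u, v) \<in> Omega" using Suc uv by auto
    have s: "(Rinv lam ^^ Suc j) z = (v, lam * v - u + 1)"
      unfolding funpow.simps comp_def uv by (simp add: Rinv_def)
    have lt1: "lam * v - u + 1 < 1" using lt[OF Suc.prems] s by simp
    have "0 \<le> lam * v" using O lam by (auto simp: Omega_def)
    then have "(Rinv lam ^^ Suc j) z \<in> Omega"
      using s lt1 O by (auto simp: Omega_def)
    moreover have "(Finv lam ^^ Suc j) z = (Rinv lam ^^ Suc j) z"
      using Finv_eq_Rinv[OF O lam] lt1 Suc uv by simp
    ultimately show ?case by simp
  qed (use z in simp)
  then show ?thesis using that k0 k by blast
qed

lemma strip_before_late_exit:
  assumes "snd ((Rinv lam ^^ k) z) \<ge> 1" "4 \<le> k"
    "\<And>j. j < k \<Longrightarrow> (Finv lam ^^ j) z = (Rinv lam ^^ j) z"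
    "\<And>j. j < k \<Longrightarrow> (Rinv lam ^^ j) z \<in> Omega"
  shows "(Finv lam ^^ (k - 4)) z \<in> entry_strip lam"
proof -
  have "(Rinv lam ^^ 4) ((Rinv lam ^^ (k - 4)) z) = (Rinv lam ^^ k) z"
    using assms(2) funpow_add[of 4 "k - 4" "Rinv lam"] by simp
  then show ?thesis using assms by (simp add: entry_strip_def)
qed

section \<open>Backward orbits reach the entrance strip\<close>

text \<open>
  \<open>T\<close> is a real number because the bounds for it are multiples of \<open>1 / \<lambda>\<close>.
\<close>

definition reaches_strip :: "real \<Rightarrow> real \<Rightarrow> point \<Rightarrow> bool" where
  "reaches_strip lam T z \<longleftrightarrow> (\<exists>t. real t \<le> T \<and> (Finv lam ^^ t) z \<in> entry_strip lam)"

lemma reaches_strip_step: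
  assumes "reaches_strip lam T ((Finv lam ^^ j) z)" "T + j \<le> T'"
  shows "reaches_strip lam T' z"
proof -
  obtain t where "real t \<le> T" "(Finv lam ^^ t) ((Finv lam ^^ j) z) \<in> entry_strip lam"
    using assms unfolding reaches_strip_def by blast
  then show ?thesis
    unfolding reaches_strip_def using assms(2)
    by (intro exI[of _ "t + j"]) (simp add: funpow_add)
qed

text \<open>
  The point \<open>(h, 1 - v + \<lambda> h)\<close> is the second backward image of a point \<open>(\<lambda> v - h, v)\<close> at the left edge.
  Completing the square in \<open>rho\<close> gives \<open>rho - rhoE \<ge> (w - \<lambda> h / 2)\<^sup>2 - \<lambda> w\<close> for \<open>w = v - 1/2\<close>; the
  quadratic term wins as soon as \<open>w \<ge> 10 \<lambda>\<close>.
\<close>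

lemma exit_bound_left_edge:
  assumes lam: "0 < lam" "lam \<le> 1 / 100" and h: "0 \<le> h" "h \<le> lam * v"
    and v: "1/2 + 10 * lam \<le> v" "v \<le> 1 - 10 * lam"
  shows "rho lam (h, 1 - v + lam * h) \<ge> (1 + lam\<^sup>2)\<^sup>2 * rhoE lam"
proof -
  define c where "c = 1 / (2 - lam)"
  have c: "c * (2 - lam) = 1" "c \<ge> 1/2" "c \<le> 1" using lam by (auto simp: c_def field_simps)
  have ca: "(1 - lam) / (2 - lam) = 1 - c" using lam by (simp add: c_def field_simps)
  define w where "w = v - 1/2"
  have w: "10 * lam \<le> w" "w \<le> 1/2" using v lam by (auto simp: w_def)
  define k where "k = 1 - lam\<^sup>2 / 4"
  have l2: "lam\<^sup>2 \<le> lam / 100" using lam by (simp add: power2_eq_square)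
  have k: "0 < k" "k \<le> 1" using l2 lam by (auto simp: k_def)
  have "lam * v \<le> lam * 1" using v lam by (intro mult_left_mono) auto
  then have h1: "h \<le> lam" using h(2) by simp
  have e1: "1 - v + lam * h - c - lam / 2 * (h - c) = - (w - lam * h / 2)"
    using c(1) by (simp add: w_def field_simps)
  have r: "rho lam (h, 1 - v + lam * h) = k * (h - c)\<^sup>2 + (w - lam * h / 2)\<^sup>2"
    unfolding rho_squares c_def[symmetric] e1 k_def[symmetric] power2_minus ..
  have e2: "(h - c)\<^sup>2 - (1 - c)\<^sup>2 = (lam * c - h) * (1 - h)"
  proof -
    have "lam * c = 2 * c - 1" using c(1) by (simp add: algebra_simps)
    then show ?thesis by (simp only: power2_eq_square) (simp add: algebra_simps)
  qed
  have "lam * (c - v) \<ge> lam * (- w)" using lam c by (intro mult_left_mono) (auto simp: w_def)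
  then have "lam * c - h \<ge> - (lam * w)" using h by (simp add: algebra_simps)
  moreover have lw: "0 \<le> lam * w" using lam w by simp
  ultimately have "(lam * c - h) * (1 - h) \<ge> - (lam * w)"
  proof (cases "lam * c - h \<ge> 0")
    case True
    then have "0 \<le> (lam * c - h) * (1 - h)" using h1 lam by (intro mult_nonneg_nonneg) auto
    moreover have "- (lam * w) \<le> 0" using lw by simp
    ultimately show ?thesis by (rule order_trans[rotated])
  next
    case False
    then have "(lam * c - h) * 1 \<le> (lam * c - h) * (1 - h)"
      using h by (intro mult_left_mono_neg) auto
    then show ?thesis using \<open>lam * c - h \<ge> - (lam * w)\<close> unfolding mult_1_right by (rule order_trans[rotated])
  qed
  then have "k * ((h - c)\<^sup>2 - (1 - c)\<^sup>2) \<ge> k * (- (lam * w))"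
    unfolding e2 using k by (intro mult_left_mono) auto
  moreover have "k * (lam * w) \<le> lam * w" using k lw by (simp add: mult_left_le_one_le)
  ultimately have A: "k * (h - c)\<^sup>2 \<ge> k * (1 - c)\<^sup>2 - lam * w" by (simp add: algebra_simps)
  have "lam * h \<le> 1 * lam" using h h1 lam by (intro mult_mono) auto
  then have "w - lam * h / 2 \<ge> 9 / 10 * w" using w lam by linarith
  then have "(w - lam * h / 2)\<^sup>2 \<ge> (9 / 10 * w)\<^sup>2" using w lam by (intro power_mono) auto
  then have B: "(w - lam * h / 2)\<^sup>2 \<ge> 81 / 100 * w\<^sup>2" by (simp add: power2_eq_square)
  have "w * w \<ge> 10 * lam * w" using w lam by (intro mult_right_mono) auto
  moreover have "10 * lam * w \<ge> 10 * lam * (10 * lam)" using w lam by (intro mult_left_mono) auto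
  ultimately have C: "81 / 100 * w\<^sup>2 - lam * w \<ge> 71 * lam\<^sup>2"
    by (simp add: power2_eq_square)
  have "(1 - c)\<^sup>2 \<le> 1" using c by (simp add: power_le_one)
  then have kc: "k * (1 - c)\<^sup>2 \<le> 1" using k mult_mono[of k 1 "(1 - c)\<^sup>2" 1] by simp
  have "(1 + lam\<^sup>2)\<^sup>2 - 1 = lam\<^sup>2 * (2 + lam\<^sup>2)" by (simp add: power2_eq_square algebra_simps)
  also have "\<dots> \<le> lam\<^sup>2 * 3" using l2 lam by (intro mult_left_mono) auto
  finally have "((1 + lam\<^sup>2)\<^sup>2 - 1) * (k * (1 - c)\<^sup>2) \<le> 3 * lam\<^sup>2 * 1"
    using kc k by (intro mult_mono) auto
  then have "(1 + lam\<^sup>2)\<^sup>2 * rhoE lam \<le> k * (1 - c)\<^sup>2 + 3 * lam\<^sup>2"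
    unfolding rhoE_def ca k_def[symmetric] by (simp add: algebra_simps)
  also have "\<dots> \<le> rho lam (h, 1 - v + lam * h)" unfolding r using A B C zero_le_power2[of lam] by linarith
  finally show ?thesis .
qed

text \<open>
  The assumption \<open>\<lambda> (1 - v + \<lambda> h) < h\<close> says that the backward rotation moves the point into the
  square. It then visits the other three edges before it returns to the left one, so that its first
  exit comes after at least four steps, and the backward orbit has met the strip.
\<close>

lemma left_edge_reaches_strip:
  assumes lam: "0 < lam" "lam \<le> 1 / 100" and h: "0 \<le> h" "h \<le> lam * v"
    and v: "1/2 + 10 * lam \<le> v" "v \<le> 1 - 10 * lam"
    and inner: "lam * (1 - v + lam * h) < h"
  shows "reaches_strip lam (20 / lam) (h, 1 - v + lam * h)"
proof -
  have l1: "lam \<le> 1" using lam by simp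
  define z where "z = (h, 1 - v + lam * h)"
  have "lam * v \<le> lam * 1" using v lam by (intro mult_left_mono) auto
  then have h1: "h \<le> lam" using h(2) by simp
  have lh: "0 \<le> lam * h" "lam * h \<le> 1 / 100" using h h1 lam mult_mono[of lam 1 h "1/100"] by auto
  have O: "z \<in> Omega" using v h h1 lam lh by (auto simp: z_def Omega_def)
  obtain k0 where k0: "real k0 \<le> 20 / lam" "snd ((Rinv lam ^^ k0) z) \<ge> 1"
    using escape_time[OF lam(1) l1 exit_bound_left_edge[OF lam h v]] unfolding z_def by blast
  obtain k where k: "0 < k" "k \<le> k0" "snd ((Rinv lam ^^ k) z) \<ge> 1"
    "\<And>j. j < k \<Longrightarrow> (Finv lam ^^ j) z = (Rinv lam ^^ j) z"
    "\<And>j. j < k \<Longrightarrow> (Rinv lam ^^ j) z \<in> Omega"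
    using first_exit[OF less_imp_le[OF lam(1)] l1 O k0(2)] by blast
  define y0 where "y0 = 1 - v + lam * h"
  define y1 where "y1 = lam * y0 - h + 1"
  define y2 where "y2 = lam * y1 - y0 + 1"
  define y3 where "y3 = lam * y2 - y1 + 1"
  have ys: "snd ((Rinv lam ^^ 1) z) = y1" "snd ((Rinv lam ^^ 2) z) = y2" "snd ((Rinv lam ^^ 3) z) = y3"
    by (auto simp: z_def Rinv_def y0_def y1_def y2_def y3_def eval_nat_numeral)
  have y1: "y1 < 1" using inner by (simp add: y1_def y0_def)
  have "lam * y1 \<le> lam * 1" using y1 lam by (intro mult_left_mono) auto
  then have y2: "y2 \<le> v + lam" using lh by (simp add: y2_def y0_def)
  have "lam * y2 \<le> lam * 1" using y2 v lam by (intro mult_left_mono) auto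
  moreover have "0 \<le> lam * y0" using v lh lam by (simp add: y0_def)
  ultimately have y3: "y3 < 1" using lam h1 unfolding y3_def y1_def by linarith
  have "y2 < 1" using y2 v lam by simp
  then have "snd ((Rinv lam ^^ j) z) < 1" if "j = 1 \<or> j = 2 \<or> j = 3" for j
    using that y1 y3 ys by blast
  then have "k \<noteq> 1" "k \<noteq> 2" "k \<noteq> 3" using k(3) not_less by blast+
  then have "k \<ge> 4" using k(1) by linarith
  then have "(Finv lam ^^ (k - 4)) z \<in> entry_strip lam"
    using strip_before_late_exit k(3-5) by blast
  moreover have "real (k - 4) \<le> 20 / lam" using k(2) k0(1) by simp
  ultimately show ?thesis unfolding reaches_strip_def z_def by blast
qed

text \<open>
  At the left edge, and with \<open>v\<close> away from \<open>1/2\<close> and \<open>1\<close>. While a point slides, \<open>u\<close> decreases faster than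
  \<open>v\<close> changes, so that \<open>v - u\<close> increases and \<open>v + u\<close> decreases. Stated with these sums, the condition is
  preserved, and the drift of \<open>v\<close> never has to be summed up.
\<close>

definition sliding :: "real \<Rightarrow> point \<Rightarrow> bool" where
  "sliding lam = (\<lambda>(u, v). 0 \<le> u \<and> u \<le> lam * v \<and> v - u \<ge> 1/2 + 10 * lam \<and> v + u \<le> 1 - 10 * lam)"

lemma Finv_twice_left_strip:
  assumes lam: "0 < lam" "lam \<le> 1 / 100" and O: "(u, v) \<in> Omega"
    and u: "u \<le> lam * v" and v: "lam \<le> v"
  shows "(Finv lam ^^ 2) (u, v) = (lam * v - u, 1 - v + lam * (lam * v - u))"
    "lam * (lam * v - u) < v" "(v, lam * v - u) \<in> Omega"
proof -
  define h where "h = lam * v - u"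
  have b: "0 \<le> u" "v < 1" using O by (auto simp: Omega_def)
  have "lam * v < lam" using b lam by simp
  then have h: "0 \<le> h" "h < lam" using u b by (auto simp: h_def)
  show lt: "lam * (lam * v - u) < v"
    using mult_strict_mono[of lam 1 h v] h v lam unfolding h_def[symmetric] by simp
  show O2: "(v, lam * v - u) \<in> Omega"
    using h b v lam unfolding h_def[symmetric] by (auto simp: Omega_def)
  have "Finv lam (u, v) = (v, h)" using Finv_eq_shift[OF O] u lam by (simp add: h_def)
  moreover have "Finv lam (v, h) = Rinv lam (v, h)"
    using Finv_eq_Rinv[of v h lam] O2 lt lam by (simp add: h_def)
  ultimately show "(Finv lam ^^ 2) (u, v) = (lam * v - u, 1 - v + lam * (lam * v - u))"
    unfolding h_def[symmetric] by (simp add: numeral_2_eq_2 Rinv_def)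
qed

text \<open>
  Two backward steps from \<open>(u, v)\<close> lead to \<open>(h, 1 - v + \<lambda> h)\<close> with \<open>h = \<lambda> v - u\<close>. If this point is
  again at the edge, then two more steps return to a point near \<open>(u - \<lambda> (2 v - 1), v)\<close>; if not, then
  the passage through the square begins.
\<close>

lemma sliding_step:
  assumes lam: "0 < lam" "lam \<le> 1 / 100" and sl: "sliding lam (u, v)"
  shows "reaches_strip lam (20 / lam + 2) (u, v) \<or>
    (\<exists>u1 v1. (Finv lam ^^ 4) (u, v) = (u1, v1) \<and> sliding lam (u1, v1) \<and> u1 \<le> u - lam\<^sup>2)"
proof -
  have u: "0 \<le> u" "u \<le> lam * v" "v - u \<ge> 1/2 + 10 * lam" "v + u \<le> 1 - 10 * lam"
    using sl by (auto simp: sliding_def)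
  have v: "1/2 + 10 * lam \<le> v" "v \<le> 1 - 10 * lam" using u by auto
  have lv: "lam * v \<le> lam * 1" using v lam by (intro mult_left_mono) auto
  have O: "(u, v) \<in> Omega" using u v lam by (auto simp: Omega_def)
  define h where "h = lam * v - u"
  define v' where "v' = 1 - v + lam * h"
  have h: "0 \<le> h" "h \<le> lam * v" "h \<le> lam" using u lv by (auto simp: h_def)
  have lh: "0 \<le> lam * h" "lam * h \<le> lam / 100" using h lam mult_mono[of lam "1/100" h lam] by auto
  have v': "10 * lam \<le> v'" "v' \<le> 1/2" using v lh lam unfolding v'_def by linarith+
  have two: "(Finv lam ^^ 2) (u, v) = (h, v')"
    using Finv_twice_left_strip[OF lam O] u v lam by (simp add: h_def v'_def)
  have O2: "(h, v') \<in> Omega" using h v' lam by (auto simp: Omega_def)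
  show ?thesis
  proof (cases "h \<le> lam * v'")
    case False
    then have "reaches_strip lam (20 / lam) (h, v')"
      using left_edge_reaches_strip[OF lam h(1,2) v] by (simp add: v'_def)
    then have "reaches_strip lam (20 / lam + 2) (u, v)"
      using reaches_strip_step[of lam "20 / lam" 2 "(u, v)" "20 / lam + 2"] two by simp
    then show ?thesis ..
  next
    case True
    define h' where "h' = lam * v' - h"
    have "lam * v' \<le> lam * (1/2)" using v' lam by (intro mult_left_mono) auto
    then have h': "0 \<le> h'" "h' \<le> lam / 2" using True h by (auto simp: h'_def)
    define v1 where "v1 = 1 - v' + lam * h'"
    have four: "(Finv lam ^^ 4) (u, v) = (h', v1)"
    proof -
      have "(Finv lam ^^ 4) (u, v) = (Finv lam ^^ 2) ((Finv lam ^^ 2) (u, v))"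
        by (simp add: eval_nat_numeral)
      then show ?thesis unfolding two
        using Finv_twice_left_strip[OF lam O2 True] v' lam by (simp add: h'_def v1_def)
    qed
    have lh': "0 \<le> lam * h'" "lam * h' \<le> 1 * (lam / 2)"
      using h' lam by (auto intro!: mult_mono)
    have v1: "v1 - v = lam * h' - lam * h" by (simp add: v1_def v'_def)
    have u1: "h' - u = lam * (1 - 2 * v + lam * h)"
      by (simp add: h'_def v'_def h_def algebra_simps)
    have "lam * (1 - 2 * v + lam * h) \<le> lam * (- 19 * lam)"
      using v lh lam by (intro mult_left_mono; linarith)
    then have dec: "h' \<le> u - 19 * (lam * lam)" using u1 by simp
    have "lam * (1/2) \<le> lam * v1"
      using v' lh' lam by (intro mult_left_mono) (auto simp: v1_def)
    moreover have "lam * h \<le> lam * lam" "lam * h' \<le> lam * lam"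
      using h h' lam by (auto intro!: mult_left_mono)
    ultimately have "sliding lam (h', v1)"
      using h' dec v1 lh lh' u unfolding sliding_def prod.case by (intro conjI; linarith)
    moreover have "h' \<le> u - lam\<^sup>2"
      using dec zero_le_square[of lam] unfolding power2_eq_square by linarith
    ultimately show ?thesis using four by blast
  qed
qed

lemma sliding_reaches_strip_steps:
  assumes lam: "0 < lam" "lam \<le> 1 / 100"
  shows "sliding lam (u, v) \<Longrightarrow> u \<le> n * lam\<^sup>2 \<Longrightarrow> reaches_strip lam (20 / lam + 2 + 4 * real n) (u, v)"
proof (induction n arbitrary: u v)
  case 0
  have "lam\<^sup>2 > 0" using lam by simp
  then have "\<not> sliding lam (u1, v1)" if "u1 \<le> u - lam\<^sup>2" for u1 v1
    using that 0 \<open>lam\<^sup>2 > 0\<close> unfolding sliding_def prod.case of_nat_0 by linarith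
  then show ?case using sliding_step[OF lam 0(1)] by auto
next
  case (Suc n)
  from sliding_step[OF lam Suc.prems(1)] show ?case
  proof (elim disjE exE conjE)
    assume "reaches_strip lam (20 / lam + 2) (u, v)"
    then show ?thesis using reaches_strip_step[of lam "20 / lam + 2" 0 "(u, v)"] by simp
  next
    fix u1 v1
    assume 1: "(Finv lam ^^ 4) (u, v) = (u1, v1)" "sliding lam (u1, v1)" "u1 \<le> u - lam\<^sup>2"
    then have "u1 \<le> n * lam\<^sup>2" using Suc.prems(2) by (simp add: algebra_simps)
    then show ?thesis
      using Suc.IH[OF 1(2)] reaches_strip_step[of lam "20 / lam + 2 + 4 * real n" 4 "(u, v)"] 1(1) by simp
  qed
qed

lemma sliding_reaches_strip:
  assumes lam: "0 < lam" "lam \<le> 1 / 100" and s: "sliding lam z"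
  shows "reaches_strip lam (30 / lam) z"
proof -
  obtain u v where z: "z = (u, v)" by (cases z)
  define n where "n = nat \<lceil>1 / lam\<rceil>"
  have n: "1 / lam \<le> n" "n \<le> 1 / lam + 1" using lam by (auto simp: n_def)
  have "u \<le> lam * v" "v \<le> 1" using s z lam by (auto simp: sliding_def)
  then have "u \<le> lam" using mult_left_mono[of v 1 lam] lam by linarith
  also have "\<dots> = 1 / lam * lam\<^sup>2" using lam by (simp add: power2_eq_square)
  also have "\<dots> \<le> n * lam\<^sup>2" using n by (intro mult_right_mono) auto
  finally have "reaches_strip lam (20 / lam + 2 + 4 * real n) z"
    using sliding_reaches_strip_steps[OF lam] s z by blast
  moreover have "20 / lam + 2 + 4 * real n \<le> 30 / lam"
  proof -
    have "6 \<le> 6 / lam" using lam by (simp add: field_simps)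
    moreover have "30 / lam = 20 / lam + 4 * (1 / lam) + 6 / lam" by (simp add: field_simps)
    ultimately show ?thesis using n by linarith
  qed
  ultimately show ?thesis using reaches_strip_step[of lam _ 0 z "30 / lam"] by simp
qed

text \<open>
  The places at the left edge where the sliding argument fails: next to the corners, and next to the
  middle of the edge, where \<open>2 v - 1\<close> is too small.
\<close>

definition edge_junctions :: "real \<Rightarrow> point set" where
  "edge_junctions lam = {0..lam} \<times> ({0..12 * lam} \<union> {1/2 - 12 * lam..1/2 + 12 * lam} \<union> {1 - 12 * lam..1})"

text \<open>
  A point with \<open>v < 1/2\<close> becomes a sliding point with \<open>v > 1/2\<close> in two steps.
\<close>

lemma left_strip_reaches_strip:
  assumes lam: "0 < lam" "lam \<le> 1 / 100" and O: "(u, v) \<in> Omega" and u: "u \<le> lam * v"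
    and nj: "(u, v) \<notin> edge_junctions lam"
  shows "reaches_strip lam (30 / lam + 2) (u, v)"
proof -
  have uv: "0 \<le> u" "0 \<le> v" "v < 1" using O by (auto simp: Omega_def)
  have lv: "lam * v \<le> lam * 1" using uv lam by (intro mult_left_mono) auto
  then have "u \<le> lam" using u by simp
  then consider "12 * lam < v" "v < 1/2 - 12 * lam" | "1/2 + 12 * lam < v" "v < 1 - 12 * lam"
    using nj uv by (force simp: edge_junctions_def)
  then show ?thesis
  proof cases
    case 2
    then have "sliding lam (u, v)" using uv u \<open>u \<le> lam\<close> lam by (auto simp: sliding_def)
    then show ?thesis
      using sliding_reaches_strip[OF lam] reaches_strip_step[of lam "30 / lam" 0 "(u, v)"] by simp
  next
    case 1
    define h where "h = lam * v - u"
    have h: "0 \<le> h" "h \<le> lam * v" using uv u by (auto simp: h_def)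
    have "lam * v \<le> lam * (1/2)" using 1 lam by (intro mult_left_mono) auto
    then have h2: "h \<le> lam / 2" using h by simp
    have lh: "0 \<le> lam * h" "lam * h \<le> 1 * h" using h lam mult_right_mono[of lam 1 h] by auto
    have "lam * (1/2) \<le> lam * (1 - v + lam * h)"
      using 1 lh lam by (intro mult_left_mono; linarith)
    then have "sliding lam (h, 1 - v + lam * h)"
      using 1 h h2 lh lam unfolding sliding_def prod.case by (intro conjI; linarith)
    then have "reaches_strip lam (30 / lam) ((Finv lam ^^ 2) (u, v))"
      using Finv_twice_left_strip[OF lam O u] 1 lam sliding_reaches_strip[OF lam] by (simp add: h_def)
    then show ?thesis using reaches_strip_step by force
  qed
qed

lemma reaches_strip_or_edge_junction:
  assumes lam: "0 < lam" "lam \<le> 1 / 100" and O: "z \<in> Omega"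
    and out: "rho lam z \<ge> (1 + lam\<^sup>2)\<^sup>2 * rhoE lam"
  shows "reaches_strip lam (40 / lam) z \<or> (\<exists>j<3. (Finv lam ^^ j) z \<in> edge_junctions lam)"
proof -
  have l1: "lam \<le> 1" using lam by simp
  obtain k0 where k0: "real k0 \<le> 20 / lam" "snd ((Rinv lam ^^ k0) z) \<ge> 1"
    using escape_time[OF lam(1) l1 out] by blast
  obtain k where k: "0 < k" "k \<le> k0" "snd ((Rinv lam ^^ k) z) \<ge> 1"
    "\<And>j. j < k \<Longrightarrow> (Finv lam ^^ j) z = (Rinv lam ^^ j) z"
    "\<And>j. j < k \<Longrightarrow> (Rinv lam ^^ j) z \<in> Omega"
    using first_exit[OF less_imp_le[OF lam(1)] l1 O k0(2)] by blast
  show ?thesis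
  proof (cases "k \<ge> 4")
    case True
    then have "(Finv lam ^^ (k - 4)) z \<in> entry_strip lam"
      using strip_before_late_exit k(3-5) by blast
    moreover have "20 / lam \<le> 40 / lam" using lam by (intro divide_right_mono) auto
    then have "real (k - 4) \<le> 40 / lam" using k(2) k0(1) by simp
    ultimately show ?thesis unfolding reaches_strip_def by blast
  next
    case False
    define j where "j = k - 1"
    have j: "j < 3" "k = Suc j" using False k(1) by (auto simp: j_def)
    obtain u v where uv: "(Rinv lam ^^ j) z = (u, v)" by (cases "(Rinv lam ^^ j) z")
    have O': "(u, v) \<in> Omega" using k(5)[of j] j uv by simp
    have F: "(Finv lam ^^ j) z = (u, v)" using k(4)[of j] j uv by simp
    have "u \<le> lam * v" using k(3) unfolding j(2) funpow.simps comp_def uv by (simp add: Rinv_def)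
    then have "(u, v) \<in> edge_junctions lam \<or> reaches_strip lam (30 / lam + 2) (u, v)"
      using left_strip_reaches_strip[OF lam O'] by blast
    moreover have "30 / lam + 2 + real j \<le> 40 / lam"
    proof -
      have "10 \<le> 10 / lam" using lam by (simp add: field_simps)
      moreover have "40 / lam = 30 / lam + 10 / lam" by (simp add: field_simps)
      ultimately show ?thesis using j by linarith
    qed
    ultimately show ?thesis using F j reaches_strip_step[of lam "30 / lam + 2" j z] by metis
  qed
qed

section \<open>Tangents of the island\<close>

text \<open>
  Let \<open>c\<close> be the coordinates of the centre, \<open>q = y - c\<close> and \<open>x - c = p cos \<theta> + q sin \<theta>\<close>. Then \<^const>\<open>Qform\<close>
  is \<open>cos\<^sup>2 \<theta>\<close> times the Euclidean metric of the plane with coordinates \<open>(p, q)\<close>, and the defined value is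
  \<open>p sin \<alpha> + q cos \<alpha>\<close>, the coordinate in the direction at angle \<open>\<alpha>\<close> clockwise from the \<open>q\<close>-axis.
  The island is a disc in these coordinates, and the lines \<open>ell n\<close> and their mirror images are tangents
  of it.
\<close>

definition tang :: "real \<Rightarrow> real \<Rightarrow> point \<Rightarrow> real" where
  "tang lam \<alpha> z =
     ((fst z - 1 / (2 - lam)) - (snd z - 1 / (2 - lam)) * sin (theta lam)) / cos (theta lam) * sin \<alpha>
       + (snd z - 1 / (2 - lam)) * cos \<alpha>"

text \<open>
  The radius of the island in the coordinates of \<open>tang\<close>, which is also the distance of its tangents
  from the centre.
\<close>

definition apothem :: "real \<Rightarrow> real" where
  "apothem lam = 1 - 1 / (2 - lam)"

lemma tang_0: "tang lam 0 z = snd z - 1 / (2 - lam)"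
  by (simp add: tang_def)

lemma tang_right:
  assumes "0 < lam" "lam \<le> 1"
  shows "tang lam (pi / 2 - theta lam) z = fst z - 1 / (2 - lam)"
proof -
  have "sin (pi / 2 - theta lam) = cos (theta lam)" "cos (pi / 2 - theta lam) = sin (theta lam)"
    by (simp_all add: sin_diff cos_diff)
  then show ?thesis using cos_theta_pos[OF assms] by (simp add: tang_def)
qed

lemma tang_centre_add:
  "tang lam \<alpha> (centre lam + (X, Y)) = (X - Y * sin (theta lam)) / cos (theta lam) * sin \<alpha> + Y * cos \<alpha>"
  by (simp add: tang_def centre_def)

lemma tang_Cmap:
  assumes "0 < lam" "lam \<le> 1"
  shows "tang lam \<alpha> (centre lam + Cmap lam (w - centre lam)) = tang lam (\<alpha> + (pi / 2 - theta lam)) w"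
proof -
  obtain X Y where w: "w = centre lam + (X, Y)"
    by (metis add.commute diff_add_cancel surj_pair)
  define S K where "S = sin (theta lam)" and "K = cos (theta lam)"
  have K: "K > 0" "K * K = 1 - S * S"
    using cos_theta_pos[OF assms] sin_cos_squared_add[of "theta lam"]
    by (auto simp: K_def S_def power2_eq_square algebra_simps)
  have lX: "lam * X = 2 * S * X" using theta_facts(1)[OF assms] by (simp add: S_def)
  have 1: "tang lam \<alpha> (centre lam + Cmap lam (w - centre lam))
      = ((lam * X - Y) - X * S) / K * sin \<alpha> + X * cos \<alpha>"
    using tang_centre_add[of lam \<alpha> "lam * X - Y" X] by (simp add: w Cmap_def S_def K_def)
  have 2: "tang lam (\<alpha> + (pi / 2 - theta lam)) w
      = (X - Y * S) / K * (cos \<alpha> * K + sin \<alpha> * S) + Y * (cos \<alpha> * S - sin \<alpha> * K)"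
    by (simp add: w tang_centre_add S_def K_def sin_add cos_add sin_diff cos_diff algebra_simps)
  have "(X - Y * S) * (cos \<alpha> * K + sin \<alpha> * S) + Y * (cos \<alpha> * S - sin \<alpha> * K) * K
      = X * S * sin \<alpha> + X * cos \<alpha> * K - Y * sin \<alpha> * (K * K + S * S)"
    by (simp add: algebra_simps)
  also have "K * K + S * S = 1" using K(2) by simp
  finally have "((2 * S * X - Y) - X * S) * sin \<alpha> + X * cos \<alpha> * K
      = (X - Y * S) * (cos \<alpha> * K + sin \<alpha> * S) + Y * (cos \<alpha> * S - sin \<alpha> * K) * K"
    by (simp add: algebra_simps)
  then show ?thesis
    unfolding 1 2 lX using K(1) by (simp add: field_simps)
qed

lemma Rinv_eq: "lam \<noteq> 2 \<Longrightarrow> centre lam + Cmap lam (Rinv lam z - centre lam) = z"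
proof (cases z)
  case (Pair u v)
  define c where "c = 1 / (2 - lam)"
  assume "lam \<noteq> 2"
  then have "c * (2 - lam) = 1" by (simp add: c_def)
  then have "c * 2 = 1 + c * lam" by (simp add: algebra_simps)
  then show ?thesis
    unfolding Pair Rinv_def Cmap_def centre_def c_def[symmetric] by (simp add: algebra_simps)
qed

lemma tang_Rinv:
  assumes "0 < lam" "lam \<le> 1"
  shows "tang lam (\<alpha> + (pi / 2 - theta lam)) (Rinv lam z) = tang lam \<alpha> z"
  using tang_Cmap[OF assms, of \<alpha> "Rinv lam z"] Rinv_eq[of lam z] assms by simp

lemma tang_Rinv_pow:
  assumes "0 < lam" "lam \<le> 1"
  shows "tang lam (\<alpha> + k * (pi / 2 - theta lam)) ((Rinv lam ^^ k) z) = tang lam \<alpha> z"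
proof (induction k)
  case (Suc k)
  have "\<alpha> + real (Suc k) * b = \<alpha> + real k * b + b" for b :: real
    by (simp add: algebra_simps)
  then show ?case
    using tang_Rinv[OF assms, of "\<alpha> + k * (pi / 2 - theta lam)" "(Rinv lam ^^ k) z"] Suc
    by (simp add: add.assoc)
qed simp

lemma tang_Cmap_pow:
  assumes "0 < lam" "lam \<le> 1"
  shows "tang lam \<alpha> (centre lam + (Cmap lam ^^ k) (w - centre lam)) = tang lam (\<alpha> + k * (pi / 2 - theta lam)) w"
proof (induction k arbitrary: \<alpha>)
  case (Suc k)
  have "tang lam \<alpha> (centre lam + (Cmap lam ^^ Suc k) (w - centre lam))
      = tang lam (\<alpha> + (pi / 2 - theta lam)) (centre lam + (Cmap lam ^^ k) (w - centre lam))"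
    using tang_Cmap[OF assms, of \<alpha> "centre lam + (Cmap lam ^^ k) (w - centre lam)"] by simp
  also have "\<dots> = tang lam (\<alpha> + (pi / 2 - theta lam) + k * (pi / 2 - theta lam)) w"
    by (rule Suc.IH)
  also have "\<alpha> + b + real k * b = \<alpha> + real (Suc k) * b" for b :: real
    by (simp add: algebra_simps)
  finally show ?case .
qed simp

lemma Cmap_Rinv_pow:
  assumes "lam \<noteq> 2"
  shows "centre lam + (Cmap lam ^^ k) ((Rinv lam ^^ k) z - centre lam) = z"
proof (induction k)
  case (Suc k)
  have "Cmap lam ((Rinv lam ^^ Suc k) z - centre lam) = (Rinv lam ^^ k) z - centre lam"
    using Rinv_eq[OF assms, of "(Rinv lam ^^ k) z"] by (simp add: eq_diff_eq add.commute)
  then have "(Cmap lam ^^ Suc k) ((Rinv lam ^^ Suc k) z - centre lam)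
      = (Cmap lam ^^ k) ((Rinv lam ^^ k) z - centre lam)"
    by (simp add: funpow_swap1)
  then show ?case using Suc by simp
qed simp

text \<open>
  Four rotations make a full turn up to the angle \<open>4 \<theta>\<close>.
\<close>

lemma tang_full_turns:
  "tang lam (\<alpha> + real (4 * n) * (pi / 2 - theta lam)) z = tang lam (\<alpha> - 4 * real n * theta lam) z"
proof -
  have "\<alpha> + real (4 * n) * (pi / 2 - theta lam) = (\<alpha> - 4 * real n * theta lam) + 2 * pi * of_int (int n)"
    by (simp add: algebra_simps)
  then show ?thesis
    using sin_int_2pin[of "int n"] cos_int_2pin[of "int n"]
    by (simp only: tang_def sin_add cos_add) simp
qed

lemma ell_tang:
  assumes "0 < lam" "lam \<le> 1"
  shows "ell lam n = {z. tang lam (4 * real n * theta lam) z = apothem lam}"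
proof (intro equalityI subsetI)
  fix z assume "z \<in> ell lam n"
  then obtain w where w: "snd w = 1" "z = centre lam + (Cmap lam ^^ (4 * n)) (w - centre lam)"
    by (auto simp: ell_def)
  then have "tang lam (4 * real n * theta lam) z
      = tang lam (4 * real n * theta lam + real (4 * n) * (pi / 2 - theta lam)) w"
    using tang_Cmap_pow[OF assms] by simp
  also have "\<dots> = apothem lam"
    using w by (simp only: tang_full_turns) (simp add: tang_0 apothem_def)
  finally show "z \<in> {z. tang lam (4 * real n * theta lam) z = apothem lam}" by simp
next
  fix z assume "z \<in> {z. tang lam (4 * real n * theta lam) z = apothem lam}"
  then have "tang lam (4 * real n * theta lam + real (4 * n) * (pi / 2 - theta lam)) ((Rinv lam ^^ (4 * n)) z) = apothem lam"
    using tang_Rinv_pow[OF assms, of "4 * real n * theta lam" "4 * n" z] by simp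
  then have "snd ((Rinv lam ^^ (4 * n)) z) = 1"
    by (simp only: tang_full_turns) (simp add: tang_0 apothem_def)
  then show "z \<in> ell lam n"
    unfolding ell_def using Cmap_Rinv_pow[of lam "4 * n" z] assms
    by (intro image_eqI[of _ _ "(Rinv lam ^^ (4 * n)) z"]) auto
qed

lemma snd_Rinv_pow_4:
  assumes "0 < lam" "lam \<le> 1"
  shows "snd ((Rinv lam ^^ 4) z) - 1 / (2 - lam) = tang lam (4 * theta lam) z"
proof -
  have "tang lam (4 * theta lam) z
      = tang lam (4 * theta lam + real (4 * 1) * (pi / 2 - theta lam)) ((Rinv lam ^^ 4) z)"
    using tang_Rinv_pow[OF assms, of "4 * theta lam" 4 z] by simp
  then show ?thesis by (simp only: tang_full_turns) (simp add: tang_0)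
qed

lemma tang_G:
  assumes "0 < lam" "lam \<le> 1"
  shows "tang lam \<alpha> (G z) = tang lam (pi / 2 - theta lam - \<alpha>) z"
proof -
  obtain X Y where z: "z = centre lam + (X, Y)"
    by (metis add.commute diff_add_cancel surj_pair)
  define S K where "S = sin (theta lam)" and "K = cos (theta lam)"
  have K: "K > 0" "K * K = 1 - S * S"
    using cos_theta_pos[OF assms] sin_cos_squared_add[of "theta lam"]
    by (auto simp: K_def S_def power2_eq_square algebra_simps)
  have "G z = centre lam + (Y, X)" by (simp add: z G_def centre_def)
  then have 1: "tang lam \<alpha> (G z) = (Y - X * S) / K * sin \<alpha> + X * cos \<alpha>"
    by (simp only: tang_centre_add S_def K_def)
  have 2: "tang lam (pi / 2 - theta lam - \<alpha>) z
      = (X - Y * S) / K * (K * cos \<alpha> - S * sin \<alpha>) + Y * (S * cos \<alpha> + K * sin \<alpha>)"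
  proof -
    have "pi / 2 - theta lam - \<alpha> = pi / 2 - (theta lam + \<alpha>)" by simp
    then have "sin (pi / 2 - theta lam - \<alpha>) = cos (theta lam + \<alpha>)"
      "cos (pi / 2 - theta lam - \<alpha>) = sin (theta lam + \<alpha>)"
      by (simp_all only: sin_diff cos_diff) simp_all
    then show ?thesis
      by (simp add: z tang_centre_add S_def K_def sin_add cos_add)
  qed
  have "(X - Y * S) * (K * cos \<alpha> - S * sin \<alpha>) + Y * (S * cos \<alpha> + K * sin \<alpha>) * K
      = X * cos \<alpha> * K - X * S * sin \<alpha> + Y * sin \<alpha> * (K * K + S * S)"
    by (simp add: algebra_simps)
  also have "K * K + S * S = 1" using K(2) by simp
  finally have "(Y - X * S) * sin \<alpha> + X * cos \<alpha> * K
      = (X - Y * S) * (K * cos \<alpha> - S * sin \<alpha>) + Y * (S * cos \<alpha> + K * sin \<alpha>) * K"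
    by (simp add: algebra_simps)
  then show ?thesis unfolding 1 2 using K(1) by (simp add: field_simps)
qed

text \<open>
  The direction normal to \<open>G ` ell n\<close>.
\<close>

definition exit_angle :: "real \<Rightarrow> nat \<Rightarrow> real" where
  "exit_angle lam n = pi / 2 - (4 * real n + 1) * theta lam"

lemma G_ell_tang:
  assumes "0 < lam" "lam \<le> 1"
  shows "G ` ell lam n = {z. tang lam (exit_angle lam n) z = apothem lam}"
proof -
  have a: "pi / 2 - theta lam - 4 * real n * theta lam = exit_angle lam n"
    by (simp add: exit_angle_def algebra_simps)
  have GG: "G (G z) = z" for z by (cases z) (simp add: G_def)
  have "G ` ell lam n = {z. G z \<in> ell lam n}"
  proof (intro set_eqI iffI)
    fix w assume "w \<in> {z. G z \<in> ell lam n}"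
    then have "G (G w) \<in> G ` ell lam n" by blast
    then show "w \<in> G ` ell lam n" by (simp only: GG)
  next
    fix w assume "w \<in> G ` ell lam n"
    then obtain v where "v \<in> ell lam n" "w = G v" by blast
    then show "w \<in> {z. G z \<in> ell lam n}" by (simp only: GG mem_Collect_eq)
  qed
  then show ?thesis by (simp add: ell_tang[OF assms] tang_G[OF assms] a)
qed

text \<open>
  The three directions are linearly dependent in the plane, with the sines of the angles between them
  as coefficients.
\<close>

lemma tang_three:
  "tang lam \<gamma> z * sin (\<beta> - \<alpha>) = tang lam \<alpha> z * sin (\<beta> - \<gamma>) + tang lam \<beta> z * sin (\<gamma> - \<alpha>)"
proof -
  have *: "(p * sin \<gamma> + q * cos \<gamma>) * sin (\<beta> - \<alpha>)
      = (p * sin \<alpha> + q * cos \<alpha>) * sin (\<beta> - \<gamma>) + (p * sin \<beta> + q * cos \<beta>) * sin (\<gamma> - \<alpha>)" for p q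
    by (simp add: sin_diff algebra_simps)
  show ?thesis unfolding tang_def by (rule *)
qed

lemma sin_add_less:
  fixes x y :: real
  assumes "0 < x" "0 < y" "x + y < pi"
  shows "sin (x + y) < sin x + sin y"
proof -
  have "sin x > 0" "sin y > 0" using assms by (auto intro: sin_gt_zero)
  moreover have "cos y < 1" using cos_monotone_0_pi[of 0 y] assms by simp
  ultimately have "sin x * cos y < sin x * 1" by (intro mult_strict_left_mono) auto
  moreover have "cos x * sin y \<le> 1 * sin y"
    using \<open>sin y > 0\<close> by (intro mult_right_mono) auto
  ultimately show ?thesis by (simp add: sin_add)
qed

text \<open>
  At the intersection of two tangents, a tangent with a direction between theirs has been crossed, and
  a tangent with a direction outside has not; this and the next two lemmas are the three cases.
\<close>

lemma tang_between:
  assumes "tang lam \<alpha> z = a" "tang lam \<beta> z = a" "a > 0" "\<alpha> < \<gamma>" "\<gamma> < \<beta>" "\<beta> < \<alpha> + pi"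
  shows "tang lam \<gamma> z > a"
proof -
  have p: "sin (\<beta> - \<alpha>) > 0" using assms by (intro sin_gt_zero) auto
  have "sin ((\<beta> - \<gamma>) + (\<gamma> - \<alpha>)) < sin (\<beta> - \<gamma>) + sin (\<gamma> - \<alpha>)"
    using assms by (intro sin_add_less) auto
  then have "a * sin (\<beta> - \<alpha>) < a * (sin (\<beta> - \<gamma>) + sin (\<gamma> - \<alpha>))" using assms(3) by simp
  also have "\<dots> = tang lam \<gamma> z * sin (\<beta> - \<alpha>)"
    using tang_three[of lam \<gamma> z \<beta> \<alpha>] assms(1,2) by (simp add: distrib_left)
  finally show ?thesis using p by simp
qed

lemma tang_below:
  assumes "tang lam \<alpha> z = a" "tang lam \<beta> z = a" "a > 0" "\<gamma> < \<alpha>" "\<alpha> < \<beta>" "\<beta> < \<gamma> + pi"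
  shows "tang lam \<gamma> z < a"
proof -
  have p: "sin (\<beta> - \<alpha>) > 0" using assms by (intro sin_gt_zero) auto
  have "sin ((\<beta> - \<alpha>) + (\<alpha> - \<gamma>)) < sin (\<beta> - \<alpha>) + sin (\<alpha> - \<gamma>)"
    using assms by (intro sin_add_less) auto
  then have "a * (sin (\<beta> - \<gamma>) - sin (\<alpha> - \<gamma>)) < a * sin (\<beta> - \<alpha>)" using assms(3) by simp
  moreover have "sin (\<gamma> - \<alpha>) = - sin (\<alpha> - \<gamma>)" using sin_minus[of "\<alpha> - \<gamma>"] by simp
  ultimately have "tang lam \<gamma> z * sin (\<beta> - \<alpha>) < a * sin (\<beta> - \<alpha>)"
    using tang_three[of lam \<gamma> z \<beta> \<alpha>] assms(1,2) by (simp add: right_diff_distrib)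
  then show ?thesis using p by simp
qed

lemma tang_above:
  assumes "tang lam \<alpha> z = a" "tang lam \<beta> z = a" "a > 0" "\<alpha> < \<beta>" "\<beta> < \<gamma>" "\<gamma> < \<alpha> + pi"
  shows "tang lam \<gamma> z < a"
proof -
  have p: "sin (\<beta> - \<alpha>) > 0" using assms by (intro sin_gt_zero) auto
  have "sin ((\<gamma> - \<beta>) + (\<beta> - \<alpha>)) < sin (\<gamma> - \<beta>) + sin (\<beta> - \<alpha>)"
    using assms by (intro sin_add_less) auto
  then have "a * (sin (\<gamma> - \<alpha>) - sin (\<gamma> - \<beta>)) < a * sin (\<beta> - \<alpha>)" using assms(3) by simp
  moreover have "sin (\<beta> - \<gamma>) = - sin (\<gamma> - \<beta>)" using sin_minus[of "\<gamma> - \<beta>"] by simp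
  ultimately have "tang lam \<gamma> z * sin (\<beta> - \<alpha>) < a * sin (\<beta> - \<alpha>)"
    using tang_three[of lam \<gamma> z \<beta> \<alpha>] assms(1,2) by (simp add: right_diff_distrib)
  then show ?thesis using p by simp
qed

lemma tang_intersection_exists:
  assumes "0 < lam" "lam \<le> 1" "\<alpha> < \<beta>" "\<beta> < \<alpha> + pi"
  shows "\<exists>z. tang lam \<alpha> z = a \<and> tang lam \<beta> z = a"
proof -
  define d where "d = sin (\<beta> - \<alpha>)"
  have d: "d > 0" unfolding d_def using assms by (intro sin_gt_zero) auto
  \<comment> \<open>Cramer's rule for the coordinates of the intersection\<close>
  define p q where "p = a * (cos \<alpha> - cos \<beta>) / d" and "q = a * (sin \<beta> - sin \<alpha>) / d"
  define z where "z = centre lam + (p * cos (theta lam) + q * sin (theta lam), q)"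
  have t: "tang lam \<gamma> z = p * sin \<gamma> + q * cos \<gamma>" for \<gamma>
    unfolding z_def tang_centre_add using cos_theta_pos[OF assms(1,2)] by simp
  have "a * (cos \<alpha> - cos \<beta>) * sin \<alpha> + a * (sin \<beta> - sin \<alpha>) * cos \<alpha> = a * d"
    "a * (cos \<alpha> - cos \<beta>) * sin \<beta> + a * (sin \<beta> - sin \<alpha>) * cos \<beta> = a * d"
    by (simp_all add: d_def sin_diff algebra_simps)
  then have "tang lam \<alpha> z = a" "tang lam \<beta> z = a"
    unfolding t p_def q_def using d by (simp_all add: field_simps)
  then show ?thesis by blast
qed

text \<open>
  The angle between the two tangents lies strictly between \<open>0\<close> and \<open>pi\<close>, so that they meet and the
  choice in \<^const>\<open>Qpt\<close> has a witness.
\<close>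

lemma Qpt_tang:
  assumes "0 < lam" "lam \<le> 1" "4 * real i * theta lam < exit_angle lam n"
  shows "tang lam (4 * real i * theta lam) (Qpt lam i n) = apothem lam"
    "tang lam (exit_angle lam n) (Qpt lam i n) = apothem lam"
proof -
  have th: "0 < theta lam" using theta_facts[OF assms(1,2)] by simp
  then have "0 \<le> 4 * real i * theta lam" "exit_angle lam n < pi"
    using pi_gt_zero by (auto simp: exit_angle_def algebra_simps intro!: add_pos_nonneg)
  then have "exit_angle lam n < 4 * real i * theta lam + pi" by linarith
  then obtain z where "tang lam (4 * real i * theta lam) z = apothem lam"
    "tang lam (exit_angle lam n) z = apothem lam"
    using tang_intersection_exists[OF assms(1,2,3), of "apothem lam"] by blast
  then have "\<exists>z. z \<in> ell lam i \<inter> G ` ell lam n"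
    by (intro exI[of _ z] IntI; subst ell_tang[OF assms(1,2)] G_ell_tang[OF assms(1,2)]) simp_all
  then have "Qpt lam i n \<in> ell lam i \<inter> G ` ell lam n"
    unfolding Qpt_def by (rule someI_ex)
  then have "Qpt lam i n \<in> ell lam i" "Qpt lam i n \<in> G ` ell lam n" by blast+
  then show "tang lam (4 * real i * theta lam) (Qpt lam i n) = apothem lam"
    "tang lam (exit_angle lam n) (Qpt lam i n) = apothem lam"
    using G_ell_tang[OF assms(1,2), of n] ell_tang[OF assms(1,2), of i] by blast+
qed

section \<open>The inner quadrilaterals\<close>

lemma affine_form_tang:
  "affine_form (\<lambda>z. tang lam \<alpha> z - a)" "affine_form (\<lambda>z. a - tang lam \<alpha> z)"
proof -
  define s c where "s = sin \<alpha> / cos (theta lam)" and "c = cos \<alpha> - sin (theta lam) * s"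
  have "tang lam \<alpha> z = s * fst z + c * snd z - (s + c) / (2 - lam)" for z
    by (simp add: tang_def s_def c_def diff_divide_distrib add_divide_distrib algebra_simps)
  then have 1: "(\<lambda>z. tang lam \<alpha> z - a) = (\<lambda>z. s * fst z + c * snd z + (- ((s + c) / (2 - lam)) - a))"
    "(\<lambda>z. a - tang lam \<alpha> z) = (\<lambda>z. (- s) * fst z + (- c) * snd z + ((s + c) / (2 - lam) + a))"
    by (auto simp: fun_eq_iff)
  show "affine_form (\<lambda>z. tang lam \<alpha> z - a)" unfolding affine_form_def 1 by blast
  show "affine_form (\<lambda>z. a - tang lam \<alpha> z)" unfolding affine_form_def 1 by blast
qed

lemma apothem_pos: "0 < lam \<Longrightarrow> lam < 1 \<Longrightarrow> apothem lam > 0"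
  by (simp add: apothem_def field_simps)

text \<open>
  The normal directions of the four edges are \<open>0 < 4 \<theta> < exit_angle n < exit_angle (n - 1)\<close>, and every
  vertex is the intersection of two of the lines. The position of a vertex relative to the other two
  lines is therefore decided by the order of these angles. The bound on \<open>n\<close> gives \<open>4 \<theta> < exit_angle n\<close>.
\<close>

lemma in_Lambda_in:
  assumes lam: "0 < lam" "lam < 1" and n: "1 \<le> n" "(4 * real n + 5) * theta lam < pi / 2"
    and z: "tang lam 0 z < apothem lam" "tang lam (4 * theta lam) z > apothem lam"
      "tang lam (exit_angle lam (n - 1)) z < apothem lam" "tang lam (exit_angle lam n) z > apothem lam"
  shows "z \<in> Lambda_in lam n"
proof -
  have lam': "lam \<le> 1" using lam by simp
  define th where "th = theta lam"
  define d where "d = exit_angle lam n"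
  define k where "k = n - 1"
  have nk: "real n = real k + 1" using n(1) by (simp add: k_def)
  define e where "e = exit_angle lam k"
  have th: "0 < th" using theta_facts[OF lam(1) lam'] by (simp add: th_def)
  have o: "4 * th < d" "d < e" "e < pi / 2" "0 < 4 * th"
    using n(2) th by (auto simp: d_def e_def exit_angle_def th_def nk algebra_simps intro!: add_pos_nonneg)
  let ?a = "apothem lam"
  have a: "?a > 0" using apothem_pos lam by simp
  define A B C D where pts: "A = Qpt lam 0 n" "B = Qpt lam 0 k" "C = Qpt lam 1 k" "D = Qpt lam 1 n"
  have q: "tang lam 0 A = ?a" "tang lam d A = ?a" "tang lam 0 B = ?a" "tang lam e B = ?a"
    "tang lam (4 * th) C = ?a" "tang lam e C = ?a" "tang lam (4 * th) D = ?a" "tang lam d D = ?a"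
    using Qpt_tang[OF lam(1) lam', of 0 n] Qpt_tang[OF lam(1) lam', of 0 k]
      Qpt_tang[OF lam(1) lam', of 1 k] Qpt_tang[OF lam(1) lam', of 1 n] o
    unfolding d_def[symmetric] e_def[symmetric] th_def[symmetric] pts by simp_all
  define L where "L i = [\<lambda>z. ?a - tang lam 0 z, \<lambda>z. ?a - tang lam e z,
    \<lambda>z. tang lam (4 * th) z - ?a, \<lambda>z. tang lam d z - ?a] ! i" for i :: nat
  have L: "L 0 = (\<lambda>z. ?a - tang lam 0 z)" "L (Suc 0) = (\<lambda>z. ?a - tang lam e z)"
    "L 2 = (\<lambda>z. tang lam (4 * th) z - ?a)" "L 3 = (\<lambda>z. tang lam d z - ?a)"
    "L (Suc (Suc 0)) = (\<lambda>z. tang lam (4 * th) z - ?a)"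
    by (simp_all add: L_def)
  have pi: "0 < pi" by simp
  show ?thesis unfolding Lambda_in_def k_def[symmetric] pts[symmetric]
  proof (rule half_plane_region_subset_polygon[where L = L])
    fix i assume "i < length [A, B, C, D]"
    then have i: "i = 0 \<or> i = 1 \<or> i = 2 \<or> i = 3" by auto
    show "affine_form (L i)" using i by (auto simp: L affine_form_tang)
    show "L i ([A, B, C, D] ! i) = 0 \<and> L i ([A, B, C, D] ! (Suc i mod length [A, B, C, D])) = 0"
      using i by (auto simp: L q)
    have "tang lam e A < ?a" using tang_above[OF q(1,2) a, of e] o pi by linarith
    moreover have "tang lam (4 * th) B > ?a" using tang_between[OF q(3,4) a, of "4 * th"] o pi by linarith
    moreover have "tang lam d C > ?a" using tang_between[OF q(5,6) a, of d] o pi by linarith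
    moreover have "tang lam 0 D < ?a" using tang_below[OF q(7,8) a, of 0] o pi by linarith
    ultimately show "L (Suc i mod length [A, B, C, D]) ([A, B, C, D] ! i) > 0"
      using i by (auto simp: L)
    have "tang lam 0 C < ?a" using tang_below[OF q(5,6) a, of 0] o pi by linarith
    moreover have "tang lam e D < ?a" using tang_above[OF q(7,8) a, of e] o pi by linarith
    moreover have "tang lam (4 * th) A > ?a" using tang_between[OF q(1,2) a, of "4 * th"] o pi by linarith
    moreover have "tang lam d B > ?a" using tang_between[OF q(3,4) a, of d] o pi by linarith
    ultimately show "L i ([A, B, C, D] ! (Suc (Suc i mod length [A, B, C, D]) mod length [A, B, C, D])) > 0"
      using i by (auto simp: L)
    show "L i z > 0" using i z by (auto simp: L d_def e_def th_def k_def)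
  qed simp
qed

text \<open>
  The index is the first \<open>n\<close> for which the tangent at \<open>exit_angle n\<close> has been crossed. For the bound
  on \<open>n\<close> it suffices that the tangent for \<open>n = N - 2\<close> has been crossed. Its angle is less than \<open>12 \<theta>\<close>, so
  that it meets the strip only within \<open>O(\<lambda>)\<close> of the left end.
\<close>

lemma in_Lambda_in_exists:
  assumes lam: "0 < lam" "lam \<le> 1 / 100"
    and z: "snd z < 1" "tang lam (4 * theta lam) z > apothem lam" "fst z < 1" "fst z > 1/2 + 10 * lam"
    and off: "\<And>n. tang lam (exit_angle lam n) z \<noteq> apothem lam"
  shows "\<exists>n\<in>{1..Nmax lam - 1}. z \<in> Lambda_in lam n"
proof -
  have lam': "lam \<le> 1" "lam < 1" using lam by auto
  define th where "th = theta lam"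
  note th = theta_facts[OF lam(1) lam'(1), folded th_def]
  have thl: "th \<le> lam" using theta_le[OF lam(1) lam'(1)] by (simp add: th_def)
  let ?a = "apothem lam"
  have c: "1 / (2 - lam) \<ge> 1/2" "1 / (2 - lam) \<le> 1/2 + lam / 2"
    using lam mult_mono[of lam 1 lam 1] by (auto simp: field_simps)
  have a: "0 < ?a" "?a \<le> 1/2" using apothem_pos lam c by (auto simp: apothem_def)
  define N where "N = Nmax lam"
  have pi: "3 < pi" using pi_gt3 .
  have "pi / (8 * th) - 1/4 \<ge> pi / (8 * (1/100)) - 1/4"
    using thl lam th pi by (intro diff_right_mono divide_left_mono) auto
  then have big: "pi / (8 * th) - 1/4 \<ge> 37" using pi by simp
  have N: "real N \<le> pi / (8 * th) - 1/4" "pi / (8 * th) - 1/4 < real N + 1" "N \<ge> 37"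
    using big unfolding N_def Nmax_def th_def[symmetric] by (auto simp: le_nat_iff le_floor_iff)
  have e: "8 * th * (pi / (8 * th) - 1/4) = pi - 2 * th" using th(5) by (simp add: field_simps)
  have "8 * th * real N \<le> 8 * th * (pi / (8 * th) - 1/4)" using N(1) th(5) by (intro mult_left_mono) auto
  then have up: "4 * real N * th + th \<le> pi / 2" unfolding e by (simp add: mult_ac)
  have "8 * th * (pi / (8 * th) - 1/4) < 8 * th * (real N + 1)" using N(2) th(5) by (intro mult_strict_left_mono) auto
  then have lo: "4 * real N * th + 5 * th > pi / 2" unfolding e by (simp add: algebra_simps)
  \<comment> \<open>\<open>N - 1\<close> would be too large: the two lines that meet in \<open>Qpt 1 (N - 1)\<close> may coincide\<close>
  define n1 where "n1 = N - 2"
  have n1: "real n1 = real N - 2" using N(3) by (simp add: n1_def)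
  define d where "d = exit_angle lam n1"
  have d: "d = pi / 2 - 4 * real N * th + 7 * th"
    by (simp add: d_def exit_angle_def th_def n1 algebra_simps)
  then have dd: "8 * th \<le> d" "d < 12 * th" using up lo by auto
  define x where "x = fst z - 1 / (2 - lam)"
  have x: "x > 9 * th" using z c thl lam by (auto simp: x_def)
  have "tang lam d z > ?a"
  proof -
    define b where "b = pi / 2 - th"
    have small: "12 * th < 1" using thl lam by simp
    have pos: "sin (b - 4 * th) > 0" "sin (b - d) > 0" "sin ((d - 4 * th) / 2) > 0"
      using small dd th pi by (auto simp: b_def intro!: sin_gt_zero)
    have xb: "tang lam b z = x" using tang_right[OF lam(1) lam'(1)] by (simp add: b_def th_def x_def)
    have id: "tang lam d z * sin (b - 4 * th) = tang lam (4 * th) z * sin (b - d) + x * sin (d - 4 * th)"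
      using tang_three[of lam d z b "4 * th"] xb by simp
    define y where "y = (d - 4 * th) / 2"
    have y: "0 < y" "y \<le> 4 * th" using dd th by (auto simp: y_def)
    have halves: "((b - 4 * th) - (b - d)) / 2 = y" "((b - 4 * th) + (b - d)) / 2 = b - (d + 4 * th) / 2"
      by (simp_all add: y_def field_simps)
    have "sin (b - 4 * th) - sin (b - d) = 2 * sin y * cos (b - (d + 4 * th) / 2)"
      unfolding sin_diff_sin halves ..
    also have "cos (b - (d + 4 * th) / 2) = sin ((d + 4 * th) / 2 + th)"
      using cos_sin_eq[of "b - (d + 4 * th) / 2"] by (simp add: b_def add.commute)
    finally have D: "sin (b - 4 * th) - sin (b - d) = 2 * sin y * sin ((d + 4 * th) / 2 + th)" .
    have "sin ((d + 4 * th) / 2 + th) \<le> (d + 4 * th) / 2 + th" using dd th by (intro sin_x_le_x) auto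
    moreover have "(d + 4 * th) / 2 + th < x"
    proof -
      have "(d + 4 * th) / 2 \<le> 8 * th" using dd by (simp add: field_simps)
      then show ?thesis using x by linarith
    qed
    ultimately have s9: "sin ((d + 4 * th) / 2 + th) < x" by (rule le_less_trans)
    have "?a * (2 * sin y * sin ((d + 4 * th) / 2 + th)) < ?a * (2 * sin y * x)"
      using s9 a pos(3) by (simp add: y_def)
    also have "\<dots> \<le> 1/2 * (2 * sin y * x)"
      using a pos(3) x th by (intro mult_right_mono) (auto simp: y_def)
    also have "\<dots> = sin y * x * 1" by simp
    also have "\<dots> \<le> sin y * x * (2 * cos y)"
    proof -
      have "cos y \<ge> cos (pi / 3)"
        using y small pi th by (intro cos_monotone_0_pi_le) auto
      then show ?thesis using pos(3) x th by (intro mult_left_mono) (auto simp: cos_60 y_def)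
    qed
    also have "\<dots> = x * sin (d - 4 * th)"
    proof -
      have "d - 4 * th = 2 * y" by (simp add: y_def)
      then have "sin (d - 4 * th) = 2 * sin y * cos y" by (simp only: sin_double)
      then show ?thesis by simp
    qed
    finally have "?a * (sin (b - 4 * th) - sin (b - d)) < x * sin (d - 4 * th)" unfolding D .
    moreover have "?a * sin (b - d) < tang lam (4 * th) z * sin (b - d)"
      using z(2) pos(2) by (simp add: th_def)
    ultimately have "?a * sin (b - 4 * th) < tang lam d z * sin (b - 4 * th)"
      unfolding id by (simp add: right_diff_distrib)
    then show ?thesis using pos(1) by simp
  qed
  then have ex: "tang lam (exit_angle lam n1) z > ?a" by (simp add: d_def)
  define n where "n = (LEAST n. tang lam (exit_angle lam n) z > ?a)"
  have n: "tang lam (exit_angle lam n) z > ?a" "n \<le> n1"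
    unfolding n_def using ex by (auto intro: LeastI Least_le)
  have "exit_angle lam 0 = pi / 2 - theta lam" by (simp add: exit_angle_def)
  then have "\<not> tang lam (exit_angle lam 0) z > ?a"
    using tang_right[OF lam(1) lam'(1)] z(3) by (simp add: apothem_def)
  then have "n \<noteq> 0" using n(1) by metis
  then have n0: "1 \<le> n" by simp
  have "\<not> tang lam (exit_angle lam (n - 1)) z > ?a"
    using not_less_Least[of "n - 1" "\<lambda>n. tang lam (exit_angle lam n) z > ?a"] n0 by (auto simp: n_def)
  then have m: "tang lam (exit_angle lam (n - 1)) z < ?a" using off[of "n - 1"] by simp
  have "real n \<le> real N - 2" using n(2) n1 by simp
  then have "4 * th * real n \<le> 4 * th * (real N - 2)" using th by (intro mult_left_mono) auto
  then have "(4 * real n + 5) * theta lam < pi / 2"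
    unfolding th_def[symmetric] using up th(5) by (simp add: algebra_simps)
  then have "z \<in> Lambda_in lam n"
    using in_Lambda_in[OF lam(1) lam'(2) n0 _ _ z(2) m n(1)] z(1) by (simp add: tang_0 apothem_def)
  moreover have "n \<le> Nmax lam - 1" using n(2) N(3) by (simp add: n1_def N_def)
  ultimately show ?thesis using n0 by auto
qed

section \<open>The outer polygons away from the corner\<close>

text \<open>
  Positive to the left of the directed line from \<open>A\<close> to \<open>B\<close>.
\<close>

definition side :: "point \<Rightarrow> point \<Rightarrow> point \<Rightarrow> real" where
  "side A B z = (fst B - fst A) * (snd z - snd A) - (snd B - snd A) * (fst z - fst A)"

lemma side_ends [simp]: "side A B A = 0" "side A B B = 0"
  by (simp_all add: side_def algebra_simps)

lemma affine_form_side: "affine_form (side A B)" "affine_form (\<lambda>z. - side A B z)"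
proof -
  have "side A B = (\<lambda>z. (- (snd B - snd A)) * fst z + (fst B - fst A) * snd z
      + ((snd B - snd A) * fst A - (fst B - fst A) * snd A))"
    by (auto simp: side_def fun_eq_iff algebra_simps)
  then show "affine_form (side A B)" unfolding affine_form_def by blast
  have "(\<lambda>z. - side A B z) = (\<lambda>z. (snd B - snd A) * fst z + (- (fst B - fst A)) * snd z
      + (- ((snd B - snd A) * fst A - (fst B - fst A) * snd A)))"
    by (auto simp: side_def fun_eq_iff algebra_simps)
  then show "affine_form (\<lambda>z. - side A B z)" unfolding affine_form_def by blast
qed

text \<open>
  The affine form that vanishes on \<open>ell 1\<close> and is positive on the side of the corner \<open>(1, 1)\<close>.
\<close>

definition above_ell1 :: "real \<Rightarrow> point \<Rightarrow> real" where
  "above_ell1 lam z = (1 - 3 * lam^2 + lam^4) * (snd z - 1) + (2 * lam - lam^3) * (fst z - 1/2 - lam) + lam^3 / 2"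

lemma affine_form_above_ell1: "affine_form (above_ell1 lam)"
proof -
  have "above_ell1 lam = (\<lambda>z. (2 * lam - lam^3) * fst z + (1 - 3 * lam^2 + lam^4) * snd z
      + (lam^3 / 2 - (2 * lam - lam^3) * (1/2 + lam) - (1 - 3 * lam^2 + lam^4)))"
    by (auto simp: above_ell1_def fun_eq_iff algebra_simps)
  then show ?thesis unfolding affine_form_def by blast
qed

lemma snd_Rinv_pow_4_eq:
  "snd ((Rinv lam ^^ 4) z) = 1 + above_ell1 lam z"
proof -
  obtain u v where z: "z = (u, v)" by (cases z)
  have "(Rinv lam ^^ 4) z = Rinv lam (Rinv lam (Rinv lam (Rinv lam z)))"
    by (simp add: eval_nat_numeral)
  then show ?thesis
    by (simp add: z above_ell1_def Rinv_def eval_nat_numeral algebra_simps)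
qed

text \<open>
  The parameter in which \<open>P0 m\<close> and \<open>P1 (m + 1)\<close> are affine; it decreases from \<open>1\<close> towards \<open>0\<close> as
  \<open>m\<close> grows from \<open>0\<close> to \<open>M\<close>.
\<close>

definition cot_ratio :: "real \<Rightarrow> nat \<Rightarrow> real" where
  "cot_ratio lam m = tan (theta lam) / tan ((2 * real m + 1) * theta lam)"

lemma P0_eq: "P0 lam m = (1/2 + lam + cot_ratio lam m / 2, 1)"
  by (simp add: P0_def cot_ratio_def algebra_simps)

text \<open>
  The points of \<open>ell 1\<close> in the parametrization that the points \<open>P1 m\<close> for \<open>m \<ge> 2\<close> use.
\<close>

definition ell1_point :: "real \<Rightarrow> real \<Rightarrow> point" where
  "ell1_point lam t =
     (1/2 * (1 + 2 * lam - lam^2 + lam^4 + (1 - 3 * lam^2 + lam^4) * t),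
      1 + lam^3 / 2 + lam / 2 * (lam^2 - 2) * t)"

lemma P1_eq: "2 \<le> m \<Longrightarrow> P1 lam m = ell1_point lam (cot_ratio lam (m - 1))"
  by (simp add: P1_def ell1_point_def cot_ratio_def of_nat_diff algebra_simps)

lemma above_ell1_P0: "above_ell1 lam (P0 lam m) = lam^3 / 2 + (2 * lam - lam^3) * (cot_ratio lam m / 2)"
  by (simp add: above_ell1_def P0_eq)

lemma above_ell1_point [simp]: "above_ell1 lam (ell1_point lam t) = 0"
  by (simp add: above_ell1_def ell1_point_def field_simps eval_nat_numeral)

text \<open>
  Along \<open>ell 1\<close>, and with \<open>B\<close> on this line, \<open>side A B\<close> is proportional to the distance from \<open>B\<close>. The
  factor is the value of \<open>above_ell1\<close> at \<open>A\<close> because \<open>ell 1\<close> is orthogonal to the gradient of that form.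
\<close>

lemma side_on_ell1:
  assumes "above_ell1 lam B = 0" "above_ell1 lam z = 0"
  shows "(1 - 3 * lam^2 + lam^4) * side A B z = (fst z - fst B) * above_ell1 lam A"
proof -
  define g h where "g = 1 - 3 * lam^2 + lam^4" and "h = 2 * lam - lam^3"
  define k where "k = lam^3 / 2"
  have e: "above_ell1 lam w = g * (snd w - 1) + h * (fst w - 1/2 - lam) + k" for w
    by (simp add: above_ell1_def g_def h_def k_def)
  have 1: "g * (snd z - snd B) = - h * (fst z - fst B)" using assms by (simp add: e algebra_simps)
  have 2: "above_ell1 lam A = - (g * (snd B - snd A) + h * (fst B - fst A))"
    using assms(1) by (simp add: e algebra_simps)
  have "g * side A B z = (fst B - fst A) * (g * (snd z - snd B)) - g * (snd B - snd A) * (fst z - fst B)"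
    unfolding side_def by (simp add: algebra_simps)
  also have "\<dots> = (fst z - fst B) * above_ell1 lam A"
    unfolding 1 2 by (simp add: algebra_simps)
  finally show ?thesis by (simp add: g_def)
qed

lemma gradient_bounds:
  fixes lam :: real
  assumes "0 < lam" "lam \<le> 1 / 100"
  shows "1 - 3 * lam^2 + lam^4 \<ge> 99 / 100" "0 < 2 * lam - lam^3" "lam \<le> 2 * lam - lam^3" "2 * lam - lam^3 \<le> 2 * lam"
    "lam^3 \<le> lam^2" "0 < lam^3"
proof -
  have l2: "lam^2 \<le> (1 / 100)^2" using assms by (intro power_mono) auto
  then have l2': "lam^2 \<le> 1 / 10000" by (simp add: power2_eq_square)
  have "lam^4 \<ge> 0" by simp
  then show "1 - 3 * lam^2 + lam^4 \<ge> 99 / 100" using l2' by linarith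
  have l3: "lam^3 = lam * lam^2" by (simp add: eval_nat_numeral)
  have "lam * lam^2 \<le> lam * (1 / 10000)" using assms l2' by (intro mult_left_mono) auto
  then show "0 < 2 * lam - lam^3" "lam \<le> 2 * lam - lam^3" unfolding l3 using assms by linarith+
  show "0 < lam^3" using assms by simp
  then show "2 * lam - lam^3 \<le> 2 * lam" by simp
  have "lam * lam^2 \<le> 1 * lam^2" using assms by (intro mult_right_mono) auto
  then show "lam^3 \<le> lam^2" unfolding l3 by simp
qed

lemma Mmax_bounds:
  assumes lam: "0 < lam" "lam \<le> 1 / 100"
  shows "(2 * real (Mmax lam) + 1) * theta lam \<le> pi / 2" "pi / 2 < (2 * real (Mmax lam) + 3) * theta lam"
    "Mmax lam \<ge> 50"
proof -
  define th where "th = theta lam"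
  have l1: "lam \<le> 1" using lam by simp
  note th = theta_facts[OF lam(1) l1, folded th_def]
  have thl: "th \<le> lam" using theta_le[OF lam(1) l1] by (simp add: th_def)
  have "pi / (4 * th) - 1/2 \<ge> pi / (4 * (1/100)) - 1/2"
    using thl lam th(5) by (intro diff_right_mono divide_left_mono) auto
  then have big: "pi / (4 * th) - 1/2 \<ge> 50" using pi_gt3 by simp
  define M where "M = Mmax lam"
  have M: "real M \<le> pi / (4 * th) - 1/2" "pi / (4 * th) - 1/2 < real M + 1" "M \<ge> 50"
    using big unfolding M_def Mmax_def th_def[symmetric] by (auto simp: le_nat_iff le_floor_iff)
  have e: "2 * th * (pi / (4 * th) - 1/2) = pi / 2 - th" using th(5) by (simp add: field_simps)
  have "2 * th * real M \<le> pi / 2 - th" unfolding e[symmetric] using M(1) th(5) by (intro mult_left_mono) auto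
  then show "(2 * real (Mmax lam) + 1) * theta lam \<le> pi / 2"
    by (simp add: M_def[symmetric] th_def[symmetric] algebra_simps)
  have "pi / 2 - th < 2 * th * (real M + 1)" unfolding e[symmetric] using M(2) th(5) by (intro mult_strict_left_mono) auto
  then show "pi / 2 < (2 * real (Mmax lam) + 3) * theta lam"
    by (simp add: M_def[symmetric] th_def[symmetric] algebra_simps)
  show "Mmax lam \<ge> 50" using M(3) by (simp add: M_def)
qed

text \<open>
  The lower bound \<open>\<lambda>\<^sup>2\<close> is what keeps \<open>P1 (k + 1)\<close> strictly below \<open>y = 1\<close>. It fails at the last index
  when \<open>(2 M + 1) \<theta>\<close> is close to \<open>pi / 2\<close>, and this is why the cuts stop at \<open>M - 1\<close>.
\<close>

lemma cot_ratio_facts: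
  assumes lam: "0 < lam" "lam \<le> 1 / 100" and k: "Suc k \<le> Mmax lam - 1"
  shows "cot_ratio lam (Suc k) > 0" "cot_ratio lam (Suc k) < cot_ratio lam k" "lam^2 \<le> cot_ratio lam k"
proof -
  define th where "th = theta lam"
  have l1: "lam \<le> 1" using lam by simp
  note th = theta_facts[OF lam(1) l1, folded th_def]
  have thl: "th \<le> lam" using theta_le[OF lam(1) l1] by (simp add: th_def)
  define x y where "x = (2 * real k + 1) * th" and "y = (2 * real (Suc k) + 1) * th"
  have "real (Suc k) \<le> real (Mmax lam) - 1" using k Mmax_bounds(3)[OF lam] by linarith
  then have "(2 * real (Suc k) + 3) * th \<le> (2 * real (Mmax lam) + 1) * th"
    using th(5) by (intro mult_right_mono) auto
  then have "y + 2 * th \<le> pi / 2"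
    using Mmax_bounds(1)[OF lam] by (simp add: y_def th_def[symmetric] algebra_simps)
  moreover have xy: "y = x + 2 * th" "0 < x"
    using mult_pos_pos[of "2 * real k + 1" th] th(5) by (auto simp: x_def y_def algebra_simps)
  ultimately have b: "x \<le> pi / 2 - 4 * th" "y < pi / 2" using th(5) by auto
  have pos: "0 < tan x" "0 < tan y" "0 < tan th" using b xy th by (auto intro!: tan_gt_zero)
  have lt: "tan x < tan y" using tan_monotone[of x y] b xy th(5) by simp
  have e: "cot_ratio lam (Suc k) = tan th / tan y" "cot_ratio lam k = tan th / tan x"
    by (simp_all add: cot_ratio_def x_def y_def th_def)
  show "cot_ratio lam (Suc k) > 0" unfolding e using pos by simp
  show "cot_ratio lam (Suc k) < cot_ratio lam k"
    unfolding e using pos lt by (intro divide_strict_left_mono) auto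
  have th4: "0 < 4 * th" "4 * th < pi / 2" using thl lam th(5) pi_gt3 by auto
  have "tan x \<le> tan (pi / 2 - 4 * th)"
    using b xy th4 by (intro tan_mono_le) auto
  also have "\<dots> = 1 / tan (4 * th)" using tan_cot[of "4 * th"] by (simp add: inverse_eq_divide)
  finally have "tan x \<le> 1 / tan (4 * th)" .
  have "lam^2 = 4 * (lam / 2) * (lam / 2)" by (simp add: power2_eq_square)
  also have "\<dots> \<le> (4 * th) * th" using th(2) lam by (intro mult_mono) auto
  also have "\<dots> \<le> tan (4 * th) * tan th"
    using le_tan[OF th4] le_tan[OF th(5,3)] th(5) by (intro mult_mono) auto
  also have "\<dots> \<le> (1 / tan x) * tan th"
  proof -
    have "tan (4 * th) \<le> 1 / tan x"
      using \<open>tan x \<le> 1 / tan (4 * th)\<close> pos tan_gt_zero[OF th4] by (simp add: field_simps)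
    then show ?thesis using pos by (intro mult_right_mono) auto
  qed
  finally show "lam^2 \<le> cot_ratio lam k" unfolding e by simp
qed

lemma cot_ratio_le:
  assumes lam: "0 < lam" "lam \<le> 1 / 100" and k: "k \<le> Mmax lam - 1" "pi / 4 \<le> (2 * real k + 1) * theta lam"
  shows "cot_ratio lam k \<le> lam"
proof -
  define th where "th = theta lam"
  have l1: "lam \<le> 1" using lam by simp
  note th = theta_facts[OF lam(1) l1, folded th_def]
  define x where "x = (2 * real k + 1) * th"
  have "real k < real (Mmax lam)" using k Mmax_bounds(3)[OF lam] by linarith
  then have "x < (2 * real (Mmax lam) + 1) * th" unfolding x_def using th(5) by (intro mult_strict_right_mono) auto
  then have x: "x < pi / 2" using Mmax_bounds(1)[OF lam] by (simp add: th_def)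
  have "tan (pi / 4) \<le> tan x" using k x by (intro tan_mono_le) (auto simp: x_def th_def)
  then have "1 \<le> tan x" by (simp add: tan_45)
  then have "tan th / tan x \<le> tan th / 1"
    using tan_gt_zero[OF th(5,3)] by (intro divide_left_mono) auto
  then show ?thesis using tan_theta_le[OF lam(1) l1] by (simp add: cot_ratio_def x_def th_def)
qed

lemma cot_ratio_1:
  assumes lam: "0 < lam" "lam \<le> 1 / 100"
  shows "cot_ratio lam 1 = (1 - lam^2) / (3 - lam^2)"
proof -
  define th where "th = theta lam"
  have l1: "lam \<le> 1" using lam by simp
  note th = theta_facts[OF lam(1) l1, folded th_def]
  have s: "sin th = lam / 2" by (rule th(1))
  have c: "cos th > 0" using cos_theta_pos[OF lam(1) l1] by (simp add: th_def)
  have c2: "cos (2 * th) = 1 - lam^2 / 2" by (rule th(4))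
  have s2: "sin (2 * th) = lam * cos th" by (simp add: sin_double s)
  have e: "3 * th = 2 * th + th" by simp
  have "sin (3 * th) = lam * cos th * cos th + (1 - lam^2 / 2) * (lam / 2)"
    unfolding e sin_add s2 c2 s ..
  also have "cos th * cos th = 1 - lam^2 / 4"
    using sin_cos_squared_add[of th] by (simp add: s power2_eq_square)
  then have "lam * cos th * cos th = lam * (1 - lam^2 / 4)" by simp
  finally have s3: "sin (3 * th) = lam / 2 * (3 - lam^2)" by (simp add: algebra_simps power2_eq_square)
  have "cos (3 * th) = (1 - lam^2 / 2) * cos th - lam * cos th * (lam / 2)"
    unfolding e cos_add s2 c2 s ..
  then have c3: "cos (3 * th) = cos th * (1 - lam^2)" by (simp add: algebra_simps power2_eq_square)
  have "lam^2 < 1" using lam power_strict_mono[of lam 1 2] by simp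
  then have "lam / 2 / cos th / (lam / 2 * p / (cos th * q)) = q / p" if "p = 3 - lam^2" "q = 1 - lam^2" for p q
    using c lam that by (simp add: field_simps)
  then have "tan th / tan (3 * th) = (1 - lam^2) / (3 - lam^2)"
    unfolding tan_def s3 c3 s by blast
  then show ?thesis by (simp add: cot_ratio_def th_def)
qed

text \<open>
  The cut from \<open>P0 m\<close> to \<open>P1 m\<close> crosses the strip from its upper boundary to its lower boundary, and
  the cuts move to the left as \<open>m\<close> grows.
\<close>

lemma cut_facts:
  assumes lam: "0 < lam" "lam \<le> 1 / 100" and m: "2 \<le> m" "m \<le> Mmax lam - 1"
  shows "snd (P1 lam m) < 1" "fst (P0 lam m) < fst (P0 lam (m - 1))"
    "above_ell1 lam (P0 lam m) > 0" "above_ell1 lam (P1 lam m) = 0" "snd (P0 lam m) = 1"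
proof -
  obtain j where j: "m = Suc (Suc j)" using m(1) by (metis add_2_eq_Suc le_Suc_ex)
  note c1 = cot_ratio_facts[OF lam, of j] and c2 = cot_ratio_facts[OF lam, of "Suc j"]
  have jm: "Suc j \<le> Mmax lam - 1" "Suc (Suc j) \<le> Mmax lam - 1" using m j by auto
  note g = gradient_bounds[OF lam]
  have p: "P1 lam m = ell1_point lam (cot_ratio lam (Suc j))" using P1_eq[OF m(1)] j by simp
  have "(2 * lam - lam^3) * lam^2 \<le> (2 * lam - lam^3) * cot_ratio lam (Suc j)"
    using c2(3)[OF jm(2)] g by (intro mult_left_mono) auto
  moreover have "lam^3 < (2 * lam - lam^3) * lam^2"
  proof -
    have "lam^2 * lam < lam^2 * (2 * lam - lam^3)"
    proof (rule mult_strict_left_mono)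
      have "lam^3 < lam" using g(5) lam mult_strict_right_mono[of lam 1 lam] unfolding power2_eq_square by linarith
      then show "lam < 2 * lam - lam^3" by simp
    qed (use lam in simp)
    then show ?thesis by (simp add: eval_nat_numeral mult_ac)
  qed
  ultimately have "lam^3 < (2 * lam - lam^3) * cot_ratio lam (Suc j)" by linarith
  moreover have "1 - snd (P1 lam m) = ((2 * lam - lam^3) * cot_ratio lam (Suc j) - lam^3) / 2"
    unfolding p ell1_point_def by (simp add: field_simps eval_nat_numeral)
  ultimately show "snd (P1 lam m) < 1" by simp
  show "fst (P0 lam m) < fst (P0 lam (m - 1))" using c2(2)[OF jm(2)] by (simp add: P0_eq j)
  have "(2 * lam - lam^3) * (cot_ratio lam m / 2) > 0"
    using c2(1)[OF jm(2)] g(2) by (intro mult_pos_pos) (auto simp: j)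
  then show "above_ell1 lam (P0 lam m) > 0" unfolding above_ell1_P0 using g(6) by linarith
  show "above_ell1 lam (P1 lam m) = 0" by (simp add: p)
  show "snd (P0 lam m) = 1" by (simp add: P0_eq)
qed

lemma side_from_top:
  assumes "snd A = 1" "snd z = 1"
  shows "side A B z = (1 - snd B) * (fst z - fst A)"
  using assms by (simp add: side_def algebra_simps)

text \<open>
  The quadrilateral lies between \<open>y = 1\<close>, \<open>ell 1\<close> and two consecutive cuts. Strict convexity follows
  from the order of the cuts on the two long sides of the strip: on \<open>y = 1\<close> by \<open>side_from_top\<close>, and on
  \<open>ell 1\<close> by \<open>side_on_ell1\<close>.
\<close>

lemma in_Lambda_out_ge_3:
  assumes lam: "0 < lam" "lam \<le> 1 / 100" and m: "3 \<le> m" "m \<le> Mmax lam - 1"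
    and z: "snd z < 1" "above_ell1 lam z > 0" "side (P0 lam m) (P1 lam m) z > 0"
      "side (P0 lam (m - 1)) (P1 lam (m - 1)) z < 0"
  shows "z \<in> Lambda_out lam m"
proof -
  obtain k where k: "m = Suc k" "2 \<le> k" using m(1) by (cases m) auto
  define A B C D where pts: "A = P0 lam m" "B = P0 lam k" "C = P1 lam k" "D = P1 lam m"
  note f = cut_facts[OF lam _ m(2)] and f' = cut_facts[OF lam k(2)]
  have km: "2 \<le> m" "k \<le> Mmax lam - 1" using k m by auto
  have DC: "fst D < fst C"
  proof -
    obtain j where j: "k = Suc j" using k by (cases k) auto
    have "cot_ratio lam k < cot_ratio lam j" using cot_ratio_facts(2)[OF lam, of j] km(2) j by simp
    then show ?thesis
      using gradient_bounds(1)[OF lam] P1_eq[of m] P1_eq[of k] k j by (simp add: pts ell1_point_def)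
  qed
  have a: "above_ell1 lam A > 0" "above_ell1 lam B > 0" "above_ell1 lam C = 0" "above_ell1 lam D = 0"
    and s: "snd A = 1" "snd B = 1" "snd C < 1" "snd D < 1" and AB: "fst A < fst B"
    using f[OF km(1)] f'[OF km(2)] by (auto simp: pts k(1))
  have g: "1 - 3 * lam^2 + lam^4 > 0" using gradient_bounds(1)[OF lam] by simp
  have "(1 - 3 * lam^2 + lam^4) * side A D C > 0"
    unfolding side_on_ell1[OF a(4,3)] using DC a(1) by simp
  then have x1: "side A D C > 0" using g by (simp add: zero_less_mult_iff)
  have "(1 - 3 * lam^2 + lam^4) * side B C D < 0"
    unfolding side_on_ell1[OF a(3,4)] using DC a(2) by (simp add: mult_less_0_iff)
  then have x2: "side B C D < 0" using g by (simp add: mult_less_0_iff)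
  have x3: "side A D B > 0" "side B C A < 0"
    using s AB by (simp_all add: side_from_top mult_less_0_iff)
  define L where "L i = [\<lambda>z. 1 - snd z, \<lambda>z. - side B C z, above_ell1 lam, side A D] ! i" for i :: nat
  have L: "L 0 = (\<lambda>z. 1 - snd z)" "L (Suc 0) = (\<lambda>z. - side B C z)"
    "L 2 = above_ell1 lam" "L 3 = side A D" "L (Suc (Suc 0)) = above_ell1 lam"
    by (simp_all add: L_def)
  have top: "affine_form (\<lambda>z. 1 - snd z)"
    unfolding affine_form_def by (rule exI[of _ 0], rule exI[of _ "-1"], rule exI[of _ 1]) simp
  have "z \<in> polygon [A, B, C, D]"
  proof (rule half_plane_region_subset_polygon[where L = L])
    fix i assume "i < length [A, B, C, D]"
    then have i: "i = 0 \<or> i = 1 \<or> i = 2 \<or> i = 3" by auto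
    show "affine_form (L i)" using i by (auto simp: L top affine_form_side affine_form_above_ell1)
    show "L i ([A, B, C, D] ! i) = 0 \<and> L i ([A, B, C, D] ! (Suc i mod length [A, B, C, D])) = 0"
      using i by (auto simp: L a s)
    show "L (Suc i mod length [A, B, C, D]) ([A, B, C, D] ! i) > 0"
      using i a s x1 x3 by (auto simp: L)
    show "L i ([A, B, C, D] ! (Suc (Suc i mod length [A, B, C, D]) mod length [A, B, C, D])) > 0"
      using i a s x2 x3 by (auto simp: L)
    show "L i z > 0" using i z by (auto simp: L pts k)
  qed simp
  then show ?thesis using k by (auto simp: Lambda_out_def pts)
qed

text \<open>
  On a vertical line to the right of both end points, \<open>side A B\<close> is affine and is positive at the two
  points where this line meets \<open>y = 1\<close> and \<open>ell 1\<close>; these enclose \<open>z\<close>.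
\<close>

lemma right_of_cut:
  assumes lam: "0 < lam" "lam \<le> 1 / 100"
    and A: "snd A = 1" "above_ell1 lam A > 0" and B: "above_ell1 lam B = 0" "snd B < 1"
    and z: "fst z > fst A" "fst z > fst B" "above_ell1 lam z > 0" "snd z < 1"
  shows "side A B z > 0"
proof (cases "fst B \<le> fst A")
  case True
  then have "(fst B - fst A) * (snd z - 1) \<ge> 0" using z by (intro mult_nonpos_nonpos) auto
  moreover have "(1 - snd B) * (fst z - fst A) > 0" using B z by simp
  ultimately show ?thesis using A by (simp add: side_def algebra_simps)
next
  case False
  define g h k where "g = 1 - 3 * lam^2 + lam^4" and "h = 2 * lam - lam^3" and "k = lam^3 / 2"
  have g: "g > 0" using gradient_bounds(1)[OF lam] by (simp add: g_def)
  have e: "above_ell1 lam w = g * (snd w - 1) + h * (fst w - 1/2 - lam) + k" for w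
    by (simp add: above_ell1_def g_def h_def k_def)
  define y where "y = 1 - (h * (fst z - 1/2 - lam) + k) / g"
  have w: "above_ell1 lam (fst z, y) = 0" unfolding e using g by (simp add: y_def)
  have "g * (snd z - y) = above_ell1 lam z" unfolding e using g by (simp add: y_def field_simps)
  then have "g * (snd z - y) > 0" using z(3) by simp
  then have y: "snd z > y" using g by (simp add: zero_less_mult_iff)
  have "g * side A B (fst z, y) > 0"
    using side_on_ell1[OF B(1) w, of A] A z by (simp add: g_def)
  then have "side A B (fst z, y) > 0" using g by (simp add: zero_less_mult_iff)
  moreover have "side A B z = side A B (fst z, y) + (fst B - fst A) * (snd z - y)"
    by (simp add: side_def algebra_simps)
  moreover have "(fst B - fst A) * (snd z - y) > 0" using False y by simp
  ultimately show ?thesis by linarith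
qed

section \<open>The outer polygons at the corner\<close>

text \<open>
  The point \<open>P0 1\<close> as a rational function of \<open>\<lambda>\<close>, since \<open>tan (3 \<theta>)\<close> is a rational function of
  \<open>tan \<theta>\<close>; \<open>corner_P1\<close> is the point \<open>P1 2\<close> in the same form.
\<close>

definition corner_P0 :: "real \<Rightarrow> point" where
  "corner_P0 lam = (1/2 + lam + (1 - lam^2) / (3 - lam^2) / 2, 1)"

definition corner_P1 :: "real \<Rightarrow> point" where
  "corner_P1 lam = ell1_point lam ((1 - lam^2) / (3 - lam^2))"

text \<open>
  The inequalities between the explicit vertices that make the two polygons at the corner strictly
  convex, together with the sizes of the slivers that the edges \<open>P1 0\<close> to \<open>P'\<close> and \<open>P1 1\<close> to \<open>P'''\<close>
  cut off.
\<close>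

definition corner_shape :: "real \<Rightarrow> bool" where
  "corner_shape lam \<longleftrightarrow>
     Dpoly lam > 0 \<and> snd (P'' lam) < 1 \<and> snd (P1 lam 1) < snd (P'' lam) \<and>
     fst (P''' lam) < 1 \<and> fst (P''' lam) \<ge> 1 - 4 * lam^3 \<and> above_ell1 lam (P1 lam 1) > 0 \<and>
     fst (corner_P1 lam) < fst (P''' lam) \<and> side (P1 lam 1) (P''' lam) (corner_P1 lam) < 0 \<and>
     snd (P''' lam) \<le> snd (P1 lam 1) - 4 / 10 * lam^2 \<and>
     fst (P' lam) < 1 \<and> fst (P' lam) \<ge> 1 - 3 * lam^2 \<and>
     snd (P1 lam 0) < 1 \<and> snd (P'' lam) < snd (P1 lam 0) \<and> snd (P' lam) < 1 \<and>
     side (P1 lam 0) (P' lam) (corner_P0 lam) < 0 \<and>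
     snd (P' lam) \<le> snd (P1 lam 0) - 4 / 10 * lam \<and> fst (corner_P0 lam) < 1"

lemma eventually_corner_shape: "eventually corner_shape (at_right 0)"
  unfolding corner_shape_def
  apply (intro eventually_conj)
  subgoal unfolding Dpoly_def by real_asymp
  subgoal unfolding P''_def Dpoly_def by simp real_asymp
  subgoal unfolding P''_def P1_def Dpoly_def by simp real_asymp
  subgoal unfolding P'''_def Dpoly_def by simp real_asymp
  subgoal unfolding P'''_def Dpoly_def by simp real_asymp
  subgoal unfolding above_ell1_def P1_def by simp real_asymp
  subgoal unfolding corner_P1_def ell1_point_def P'''_def Dpoly_def by simp real_asymp
  subgoal unfolding side_def corner_P1_def ell1_point_def P'''_def P1_def Dpoly_def by simp real_asymp
  subgoal unfolding P'''_def P1_def Dpoly_def by simp real_asymp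
  subgoal unfolding P'_def by simp real_asymp
  subgoal unfolding P'_def by simp real_asymp
  subgoal unfolding P1_def by simp real_asymp
  subgoal unfolding P''_def P1_def Dpoly_def by simp real_asymp
  subgoal unfolding P'_def by simp real_asymp
  subgoal unfolding side_def corner_P0_def P'_def P1_def by simp real_asymp
  subgoal unfolding P'_def P1_def by simp real_asymp
  subgoal unfolding corner_P0_def by simp real_asymp
  done

lemma above_ell1_P''': "Dpoly lam \<noteq> 0 \<Longrightarrow> above_ell1 lam (P''' lam) = 0"
  unfolding above_ell1_def P'''_def
  by (simp add: field_simps) (simp add: Dpoly_def eval_nat_numeral algebra_simps)

text \<open>
  The polygons for \<open>m = 1\<close> and \<open>m = 2\<close> thus share the line through \<open>P0 1\<close> and \<open>P''\<close>, and there is no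
  gap between them.
\<close>

lemma P'_on_cut:
  assumes "Dpoly lam \<noteq> 0" "lam^2 \<noteq> 3"
  shows "side (corner_P0 lam) (P'' lam) (P' lam) = 0"
proof -
  have "side (corner_P0 lam) (P'' lam) (P' lam) * (2 * (3 - lam^2) * Dpoly lam) = 0"
    unfolding side_def corner_P0_def P''_def P'_def using assms
    by (simp add: field_simps) (simp add: Dpoly_def eval_nat_numeral algebra_simps)
  then show ?thesis using assms by simp
qed

lemma affine_form_right_top: "affine_form (\<lambda>z. 1 - snd z)" "affine_form (\<lambda>z. 1 - fst z)"
  unfolding affine_form_def
  by (rule exI[of _ 0], rule exI[of _ "-1"], rule exI[of _ 1], simp)
    (rule exI[of _ "-1"], rule exI[of _ 0], rule exI[of _ 1], simp)

lemma corner_points: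
  assumes "0 < lam" "lam \<le> 1 / 100"
  shows "P0 lam 1 = corner_P0 lam" "P1 lam 2 = corner_P1 lam"
  using cot_ratio_1[OF assms] P1_eq[of 2 lam] by (simp_all add: P0_eq corner_P0_def corner_P1_def)

lemma fst_corner: "fst (P1 lam 0) = 1" "fst (P1 lam 1) = 1" "fst (P'' lam) = 1"
  by (simp_all add: P1_def P''_def)

text \<open>
  The strip descends with slope at most about \<open>2 \<lambda>\<close> over a horizontal distance of about \<open>1/2\<close>.
\<close>

lemma below_top_bound:
  assumes lam: "0 < lam" "lam \<le> 1 / 100" and z: "above_ell1 lam z \<ge> 0" "fst z < 1"
  shows "snd z \<ge> 1 - 2 * lam"
proof -
  note g = gradient_bounds[OF lam]
  define G where "G = 1 - 3 * lam^2 + lam^4"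
  have "(2 * lam - lam^3) * (fst z - 1/2 - lam) \<le> (2 * lam - lam^3) * (1/2)"
    using g z lam by (intro mult_left_mono) auto
  also have "\<dots> \<le> 2 * lam * (1/2)" using g by (intro mult_right_mono) auto
  finally have 1: "G * (1 - snd z) \<le> lam + lam^3 / 2"
    using z(1) by (simp add: above_ell1_def G_def algebra_simps)
  show ?thesis
  proof (rule ccontr)
    assume "\<not> ?thesis"
    then have "99 / 100 * (2 * lam) \<le> G * (1 - snd z)"
      using g(1) lam by (intro mult_mono) (auto simp: G_def)
    moreover have "lam^3 \<le> lam / 100"
      using g(5) mult_left_mono[OF lam(2), of lam] lam unfolding power2_eq_square by linarith
    ultimately show False using 1 lam by linarith
  qed
qed

text \<open>
  The edge from \<open>P1 0\<close> to \<open>P'\<close> is nearly vertical: it recedes by at most \<open>3 \<lambda>\<^sup>2\<close> horizontally while it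
  falls by at least \<open>4 \<lambda> / 10\<close>. The strip reaches at most \<open>2 \<lambda>\<close> below \<open>P1 0\<close>, so that points with
  \<open>x < 1 - 30 \<lambda>\<^sup>2\<close> are to the left of this edge.
\<close>

lemma in_Lambda_out_1:
  assumes lam: "0 < lam" "lam \<le> 1 / 100" and c: "corner_shape lam"
    and z: "snd z < 1" "above_ell1 lam z > 0" "fst z < 1 - 30 * lam^2"
      "side (P0 lam 1) (P'' lam) z > 0"
  shows "z \<in> Lambda_out lam 1"
proof -
  note s = c[unfolded corner_shape_def]
  define A B C D where pts: "A = P0 lam 1" "B = ((1, 1) :: point)" "C = P1 lam 0" "D = P' lam"
  define E where "E = P'' lam"
  have l3: "lam^2 \<noteq> 3" using lam power_strict_mono[of lam 1 2] by auto
  have A0: "A = corner_P0 lam" using corner_points[OF lam] by (simp add: pts)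
  have co: "snd A = 1" "fst A < 1" "fst C = 1" "snd C < 1" "fst D < 1" "snd D < 1" "fst E = 1" "snd E < snd C" "snd E < 1"
    using s fst_corner[of lam] unfolding E_def A0 pts(3,4) by (simp_all add: corner_P0_def)
  have AD: "side A E D = 0" using P'_on_cut[of lam] s l3 by (simp add: A0 E_def pts)
  have x1: "side C D A < 0" using s by (simp add: A0 pts)
  have x2: "side C D B < 0" using co by (simp add: side_def pts(2) mult_less_0_iff mult_pos_pos)
  have x3: "side A E C > 0" "side A E B > 0"
    using co mult_pos_pos[of "1 - fst A" "snd C - snd E"] mult_pos_pos[of "1 - fst A" "1 - snd E"]
    by (simp_all add: side_def pts(2) algebra_simps)
  have z1: "fst z < 1" using z(3) zero_le_power2[of lam] by linarith
  have x4: "side C D z < 0"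
  proof -
    have zy: "snd z \<ge> 1 - 2 * lam" using below_top_bound[OF lam] z(2) z1 by simp
    have a: "1 - fst D \<le> 3 * lam^2" "4 / 10 * lam \<le> snd C - snd D" "0 \<le> 1 - fst D" using s by (auto simp: pts)
    have "(1 - fst D) * (snd C - snd z) \<le> (1 - fst D) * (2 * lam)"
      using co zy by (intro mult_left_mono) auto
    also have "\<dots> \<le> (3 * lam^2) * (2 * lam)" using a lam by (intro mult_right_mono) auto
    also have "\<dots> < 4 / 10 * lam * (30 * lam^2)" using lam by (simp add: power2_eq_square)
    also have "\<dots> \<le> 4 / 10 * lam * (1 - fst z)" using z(3) lam by (intro mult_left_mono) auto
    also have "\<dots> \<le> (snd C - snd D) * (1 - fst z)"
      using a z1 by (intro mult_right_mono) auto
    finally show ?thesis using co(3) by (simp add: side_def algebra_simps)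
  qed
  define L where "L i = [\<lambda>z. 1 - snd z, \<lambda>z. 1 - fst z, \<lambda>z. - side C D z, side A E] ! i" for i :: nat
  have L: "L 0 = (\<lambda>z. 1 - snd z)" "L (Suc 0) = (\<lambda>z. 1 - fst z)"
    "L 2 = (\<lambda>z. - side C D z)" "L 3 = side A E" "L (Suc (Suc 0)) = (\<lambda>z. - side C D z)"
    by (simp_all add: L_def)
  have "z \<in> polygon [A, B, C, D]"
  proof (rule half_plane_region_subset_polygon[where L = L])
    fix i assume "i < length [A, B, C, D]"
    then have i: "i = 0 \<or> i = 1 \<or> i = 2 \<or> i = 3" by auto
    show "affine_form (L i)" using i by (auto simp: L affine_form_right_top affine_form_side)
    show "L i ([A, B, C, D] ! i) = 0 \<and> L i ([A, B, C, D] ! (Suc i mod length [A, B, C, D])) = 0"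
      using i co AD by (auto simp: L pts(2))
    show "L (Suc i mod length [A, B, C, D]) ([A, B, C, D] ! i) > 0"
      using i co x2 x3 by (auto simp: L)
    show "L i ([A, B, C, D] ! (Suc (Suc i mod length [A, B, C, D]) mod length [A, B, C, D])) > 0"
      using i co x1 x3 by (auto simp: L)
    show "L i z > 0" using i z z1 x4 by (auto simp: L pts E_def)
  qed simp
  then show ?thesis by (simp add: Lambda_out_def pts)
qed

text \<open>
  As in the previous lemma, with the nearly vertical edge from \<open>P1 1\<close> to \<open>P'''\<close>, which recedes by at most
  \<open>4 \<lambda>\<^sup>3\<close> while it falls by at least \<open>4 \<lambda>\<^sup>2 / 10\<close>.
\<close>

lemma in_Lambda_out_2:
  assumes lam: "0 < lam" "lam \<le> 1 / 100" and c: "corner_shape lam"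
    and z: "snd z < 1" "above_ell1 lam z > 0" "fst z < 1 - 30 * lam^2"
      "side (P0 lam 1) (P'' lam) z < 0" "side (P0 lam 2) (P1 lam 2) z > 0"
  shows "z \<in> Lambda_out lam 2"
proof -
  note s = c[unfolded corner_shape_def]
  note g = gradient_bounds[OF lam]
  define A B C D E H where pts: "A = P0 lam 2" "B = P0 lam 1" "C = P'' lam" "D = P1 lam 1" "E = P''' lam" "H = P1 lam 2"
  have "2 \<le> Mmax lam - 1" using Mmax_bounds(3)[OF lam] by simp
  note f = cut_facts[OF lam order_refl this]
  have B0: "B = corner_P0 lam" "H = corner_P1 lam" using corner_points[OF lam] by (auto simp: pts)
  have co: "snd A = 1" "fst A < fst B" "snd B = 1" "fst B < 1" "fst C = 1" "snd C < 1" "fst D = 1" "snd D < snd C"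
    "fst E < 1" "fst H < fst E" "snd H < 1" "above_ell1 lam A > 0" "above_ell1 lam D > 0"
    "above_ell1 lam E = 0" "above_ell1 lam H = 0"
    using s f above_ell1_P'''[of lam] fst_corner[of lam] corner_points[OF lam]
    unfolding pts by (simp_all add: corner_P0_def)
  have x1: "side B C A < 0" using co by (simp add: side_from_top mult_less_0_iff)
  have x2: "side D E C < 0" using co by (simp add: side_def mult_less_0_iff)
  have "(1 - 3 * lam^2 + lam^4) * side A H E > 0"
    unfolding side_on_ell1[OF co(15,14)] using co by simp
  then have x3: "side A H E > 0" using g(1) by (simp add: zero_less_mult_iff)
  have x4: "side B C D < 0" using co by (simp add: side_def mult_less_0_iff mult_pos_neg)
  have x5: "side D E H < 0" using s by (simp add: B0 pts)
  have x6: "side A H B > 0" using co by (simp add: side_from_top)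
  have x7: "above_ell1 lam B > 0"
  proof -
    have "fst B - 1/2 - lam > 0" using lam power_strict_mono[of lam 1 2] by (simp add: B0 corner_P0_def)
    then have "(2 * lam - lam^3) * (fst B - 1/2 - lam) > 0" using g by simp
    moreover have "above_ell1 lam B = (2 * lam - lam^3) * (fst B - 1/2 - lam) + lam^3 / 2"
      by (simp add: above_ell1_def co(3))
    ultimately show ?thesis using g(6) by linarith
  qed
  have z1: "fst z < 1" using z(3) zero_le_power2[of lam] by linarith
  have x8: "side D E z < 0"
  proof -
    have zy: "snd z \<ge> 1 - 2 * lam" using below_top_bound[OF lam] z(2) z1 by simp
    have a: "1 - fst E \<le> 4 * lam^3" "4 / 10 * lam^2 \<le> snd D - snd E" "0 \<le> 1 - fst E" using s by (auto simp: pts)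
    have "(1 - fst E) * (snd D - snd z) \<le> (1 - fst E) * (2 * lam)"
      using co zy by (intro mult_left_mono) auto
    also have "\<dots> \<le> (4 * lam^3) * (2 * lam)" using a lam by (intro mult_right_mono) auto
    also have "\<dots> < 4 / 10 * lam^2 * (30 * lam^2)" using lam by (simp add: eval_nat_numeral)
    also have "\<dots> \<le> 4 / 10 * lam^2 * (1 - fst z)" using z(3) lam by (intro mult_left_mono) auto
    also have "\<dots> \<le> (snd D - snd E) * (1 - fst z)"
      using a z1 by (intro mult_right_mono) auto
    finally show ?thesis using co(7) by (simp add: side_def algebra_simps)
  qed
  define L where "L i = [\<lambda>z. 1 - snd z, \<lambda>z. - side B C z, \<lambda>z. 1 - fst z, \<lambda>z. - side D E z, above_ell1 lam, side A H] ! i" for i :: nat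
  have L: "L 0 = (\<lambda>z. 1 - snd z)" "L (Suc 0) = (\<lambda>z. - side B C z)"
    "L 2 = (\<lambda>z. 1 - fst z)" "L 3 = (\<lambda>z. - side D E z)" "L 4 = above_ell1 lam" "L 5 = side A H"
    "L (Suc (Suc 0)) = (\<lambda>z. 1 - fst z)"
    by (simp_all add: L_def)
  have "z \<in> polygon [A, B, C, D, E, H]"
  proof (rule half_plane_region_subset_polygon[where L = L])
    fix i assume "i < length [A, B, C, D, E, H]"
    then have i: "i = 0 \<or> i = 1 \<or> i = 2 \<or> i = 3 \<or> i = 4 \<or> i = 5" by auto
    show "affine_form (L i)"
      using i by (auto simp: L affine_form_right_top affine_form_side affine_form_above_ell1)
    show "L i ([A, B, C, D, E, H] ! i) = 0 \<and> L i ([A, B, C, D, E, H] ! (Suc i mod length [A, B, C, D, E, H])) = 0"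
      using i co by (auto simp: L)
    show "L (Suc i mod length [A, B, C, D, E, H]) ([A, B, C, D, E, H] ! i) > 0"
      using i co x1 x2 x3 by (auto simp: L)
    show "L i ([A, B, C, D, E, H] ! (Suc (Suc i mod length [A, B, C, D, E, H]) mod length [A, B, C, D, E, H])) > 0"
      using i co x4 x5 x6 x7 by (auto simp: L)
    show "L i z > 0" using i z z1 x8 by (auto simp: L pts)
  qed simp
  then show ?thesis by (simp add: Lambda_out_def pts)
qed

text \<open>
  The index is the first \<open>m \<ge> 2\<close> whose cut lies to the left of the point. The cut for \<open>m = M - 1\<close> lies
  within \<open>O(\<lambda>)\<close> of the left end of the strip, so that there is one. If \<open>m = 2\<close>, then the line through
  \<open>P0 1\<close> and \<open>P''\<close> decides between the first two polygons.
\<close>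

lemma in_Lambda_out_exists:
  assumes lam: "0 < lam" "lam \<le> 1 / 100" and c: "corner_shape lam"
    and z: "snd z < 1" "above_ell1 lam z > 0" "fst z > 1/2 + 10 * lam" "fst z < 1 - 30 * lam^2"
    and off: "side (P0 lam 1) (P'' lam) z \<noteq> 0"
      "\<And>m. 2 \<le> m \<Longrightarrow> m \<le> Mmax lam - 1 \<Longrightarrow> side (P0 lam m) (P1 lam m) z \<noteq> 0"
  shows "\<exists>m\<in>{1..Mmax lam}. z \<in> Lambda_out lam m"
proof -
  define M where "M = Mmax lam"
  note Mb = Mmax_bounds[OF lam, folded M_def]
  define k where "k = M - 1"
  have k: "2 \<le> k" "real k = real M - 1" "k \<le> M" using Mb(3) by (auto simp: k_def)
  have l1: "lam \<le> 1" using lam by simp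
  have th: "0 < theta lam" "theta lam \<le> lam" using theta_facts[OF lam(1) l1] theta_le[OF lam(1) l1] by auto
  note cf = cut_facts[OF lam k(1)]
  have ratio: "cot_ratio lam j \<le> lam" if "j = k \<or> j = k - 1" for j
  proof (rule cot_ratio_le[OF lam])
    show "j \<le> Mmax lam - 1" using that by (auto simp: k_def M_def)
    have "real j \<ge> real M - 2" using that k by auto
    then have "(2 * real M + 3) * theta lam - 6 * theta lam \<le> (2 * real j + 1) * theta lam"
      using th mult_right_mono[of "2 * real M - 3" "2 * real j + 1" "theta lam"] by (simp add: algebra_simps)
    then show "pi / 4 \<le> (2 * real j + 1) * theta lam" using Mb(2) th lam pi_gt3 by linarith
  qed
  have "side (P0 lam k) (P1 lam k) z > 0"
  proof (rule right_of_cut[OF lam])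
    show "snd (P0 lam k) = 1" "above_ell1 lam (P0 lam k) > 0" "above_ell1 lam (P1 lam k) = 0" "snd (P1 lam k) < 1"
      using cf by (auto simp: k_def M_def)
    show "fst z > fst (P0 lam k)" using ratio[of k] z(3) lam by (simp add: P0_eq)
    define t where "t = cot_ratio lam (k - 1)"
    have t: "t \<le> lam" "0 \<le> t"
    proof -
      have "Suc (k - 1) \<le> Mmax lam - 1" using k by (simp add: k_def M_def)
      then have "lam^2 \<le> t" using cot_ratio_facts(3)[OF lam, of "k - 1"] by (simp add: t_def)
      then show "0 \<le> t" using zero_le_power2[of lam] by linarith
    qed (use ratio[of "k - 1"] in \<open>simp add: t_def\<close>)
    have l4: "lam^4 \<le> lam^2" "lam^2 \<ge> 0" using lam by (auto intro: power_decreasing)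
    then have "1 - 3 * lam^2 + lam^4 \<le> 1" by linarith
    then have "(1 - 3 * lam^2 + lam^4) * t \<le> 1 * t" using t by (intro mult_right_mono) auto
    moreover have "2 * fst (P1 lam k) = 1 + 2 * lam - lam^2 + lam^4 + (1 - 3 * lam^2 + lam^4) * t"
      unfolding t_def by (simp add: P1_eq[OF k(1)] ell1_point_def)
    ultimately have "2 * fst (P1 lam k) \<le> 1 + 2 * lam + lam" using t(1) l4(1) by linarith
    then show "fst z > fst (P1 lam k)" using z(3) lam(1) by linarith
  qed (use z in auto)
  then have ex: "2 \<le> k \<and> side (P0 lam k) (P1 lam k) z > 0" using k by simp
  define m where "m = (LEAST m. 2 \<le> m \<and> side (P0 lam m) (P1 lam m) z > 0)"
  have m: "2 \<le> m" "side (P0 lam m) (P1 lam m) z > 0" "m \<le> k"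
    unfolding m_def using LeastI[of "\<lambda>m. 2 \<le> m \<and> side (P0 lam m) (P1 lam m) z > 0", OF ex]
      Least_le[of "\<lambda>m. 2 \<le> m \<and> side (P0 lam m) (P1 lam m) z > 0", OF ex] by auto
  show ?thesis
  proof (cases "m = 2")
    case True
    then have "z \<in> Lambda_out lam 1 \<or> z \<in> Lambda_out lam 2"
      using in_Lambda_out_1[OF lam c z(1,2,4)] in_Lambda_out_2[OF lam c z(1,2,4)] m(2) off(1) by force
    then show ?thesis using Mb(3) by (force simp: M_def)
  next
    case False
    then have m3: "3 \<le> m" using m(1) by simp
    have "\<not> (2 \<le> m - 1 \<and> side (P0 lam (m - 1)) (P1 lam (m - 1)) z > 0)"
      using not_less_Least[of "m - 1" "\<lambda>m. 2 \<le> m \<and> side (P0 lam m) (P1 lam m) z > 0"] m3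
      by (auto simp: m_def[symmetric])
    then have "side (P0 lam (m - 1)) (P1 lam (m - 1)) z < 0"
      using off(2)[of "m - 1"] m3 m(3) by (force simp: k_def M_def)
    then have "z \<in> Lambda_out lam m"
      using in_Lambda_out_ge_3[OF lam m3 _ z(1,2) m(2)] m(3) by (simp add: k_def M_def)
    then show ?thesis using m3 m(3) k(3) by (auto simp: M_def)
  qed
qed

section \<open>Counting the uncovered area\<close>

lemma null_sets_affine_form:
  assumes "affine_form f" "f w \<noteq> 0"
  shows "{z. f z = 0} \<in> null_sets lborel"
proof -
  obtain a b d where f: "f = (\<lambda>z. a * fst z + b * snd z + d)"
    using assms(1) unfolding affine_form_def by blast
  have cl: "closed {z. f z = 0}"
    using affine_form_continuous[OF assms(1)] by (intro closed_Collect_eq) auto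
  have "negligible {z. f z = 0}"
  proof (cases "a = 0 \<and> b = 0")
    case True
    then have "{z. f z = 0} = {}" using assms(2) by (auto simp: f)
    then show ?thesis by (simp only: negligible_empty)
  next
    case False
    then have "negligible {z. (a, b) \<bullet> z = - d}"
      by (intro negligible_hyperplane) (auto simp: prod_eq_iff)
    also have "{z. (a, b) \<bullet> z = - d} = {z. f z = 0}"
      by (auto simp: f inner_prod_def)
    finally show ?thesis .
  qed
  then have "{z. f z = 0} \<in> null_sets (completion lborel)" by (simp add: negligible_iff_null_sets)
  then show ?thesis using null_sets_completion_iff[of "{z. f z = 0}" lborel] cl by simp
qed

lemma emeasure_rectangle:
  fixes a b c d :: real
  assumes "a \<le> b" "c \<le> d"
  shows "emeasure lborel ({a..b} \<times> {c..d}) = ennreal ((b - a) * (d - c))"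
proof -
  have "emeasure (lborel \<Otimes>\<^sub>M lborel) ({a..b} \<times> {c..d}) = emeasure lborel {a..b} * emeasure lborel {c..d}"
    by (intro lborel.emeasure_pair_measure_Times) auto
  then show ?thesis using assms by (simp add: lborel_prod ennreal_mult)
qed

lemma bounded_polygon: "bounded (polygon vs)"
proof -
  have "bounded (polygon_boundary vs)"
    unfolding polygon_boundary_def by (intro compact_imp_bounded compact_UN) auto
  then show ?thesis
    unfolding polygon_def by (simp add: bounded_Un bounded_inside)
qed

lemma zero_area_null:
  assumes lam: "0 < lam" "lam \<le> 1" and "\<not> area lam (Lambda_out lam m \<inter> Lambda_in lam n) > 0"
  shows "Lambda_out lam m \<inter> Lambda_in lam n \<in> null_sets lborel"
proof -
  let ?A = "Lambda_out lam m \<inter> Lambda_in lam n"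
  have A: "?A \<in> sets borel" using Lambda_borel by auto
  have "bounded ?A" using bounded_polygon by (auto simp: Lambda_in_def intro: bounded_Int)
  then have fin: "emeasure lborel ?A < \<infinity>" by (rule emeasure_bounded_finite)
  have "1 - lam^2 / 4 > 0" using lam power_le_one[of lam 2] by simp
  then have "sqrt (1 - (lam / 2)\<^sup>2) > 0" by (simp add: power_divide)
  then have "measure lborel ?A = 0"
    using assms(3) measure_nonneg[of lborel ?A] by (auto simp: area_def Qform_def zero_less_mult_iff)
  then have "emeasure lborel ?A = 0" using fin by (auto simp: measure_def enn2real_eq_0_iff)
  then show ?thesis using A by auto
qed

text \<open>
  An intersection of polygons with area \<open>0\<close> is not an atom and may be missed.
\<close>

definition missed_strip :: "real \<Rightarrow> point set" where
  "missed_strip lam = entry_strip lam - \<Union>(regular_atoms lam)"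

lemma finite_regular_atoms: "finite (regular_atoms lam)" "regular_atoms lam \<subseteq> sets borel"
proof -
  have "regular_atoms lam
        \<subseteq> (\<lambda>(m, n). Lambda_out lam m \<inter> Lambda_in lam n) ` ({1..Mmax lam} \<times> {1..Nmax lam - 1})"
    by (auto simp: regular_atoms_def)
  then show "finite (regular_atoms lam)" by (rule finite_subset) auto
  show "regular_atoms lam \<subseteq> sets borel" by (auto simp: regular_atoms_def Lambda_borel)
qed

lemma entry_strip_alt: "entry_strip lam = Omega \<inter> {z. above_ell1 lam z \<ge> 0}"
  by (auto simp: entry_strip_def snd_Rinv_pow_4_eq)

lemma missed_strip_borel: "missed_strip lam \<in> sets borel" "missed_strip lam \<subseteq> Omega"
proof -
  have "closed {z. above_ell1 lam z \<ge> 0}"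
    using affine_form_continuous[OF affine_form_above_ell1] by (intro closed_Collect_le) auto
  then have "entry_strip lam \<in> sets borel" unfolding entry_strip_alt using Omega_borel by auto
  moreover have "\<Union>(regular_atoms lam) \<in> sets borel"
    using finite_regular_atoms by (intro sets.finite_Union)
  ultimately show "missed_strip lam \<in> sets borel" by (auto simp: missed_strip_def)
  show "missed_strip lam \<subseteq> Omega" by (auto simp: missed_strip_def entry_strip_def)
qed

text \<open>
  The missed points lie in a box of size \<open>10 \<lambda> \<times> 20 \<lambda>\<^sup>2\<close> at the left end of the strip, in a box of size
  \<open>30 \<lambda>\<^sup>2 \<times> 2 \<lambda>\<close> at its right end, on one of the lines that separate the polygons, or in an
  intersection of polygons that has area \<open>0\<close>.
\<close>

lemma emeasure_missed_strip:
  assumes lam: "0 < lam" "lam \<le> 1 / 100" and c: "corner_shape lam"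
  shows "emeasure lborel (missed_strip lam) \<le> ennreal (260 * lam^3)"
proof -
  have l1: "lam \<le> 1" "lam < 1" using lam by auto
  note g = gradient_bounds[OF lam]
  note s = c[unfolded corner_shape_def]
  define R1 where "R1 = {1/2..1/2 + 10 * lam} \<times> {1 - 20 * lam^2..1}"
  define R2 where "R2 = {1 - 30 * lam^2..1} \<times> {1 - 2 * lam..1}"
  \<comment> \<open>the lines on which the polygons meet, and the intersections of polygons that are not atoms\<close>
  define N1 where "N1 = {z. above_ell1 lam z = 0}"
  define N2 where "N2 = (\<Union>n. {z. tang lam (exit_angle lam n) z - apothem lam = 0})"
  define N3 where "N3 = {z. side (P0 lam 1) (P'' lam) z = 0}"
  define N4 where "N4 = (\<Union>m\<in>{2..Mmax lam - 1}. {z. side (P0 lam m) (P1 lam m) z = 0})"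
  define N5 where "N5 = (\<Union>m n. if area lam (Lambda_out lam m \<inter> Lambda_in lam n) > 0 then {}
      else Lambda_out lam m \<inter> Lambda_in lam n)"
  define N where "N = N1 \<union> N2 \<union> N3 \<union> N4 \<union> N5"
  have M2: "2 \<le> Mmax lam - 1" using Mmax_bounds(3)[OF lam] by simp
  have "N1 \<in> null_sets lborel"
    unfolding N1_def using affine_form_above_ell1 cut_facts(3)[OF lam order_refl M2]
    by (intro null_sets_affine_form[where w = "P0 lam 2"]) auto
  moreover have "N2 \<in> null_sets lborel"
    unfolding N2_def
  proof (intro null_sets_UN null_sets_affine_form)
    fix n show "affine_form (\<lambda>z. tang lam (exit_angle lam n) z - apothem lam)" by (rule affine_form_tang)
    show "tang lam (exit_angle lam n) (centre lam) - apothem lam \<noteq> 0"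
      using tang_centre_add[of lam "exit_angle lam n" 0 0] apothem_pos[OF lam(1) l1(2)]
      by (simp add: zero_prod_def[symmetric])
  qed
  moreover have "N3 \<in> null_sets lborel"
    unfolding N3_def
  proof (rule null_sets_affine_form)
    have P: "P0 lam 1 = corner_P0 lam" using corner_points(1)[OF lam] .
    have "side (P0 lam 1) (P'' lam) (1, 1) = (1 - snd (P'' lam)) * (1 - fst (P0 lam 1))"
      unfolding P by (subst side_from_top) (auto simp: corner_P0_def)
    then show "side (P0 lam 1) (P'' lam) (1, 1) \<noteq> 0" using s unfolding P by simp
  qed (rule affine_form_side)
  moreover have "N4 \<in> null_sets lborel"
    unfolding N4_def
  proof (intro null_sets.finite_UN null_sets_affine_form)
    fix m assume m: "m \<in> {2..Mmax lam - 1}"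
    show "affine_form (side (P0 lam m) (P1 lam m))" by (rule affine_form_side)
    note cf = cut_facts[OF lam, of m]
    have "side (P0 lam m) (P1 lam m) (P0 lam (m - 1)) = (1 - snd (P1 lam m)) * (fst (P0 lam (m - 1)) - fst (P0 lam m))"
      by (rule side_from_top) (simp_all add: P0_eq)
    then show "side (P0 lam m) (P1 lam m) (P0 lam (m - 1)) \<noteq> 0" using cf m by simp
  qed auto
  moreover have "N5 \<in> null_sets lborel"
    unfolding N5_def by (intro null_sets_UN) (use zero_area_null[OF lam(1) l1(1)] in auto)
  ultimately have N: "N \<in> null_sets lborel" unfolding N_def by (intro null_sets.Un)
  have sub: "missed_strip lam \<subseteq> (R1 \<union> R2) \<union> N"
  proof
    fix z assume z: "z \<in> missed_strip lam"
    then have zO: "0 \<le> fst z" "fst z < 1" "snd z < 1" and ab: "above_ell1 lam z \<ge> 0"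
      by (auto simp: missed_strip_def entry_strip_alt Omega_def)
    have ge: "snd z \<ge> 1 - 2 * lam" using below_top_bound[OF lam ab zO(2)] .
    show "z \<in> (R1 \<union> R2) \<union> N"
    proof (rule ccontr)
      assume no: "\<not> ?thesis"
      then have zN: "z \<notin> N1" "z \<notin> N2" "z \<notin> N3" "z \<notin> N4" "z \<notin> N5" by (auto simp: N_def)
      have x2: "fst z < 1 - 30 * lam^2"
        using no ge zO by (cases z) (auto simp: R2_def)
      have x1: "fst z > 1/2 + 10 * lam"
      proof (rule ccontr)
        assume le: "\<not> ?thesis"
        define G H where "G = 1 - 3 * lam^2 + lam^4" and "H = 2 * lam - lam^3"
        have e: "G * (1 - snd z) \<le> H * (fst z - 1/2 - lam) + lam^3 / 2"
          using ab by (simp add: above_ell1_def G_def H_def algebra_simps)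
        have G: "99 / 100 \<le> G" and H: "lam \<le> H" "H \<le> 2 * lam" using g by (auto simp: G_def H_def)
        have "lam^3 = lam * lam^2" by (simp add: eval_nat_numeral)
        then have l3: "lam^3 \<le> lam^2 / 100" using mult_right_mono[OF lam(2), of "lam^2"] by simp
        have lp: "lam^2 > 0" using lam by simp
        have a: "fst z \<ge> 1/2"
        proof (rule ccontr)
          assume "\<not> ?thesis"
          then have "H * (fst z - 1/2 - lam) \<le> H * (- lam)" using H lam by (intro mult_left_mono) auto
          also have "\<dots> \<le> lam * (- lam)" using H lam by (intro mult_right_mono_neg) auto
          finally have "H * (fst z - 1/2 - lam) + lam^3 / 2 < 0" using l3 lp by (simp add: power2_eq_square)
          moreover have "0 \<le> G * (1 - snd z)" using G zO by simp
          ultimately show False using e by linarith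
        qed
        have "H * (fst z - 1/2 - lam) \<le> H * (9 * lam)" using le H lam by (intro mult_left_mono) auto
        also have "\<dots> \<le> 2 * lam * (9 * lam)" using H lam by (intro mult_right_mono) auto
        finally have up: "G * (1 - snd z) \<le> 18 * lam^2 + lam^3 / 2" using e by (simp add: power2_eq_square)
        have "99 / 100 * (1 - snd z) \<le> G * (1 - snd z)" using G zO by (intro mult_right_mono) auto
        then have "99 / 100 * (1 - snd z) \<le> 18 * lam^2 + lam^3 / 2" using up by linarith
        then have "99 * (1 - snd z) \<le> 1800 * lam^2 + 50 * lam^3" by (simp add: field_simps)
        moreover have "100 * lam^3 \<le> lam^2" using l3 by simp
        ultimately have "99 * (1 - snd z) \<le> 99 * (20 * lam^2)" using lp by linarith
        then have "snd z \<ge> 1 - 20 * lam^2" by simp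
        then have "z \<in> R1" using a le zO by (cases z) (auto simp: R1_def)
        then show False using no by blast
      qed
      have ab': "above_ell1 lam z > 0" using ab zN(1) by (auto simp: N1_def)
      have "tang lam (4 * theta lam) z > apothem lam"
        using snd_Rinv_pow_4[OF lam(1) l1(1), of z] ab' by (simp add: snd_Rinv_pow_4_eq apothem_def)
      then obtain n where n: "n \<in> {1..Nmax lam - 1}" "z \<in> Lambda_in lam n"
        using in_Lambda_in_exists[OF lam zO(3) _ zO(2) x1] zN(2) by (force simp: N2_def)
      obtain m where m: "m \<in> {1..Mmax lam}" "z \<in> Lambda_out lam m"
        using in_Lambda_out_exists[OF lam c zO(3) ab' x1 x2] zN(3,4) by (force simp: N3_def N4_def)
      have "area lam (Lambda_out lam m \<inter> Lambda_in lam n) > 0"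
        using zN(5) m(2) n(2) unfolding N5_def by (auto split: if_splits)
      then have "Lambda_out lam m \<inter> Lambda_in lam n \<in> regular_atoms lam"
        using m(1) n(1) unfolding regular_atoms_def by blast
      then show False using z m(2) n(2) unfolding missed_strip_def by blast
    qed
  qed
  have l2: "lam^2 \<le> lam / 100" using mult_left_mono[OF lam(2), of lam] lam by (simp add: power2_eq_square)
  have "emeasure lborel (missed_strip lam) \<le> emeasure lborel ((R1 \<union> R2) \<union> N)"
    using sub N by (intro emeasure_mono) (auto simp: R1_def R2_def closed_Times)
  also have "\<dots> = emeasure lborel (R1 \<union> R2)"
    using N by (intro emeasure_Un_null_set) (auto simp: R1_def R2_def closed_Times)
  also have "\<dots> \<le> emeasure lborel R1 + emeasure lborel R2"
    by (intro emeasure_subadditive) (auto simp: R1_def R2_def closed_Times)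
  also have "\<dots> = ennreal (10 * lam * (20 * lam^2)) + ennreal (30 * lam^2 * (2 * lam))"
    unfolding R1_def R2_def using lam by (subst (1 2) emeasure_rectangle) auto
  also have "\<dots> = ennreal (260 * lam^3)"
    using lam by (subst ennreal_plus[symmetric]) (auto simp: eval_nat_numeral)
  finally show ?thesis .
qed

lemma main_island_alt: "main_island lam = {z. rho lam z \<le> rhoE lam}"
  by (simp add: main_island_def rho_def rhoE_def)

lemma main_island_subset:
  assumes lam: "0 < lam" "lam \<le> 1"
  shows "main_island lam \<subseteq> {0..1} \<times> {0..1}"
proof
  fix z assume z: "z \<in> main_island lam"
  obtain u v where uv: "z = (u, v)" by (cases z)
  define c where "c = 1 / (2 - lam)"
  have k: "1 - lam\<^sup>2 / 4 > 0" using lam power_le_one[of lam 2] by simp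
  have a: "(1 - lam) / (2 - lam) = 1 - c" "1 - c \<ge> 0" "1/2 \<le> c" using lam by (auto simp: c_def field_simps)
  have sym: "rho lam (u, v) = rho lam (v, u)" by (simp add: rho_alt algebra_simps)
  have le: "(x - c)\<^sup>2 \<le> (1 - c)\<^sup>2" if "rho lam (x, y) \<le> rhoE lam" for x y
  proof -
    have "(1 - lam\<^sup>2 / 4) * (x - c)\<^sup>2 \<le> rho lam (x, y)" unfolding rho_squares c_def by simp
    also have "\<dots> \<le> (1 - lam\<^sup>2 / 4) * (1 - c)\<^sup>2" using that by (simp add: rhoE_def a(1))
    finally show ?thesis using k by simp
  qed
  have in_unit: "0 \<le> x \<and> x \<le> 1" if "(x - c)\<^sup>2 \<le> (1 - c)\<^sup>2" for x
    using that a abs_le_square_iff[of "x - c" "1 - c"] by auto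
  have "rho lam (u, v) \<le> rhoE lam" using z by (simp add: main_island_alt uv)
  then show "z \<in> {0..1} \<times> {0..1}"
    using in_unit[OF le, of u v] in_unit[OF le, of v u] sym by (simp add: uv)
qed

text \<open>
  Contains the ellipses outside the island on which an orbit of the rotation can avoid leaving the
  square.
\<close>

definition tangent_annulus :: "real \<Rightarrow> point set" where
  "tangent_annulus lam = {z. rhoE lam < rho lam z \<and> rho lam z < (1 + lam\<^sup>2)\<^sup>2 * rhoE lam}"

text \<open>
  The region inside the outer ellipse is the island scaled by \<open>1 + \<lambda>\<^sup>2\<close>, and the island fits into the
  unit square.
\<close>

lemma emeasure_tangent_annulus:
  assumes lam: "0 < lam" "lam \<le> 1"
  shows "emeasure lborel (tangent_annulus lam) \<le> ennreal (3 * lam^2)"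
proof -
  define s where "s = 1 + lam\<^sup>2"
  define d where "d = centre lam - s *\<^sub>R centre lam"
  define I where "I = main_island lam"
  have l2: "0 < lam\<^sup>2" "lam\<^sup>2 \<le> 1" using lam by (auto simp: power_le_one)
  have s: "s > 1" using l2 by (simp add: s_def)
  have I: "I \<in> sets borel" by (simp add: I_def main_island_borel)
  have "emeasure lborel I \<le> emeasure lborel ({0..1} \<times> {0..1} :: point set)"
    unfolding I_def using main_island_subset[OF lam] by (intro emeasure_mono) (auto simp: closed_Times)
  also have "\<dots> = 1" by (subst emeasure_rectangle) auto
  finally have I1: "emeasure lborel I \<le> 1" .
  define J where "J = (\<lambda>x. s *\<^sub>R x + d) ` I"
  have eJ: "emeasure lebesgue J = \<bar>s\<bar> ^ DIM(point) * emeasure lebesgue I"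
    unfolding J_def by (rule emeasure_lebesgue_affine)
  have scale: "rho lam (s *\<^sub>R w + d) = s\<^sup>2 * rho lam w" for w
  proof -
    have "s *\<^sub>R w + d - centre lam = s *\<^sub>R (w - centre lam)" by (simp add: d_def algebra_simps)
    show ?thesis
      unfolding rho_def \<open>s *\<^sub>R w + d - centre lam = s *\<^sub>R (w - centre lam)\<close>
      by (simp add: Qform_def power2_eq_square algebra_simps)
  qed
  have Jalt: "J = {z. rho lam z \<le> s\<^sup>2 * rhoE lam}"
  proof (intro set_eqI iffI)
    fix z assume "z \<in> J"
    then obtain w where "w \<in> I" "z = s *\<^sub>R w + d" unfolding J_def by blast
    then show "z \<in> {z. rho lam z \<le> s\<^sup>2 * rhoE lam}"
      using s by (simp only: scale mem_Collect_eq) (simp add: I_def main_island_alt)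
  next
    fix z assume z: "z \<in> {z. rho lam z \<le> s\<^sup>2 * rhoE lam}"
    define w where "w = (1 / s) *\<^sub>R (z - d)"
    have zw: "z = s *\<^sub>R w + d" using s by (simp add: w_def)
    have "s\<^sup>2 * rho lam w \<le> s\<^sup>2 * rhoE lam" using z unfolding zw by (simp only: scale mem_Collect_eq)
    then have "w \<in> I" using s by (simp add: I_def main_island_alt)
    then show "z \<in> J" unfolding J_def using zw by blast
  qed
  have contr: "continuous_on UNIV (rho lam)" unfolding rho_def Qform_def by (intro continuous_intros)
  have Jb: "J \<in> sets borel"
    unfolding Jalt using contr by (intro borel_closed closed_Collect_le continuous_intros) auto
  have IJ: "I \<subseteq> J"
  proof -
    have "rhoE lam \<ge> 0" using l2 by (simp add: rhoE_def)
    then have "1 * rhoE lam \<le> s\<^sup>2 * rhoE lam" using s one_le_power[of s 2] by (intro mult_right_mono) auto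
    then show ?thesis by (auto simp: Jalt I_def main_island_alt)
  qed
  have sq: "\<bar>s\<bar> ^ DIM(point) = s\<^sup>2" using s by (simp add: power2_eq_square)
  have "tangent_annulus lam \<subseteq> J - I"
    by (auto simp: tangent_annulus_def Jalt I_def main_island_alt s_def)
  then have "emeasure lborel (tangent_annulus lam) \<le> emeasure lborel (J - I)"
    using Jb I by (intro emeasure_mono) auto
  also have "\<dots> = emeasure lborel J - emeasure lborel I"
    using Jb I IJ I1 by (intro emeasure_Diff) (auto simp: top_unique)
  also have "emeasure lborel J = ennreal (s\<^sup>2) * emeasure lborel I"
    using eJ Jb I unfolding sq by simp
  also have "ennreal (s\<^sup>2) * emeasure lborel I - emeasure lborel I \<le> ennreal (3 * lam^2)"
  proof -
    define x where "x = measure lborel I"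
    have x: "emeasure lborel I = ennreal x" "0 \<le> x" "x \<le> 1"
    proof -
      have "emeasure lborel I \<noteq> \<infinity>" using I1 by (auto simp: top_unique)
      then show e: "emeasure lborel I = ennreal x" unfolding x_def by (simp add: emeasure_eq_ennreal_measure)
      show "0 \<le> x" unfolding x_def by (rule measure_nonneg)
      show "x \<le> 1" using I1 unfolding e by simp
    qed
    have "ennreal (s\<^sup>2) * ennreal x - ennreal x = ennreal (s\<^sup>2 * x - x)"
      using x by (simp add: ennreal_mult[symmetric] ennreal_minus)
    also have "\<dots> \<le> ennreal (3 * lam^2)"
    proof (rule ennreal_leI)
      have "s\<^sup>2 * x - x = lam\<^sup>2 * (2 + lam\<^sup>2) * x" by (simp add: s_def power2_eq_square algebra_simps)
      also have "\<dots> \<le> lam\<^sup>2 * 3 * 1" using l2 x by (intro mult_mono) auto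
      finally show "s\<^sup>2 * x - x \<le> 3 * lam\<^sup>2" by simp
    qed
    finally show ?thesis unfolding x .
  qed
  finally show ?thesis .
qed

lemma emeasure_edge_junctions:
  assumes "0 < lam" "lam \<le> 1 / 100"
  shows "emeasure lborel (edge_junctions lam) \<le> ennreal (48 * lam^2)" "edge_junctions lam \<in> sets borel"
proof -
  let ?R = "\<lambda>a b. {0..lam} \<times> {a..b::real}"
  have e: "edge_junctions lam = ?R 0 (12 * lam) \<union> ?R (1/2 - 12 * lam) (1/2 + 12 * lam) \<union> ?R (1 - 12 * lam) 1"
    by (auto simp: edge_junctions_def)
  have b: "?R a b \<in> sets borel" for a b by (auto simp: closed_Times)
  show "edge_junctions lam \<in> sets borel" unfolding e using b by (intro sets.Un)
  have "emeasure lborel (edge_junctions lam)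
      \<le> emeasure lborel (?R 0 (12 * lam) \<union> ?R (1/2 - 12 * lam) (1/2 + 12 * lam)) + emeasure lborel (?R (1 - 12 * lam) 1)"
    unfolding e using b by (intro emeasure_subadditive) auto
  also have "\<dots> \<le> emeasure lborel (?R 0 (12 * lam)) + emeasure lborel (?R (1/2 - 12 * lam) (1/2 + 12 * lam))
      + emeasure lborel (?R (1 - 12 * lam) 1)"
    using b by (intro add_right_mono emeasure_subadditive) auto
  also have "\<dots> = ennreal (lam * (12 * lam)) + ennreal (lam * (24 * lam)) + ennreal (lam * (12 * lam))"
    using assms by (simp add: emeasure_rectangle)
  also have "\<dots> = ennreal (48 * lam^2)"
    using assms by (simp add: ennreal_plus[symmetric] power2_eq_square del: ennreal_plus)
  finally show "emeasure lborel (edge_junctions lam) \<le> ennreal (48 * lam^2)" .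
qed

lemma uncovered_subset:
  fixes lam :: real
  assumes lam: "0 < lam" "lam \<le> 1 / 100"
  shows "(Omega - main_island lam) - atom_orbits lam
    \<subseteq> tangent_annulus lam \<union> (\<Union>j\<in>{..<3}. (F lam ^^ j) ` (edge_junctions lam \<inter> Omega))
      \<union> (\<Union>t\<in>{..nat (floor (40 / lam))}. (F lam ^^ t) ` missed_strip lam)"
proof
  fix z assume z: "z \<in> (Omega - main_island lam) - atom_orbits lam"
  then have O: "z \<in> Omega" and out: "rho lam z > rhoE lam" by (auto simp: main_island_alt)
  have img: "z \<in> (F lam ^^ t) ` X" if "(Finv lam ^^ t) z \<in> X" for t X
    using F_pow_Finv_pow[OF O, where lam = lam and t = t] imageI[OF that, of "F lam ^^ t"] by simp
  have inO: "(Finv lam ^^ t) z \<in> Omega" for t using Finv_pow_in_Omega[OF O] .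
  show "z \<in> tangent_annulus lam \<union> (\<Union>j\<in>{..<3}. (F lam ^^ j) ` (edge_junctions lam \<inter> Omega))
      \<union> (\<Union>t\<in>{..nat (floor (40 / lam))}. (F lam ^^ t) ` missed_strip lam)"
  proof (cases "z \<in> tangent_annulus lam")
    case False
    then have "rho lam z \<ge> (1 + lam\<^sup>2)\<^sup>2 * rhoE lam" using out by (auto simp: tangent_annulus_def)
    from reaches_strip_or_edge_junction[OF lam O this] show ?thesis
    proof (elim disjE exE conjE)
      assume "reaches_strip lam (40 / lam) z"
      then obtain t where t: "real t \<le> 40 / lam" "(Finv lam ^^ t) z \<in> entry_strip lam"
        unfolding reaches_strip_def by blast
      have "(Finv lam ^^ t) z \<notin> \<Union>(regular_atoms lam)"
      proof
        assume "(Finv lam ^^ t) z \<in> \<Union>(regular_atoms lam)"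
        then have "z \<in> (F lam ^^ t) ` (\<Union>(regular_atoms lam) \<inter> Omega)" using img inO by blast
        then show False using z unfolding atom_orbits_def by blast
      qed
      then have "z \<in> (F lam ^^ t) ` missed_strip lam" using img t(2) by (simp add: missed_strip_def)
      moreover have "t \<in> {..nat \<lfloor>40 / lam\<rfloor>}" using t(1) by (simp add: le_nat_floor)
      ultimately show ?thesis by blast
    next
      fix j :: nat assume j: "j < 3" "(Finv lam ^^ j) z \<in> edge_junctions lam"
      then have "z \<in> (F lam ^^ j) ` (edge_junctions lam \<inter> Omega)" using img inO by blast
      then show ?thesis using j(1) by blast
    qed
  qed simp
qed

lemma emeasure_uncovered:
  assumes lam: "0 < lam" "lam \<le> 1 / 100" and c: "corner_shape lam"
  shows "emeasure lborel ((Omega - main_island lam) - atom_orbits lam) \<le> ennreal (11000 * lam^2)"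
proof -
  have l1: "0 \<le> lam" "lam \<le> 1" using lam by auto
  define T where "T = nat \<lfloor>40 / lam\<rfloor>"
  have T: "real T \<le> 40 / lam" using lam by (simp add: T_def)
  define X where "X = edge_junctions lam \<inter> Omega"
  have X: "X \<in> sets borel" "X \<subseteq> Omega" using emeasure_edge_junctions[OF lam] Omega_borel by (auto simp: X_def)
  have "emeasure lborel X \<le> emeasure lborel (edge_junctions lam)"
    using emeasure_edge_junctions(2)[OF lam] by (intro emeasure_mono) (auto simp: X_def)
  then have eX: "emeasure lborel X \<le> ennreal (48 * lam^2)"
    using emeasure_edge_junctions(1)[OF lam] by (rule order_trans)
  define A1 where "A1 = tangent_annulus lam"
  define A2 where "A2 = (\<Union>j\<in>{..<3}. (F lam ^^ j) ` X)"
  define A3 where "A3 = (\<Union>t\<in>{..T}. (F lam ^^ t) ` missed_strip lam)"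
  have contr: "continuous_on UNIV (rho lam)" unfolding rho_def Qform_def by (intro continuous_intros)
  have "open A1"
    unfolding A1_def tangent_annulus_def using contr
    by (intro open_Collect_conj open_Collect_less continuous_intros) auto
  then have b1: "A1 \<in> sets borel" by simp
  have b2': "(F lam ^^ j) ` X \<in> sets borel" for j using F_pow_image_borel[OF X(2,1)] by blast
  have b3': "(F lam ^^ j) ` missed_strip lam \<in> sets borel" for j
    using F_pow_image_borel missed_strip_borel by blast
  have b2: "A2 \<in> sets borel" unfolding A2_def using b2' by (intro sets.finite_UN) auto
  have b3: "A3 \<in> sets borel" unfolding A3_def using b3' by (intro sets.finite_UN) auto
  have e2: "emeasure lborel A2 \<le> ennreal (144 * lam^2)"
  proof -
    have "emeasure lborel A2 \<le> (\<Sum>j<3. emeasure lborel ((F lam ^^ j) ` X))"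
      unfolding A2_def using b2' by (intro emeasure_subadditive_finite) auto
    also have "\<dots> \<le> (\<Sum>j<3::nat. ennreal (48 * lam^2))"
      using emeasure_F_pow_image_le[OF X l1] eX by (intro sum_mono) (blast intro: order_trans)
    also have "\<dots> = ennreal (144 * lam^2)"
      by (simp add: ennreal_mult[symmetric] ennreal_of_nat_eq_real_of_nat flip: ennreal_numeral)
    finally show ?thesis .
  qed
  have e3: "emeasure lborel A3 \<le> ennreal (real (Suc T) * (260 * lam^3))"
  proof -
    have "emeasure lborel A3 \<le> (\<Sum>t\<in>{..T}. emeasure lborel ((F lam ^^ t) ` missed_strip lam))"
      unfolding A3_def using b3' by (intro emeasure_subadditive_finite) auto
    also have "\<dots> \<le> (\<Sum>t\<in>{..T}. ennreal (260 * lam^3))"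
      using emeasure_F_pow_image_le[OF missed_strip_borel l1] emeasure_missed_strip[OF lam c]
      by (intro sum_mono) (blast intro: order_trans)
    also have "\<dots> = of_nat (Suc T) * ennreal (260 * lam^3)" by simp
    also have "\<dots> = ennreal (real (Suc T) * (260 * lam^3))"
      using lam by (simp only: ennreal_of_nat_eq_real_of_nat) (simp add: ennreal_mult)
    finally show ?thesis .
  qed
  have "emeasure lborel ((Omega - main_island lam) - atom_orbits lam) \<le> emeasure lborel (A1 \<union> A2 \<union> A3)"
    using uncovered_subset[OF lam] b1 b2 b3 by (intro emeasure_mono) (auto simp: A1_def A2_def A3_def X_def T_def)
  also have "\<dots> \<le> emeasure lborel (A1 \<union> A2) + emeasure lborel A3"
    using b1 b2 b3 by (intro emeasure_subadditive) auto
  also have "\<dots> \<le> emeasure lborel A1 + emeasure lborel A2 + emeasure lborel A3"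
    using b1 b2 by (intro add_right_mono emeasure_subadditive) auto
  also have "\<dots> \<le> ennreal (3 * lam^2) + ennreal (144 * lam^2) + ennreal (real (Suc T) * (260 * lam^3))"
    using emeasure_tangent_annulus[OF lam(1) l1(2)] e2 e3 by (intro add_mono) (auto simp: A1_def)
  also have "\<dots> = ennreal (3 * lam^2 + 144 * lam^2 + real (Suc T) * (260 * lam^3))"
    using lam by (simp add: ennreal_plus[symmetric] del: ennreal_plus)
  also have "\<dots> \<le> ennreal (11000 * lam^2)"
  proof (rule ennreal_leI)
    have "real (Suc T) * lam \<le> (40 / lam + 1) * lam" using T lam by (intro mult_right_mono) auto
    also have "\<dots> \<le> 41" using lam by (simp add: field_simps)
    finally have "real (Suc T) * lam * (260 * lam^2) \<le> 41 * (260 * lam^2)" by (intro mult_right_mono) auto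
    moreover have "real (Suc T) * (260 * lam^3) = real (Suc T) * lam * (260 * lam^2)"
      by (simp add: eval_nat_numeral)
    ultimately show "3 * lam^2 + 144 * lam^2 + real (Suc T) * (260 * lam^3) \<le> 11000 * lam^2"
      using zero_le_power2[of lam] by linarith
  qed
  finally show ?thesis .
qed

theorem theorem23:
  "(\<lambda>lam. area lam ((Omega - main_island lam) - atom_orbits lam)) \<in> O[at_right 0](\<lambda>lam. lam\<^sup>2)"
proof (rule bigoI)
  have "eventually (\<lambda>lam::real. lam \<in> {0<..<1/100}) (at_right 0)"
    by (rule eventually_at_right_real) simp
  with eventually_corner_shape
  show "eventually (\<lambda>lam. norm (area lam ((Omega - main_island lam) - atom_orbits lam)) \<le> 11000 * norm (lam\<^sup>2)) (at_right 0)"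
  proof eventually_elim
    case (elim lam)
    then have lam: "0 < lam" "lam \<le> 1 / 100" by auto
    let ?U = "(Omega - main_island lam) - atom_orbits lam"
    have "measure lborel ?U \<le> 11000 * lam\<^sup>2"
      unfolding measure_def using emeasure_uncovered[OF lam elim(1)] by (intro enn2real_leI) auto
    moreover have "0 \<le> sqrt (1 - (lam / 2)\<^sup>2)" "sqrt (1 - (lam / 2)\<^sup>2) \<le> 1"
      using lam power_le_one[of lam 2] by (auto simp: power_divide)
    then have "sqrt (1 - (lam / 2)\<^sup>2) * measure lborel ?U \<le> 1 * measure lborel ?U"
      "0 \<le> sqrt (1 - (lam / 2)\<^sup>2) * measure lborel ?U"
      by (intro mult_right_mono mult_nonneg_nonneg measure_nonneg; simp)+
    ultimately show ?case by (simp add: area_def Qform_def)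
  qed
qed

end
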